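(* Let $\alpha,\beta\in(0,1]$ and $\lambda>0$. The probability law $$p_k(t;\alpha,\beta)=\Pr\{N(\mathfrak{F}^{\alpha,\beta}_t)=k\}=\frac{(-\lambda)^k}{k!}\frac{\partial^k}{\partial\lambda^k}E_\beta(-t^\beta\lambda^\alpha)$$ of the time-changed Poisson process $N(\mathfrak{F}^{\alpha,\beta}_t)$, $t>0$, is the solution to the fractional differential equation $$\left(\mathcal{D}^\beta_t+\lambda^\alpha(I-B)^\alpha\right)p_k(t;\alpha,\beta)=0,\qquad k=0,1,2,\ldots,\ t>0,$$ with initial condition $p_0(0;\alpha,\beta)=1$ and $p_k(0;\alpha,\beta)=0$ for $k\ge1$, where $$(I-B)^\alpha=\sum_{j=0}^\infty(-1)^j\binom{\alpha}{j}B^j.$$ Furthermore, for $k=1,2,\ldots$, the waiting time of the $k$-th event $$T^{\alpha,\beta}_k=\inf\{s\ge0:\ N(\mathfrak{F}^{\alpha,\beta}_s)\ge k\}$$ has density $$\frac{\Pr\{T^{\alpha,\beta}_k\in dt\}}{dt}=\frac{\beta k}{\alpha t}\,\frac{(-\lambda)^k}{k!}\frac{\partial^k}{\partial\lambda^k}E_\beta(-t^\beta\lambda^\alpha)=\frac{\beta k}{\alpha t}\,p_k(t;\alpha,\beta),$$ and $$T^{\alpha,\beta}_k\overset{law}{=}\mathfrak{F}^{\beta,\alpha}_{T_k},\qquad k=1,2,\ldots.$$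
   Context: $N$ is a homogeneous Poisson process of rate $\lambda$. For $\nu\in(0,1)$, $\mathfrak{A}^\nu$ is a $\nu$-stable subordinator with $\mathbb{E}e^{-\xi\mathfrak{A}^\nu_t}=e^{-t\xi^\nu}$ and $\mathfrak{A}^1_t=t$; $\mathfrak{L}^\nu_t=\inf\{s\ge0:\mathfrak{A}^\nu_s>t\}$ is the inverse of a $\nu$-stable subordinator ($\mathfrak{L}^1_t=t$). $\mathfrak{F}^{\alpha,\beta}_t=\mathfrak{A}^\alpha_{\mathfrak{L}^\beta_t}$ with $\mathfrak{A}^\alpha$ and $\mathfrak{L}^\beta$ independent of each other and of $N$. $T_k=\inf\{t\ge0:N(t)\ge k\}$ is the waiting time of the $k$-th event of $N$, and in $\mathfrak{F}^{\beta,\alpha}_{T_k}$ the process $\mathfrak{F}^{\beta,\alpha}$ is independent of $T_k$. $E_\beta(z)=\sum_{k\ge0}z^k/\Gamma(\beta k+1)$ is the Mittag-Leffler function. $B$ is the backward shift $Bu_k=u_{k-1}$, with $u_k=0$ for $k<0$. $\mathcal{D}^\beta_tu=\partial_t^\beta u-u(0^+)\frac{t^{-\beta}}{\Gamma(1-\beta)}$, $\partial_t^\beta u=\frac1{\Gamma(1-\beta)}\frac{\partial}{\partial t}\int_0^t\frac{u(s)ds}{(t-s)^\beta}$, is the Dzhrbashyan–Caputo derivative ($\mathcal{D}^1_t=d/dt$). *)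

theory Defs
  imports "HOL-Probability.Probability"
begin

section \<open>Stochastic processes\<close>

text \<open>
  A process is a family \<open>X :: real \<Rightarrow> 'a \<Rightarrow> _\<close> of which only the times \<open>t \<ge> 0\<close> matter.
  The processes with jumps are taken in the version all of whose paths are right-continuous and
  nondecreasing (left limits then exist automatically).
\<close>

definition indep_increments :: "'a measure \<Rightarrow> (real \<Rightarrow> 'a \<Rightarrow> real) \<Rightarrow> bool" where
  "indep_increments M X \<longleftrightarrow>
     (\<forall>(n::nat) (t::nat \<Rightarrow> real). 0 \<le> t 0 \<and> mono t \<longrightarrow>
        prob_space.indep_vars M (\<lambda>_. borel) (\<lambda>i \<omega>. X (t (Suc i)) \<omega> - X (t i) \<omega>) {..<n})"

definition poisson_process :: "'a measure \<Rightarrow> real \<Rightarrow> (real \<Rightarrow> 'a \<Rightarrow> nat) \<Rightarrow> bool" where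
  "poisson_process M lam N \<longleftrightarrow>
     prob_space M \<and>
     (\<forall>t\<ge>0. N t \<in> measurable M (count_space UNIV)) \<and>
     (\<forall>\<omega>\<in>space M. N 0 \<omega> = 0 \<and> mono_on {0..} (\<lambda>t. N t \<omega>) \<and>
        (\<forall>t\<ge>0. continuous (at_right t) (\<lambda>t. N t \<omega>))) \<and>
     indep_increments M (\<lambda>t \<omega>. real (N t \<omega>)) \<and>
     (\<forall>s t. 0 \<le> s \<and> s < t \<longrightarrow>
        distr M (count_space UNIV) (\<lambda>\<omega>. N t \<omega> - N s \<omega>) = measure_pmf (poisson_pmf (lam * (t - s))))"

definition stable_subordinator :: "'a measure \<Rightarrow> real \<Rightarrow> (real \<Rightarrow> 'a \<Rightarrow> real) \<Rightarrow> bool" where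
  "stable_subordinator M \<nu> A \<longleftrightarrow>
     prob_space M \<and>
     (if \<nu> = 1 then \<forall>t\<ge>0. \<forall>\<omega>\<in>space M. A t \<omega> = t
      else
        (\<forall>t\<ge>0. A t \<in> borel_measurable M) \<and>
        (\<forall>\<omega>\<in>space M. A 0 \<omega> = 0 \<and> mono_on {0..} (\<lambda>t. A t \<omega>) \<and>
           (\<forall>t\<ge>0. continuous (at_right t) (\<lambda>t. A t \<omega>))) \<and>
        indep_increments M A \<and>
        (\<forall>s t. 0 \<le> s \<and> s \<le> t \<longrightarrow>
           distr M borel (\<lambda>\<omega>. A t \<omega> - A s \<omega>) = distr M borel (A (t - s))) \<and>
        (\<forall>t\<ge>0. \<forall>\<xi>\<ge>0.
           prob_space.expectation M (\<lambda>\<omega>. exp (- \<xi> * A t \<omega>)) = exp (- t * \<xi> powr \<nu>)))"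

text \<open>
  The infimum of a set of times.  \<open>Inf {}\<close> is an unspecified real, so the empty set, which
  for the sets below occurs only on a null event, gets the value \<open>0\<close>.
\<close>

definition first_time :: "real set \<Rightarrow> real" where
  "first_time S = (if S = {} then 0 else Inf S)"

definition inverse_process :: "(real \<Rightarrow> 'a \<Rightarrow> real) \<Rightarrow> real \<Rightarrow> 'a \<Rightarrow> real" where
  "inverse_process A t \<omega> = first_time {s. 0 \<le> s \<and> t < A s \<omega>}"

definition time_change :: "(real \<Rightarrow> 'a \<Rightarrow> 'b) \<Rightarrow> (real \<Rightarrow> 'a \<Rightarrow> real) \<Rightarrow> real \<Rightarrow> 'a \<Rightarrow> 'b" where
  "time_change X R t \<omega> = X (R t \<omega>) \<omega>"

definition waiting_time :: "(real \<Rightarrow> 'a \<Rightarrow> nat) \<Rightarrow> nat \<Rightarrow> 'a \<Rightarrow> real" where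
  "waiting_time X k \<omega> = first_time {t. 0 \<le> t \<and> k \<le> X t \<omega>}"

text \<open>Processes as random elements of the product space of real functions on \<open>[0, \<infinity>)\<close>.\<close>

definition path_space :: "(real \<Rightarrow> real) measure" where
  "path_space = (\<Pi>\<^sub>M t\<in>{0..}. borel)"

definition path_of :: "(real \<Rightarrow> 'a \<Rightarrow> real) \<Rightarrow> 'a \<Rightarrow> real \<Rightarrow> real" where
  "path_of X \<omega> = (\<lambda>t\<in>{0..}. X t \<omega>)"

text \<open>
  The library constant \<open>indep_var\<close> forces both random elements to have values of the same type;
  this is the same notion without that restriction (cf. \<open>indep_var_eq\<close>).
\<close>

definition indep_elements ::
  "'a measure \<Rightarrow> 'b measure \<Rightarrow> ('a \<Rightarrow> 'b) \<Rightarrow> 'c measure \<Rightarrow> ('a \<Rightarrow> 'c) \<Rightarrow> bool" where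
  "indep_elements M S X T Y \<longleftrightarrow>
     X \<in> measurable M S \<and> Y \<in> measurable M T \<and>
     prob_space.indep_set M
       {X -` A \<inter> space M |A. A \<in> sets S} {Y -` B \<inter> space M |B. B \<in> sets T}"

section \<open>Fractional calculus\<close>

definition mittag_leffler :: "real \<Rightarrow> real \<Rightarrow> real" where
  "mittag_leffler \<beta> z = (\<Sum>k. z ^ k / Gamma (\<beta> * real k + 1))"

text \<open>
  \<open>has_caputo_derivative \<beta> u D t\<close>: the Dzhrbashyan--Caputo derivative of order \<open>\<beta>\<close> of \<open>u\<close> at \<open>t\<close>
  exists and equals \<open>D\<close>.  Below \<open>c\<close> is \<open>u(0+)\<close> and \<open>R\<close> is the Riemann--Liouville derivative.
\<close>

definition has_caputo_derivative :: "real \<Rightarrow> (real \<Rightarrow> real) \<Rightarrow> real \<Rightarrow> real \<Rightarrow> bool" where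
  "has_caputo_derivative \<beta> u D t \<longleftrightarrow>
     (if \<beta> = 1 then (u has_real_derivative D) (at t)
      else \<exists>c R. (u \<longlongrightarrow> c) (at_right 0) \<and>
        ((\<lambda>\<tau>. 1 / Gamma (1 - \<beta>) * (LINT s:{0..\<tau>}|lborel. u s / (\<tau> - s) powr \<beta>))
           has_real_derivative R) (at t) \<and>
        D = R - c * (t powr (- \<beta>) / Gamma (1 - \<beta>)))"

definition backward_shift :: "(nat \<Rightarrow> real) \<Rightarrow> nat \<Rightarrow> real" where
  "backward_shift u k = (if k = 0 then 0 else u (k - 1))"

definition frac_difference :: "real \<Rightarrow> (nat \<Rightarrow> real) \<Rightarrow> nat \<Rightarrow> real" where
  "frac_difference \<alpha> u k = (\<Sum>j. (-1) ^ j * (\<alpha> gchoose j) * (backward_shift ^^ j) u k)"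

text \<open>
  Solutions of the Cauchy problem are families of functions continuous on \<open>[0, \<infinity>)\<close>, which links
  the value at \<open>0\<close> to the values at \<open>t > 0\<close>.
\<close>

definition solves_frac_cauchy ::
  "real \<Rightarrow> real \<Rightarrow> real \<Rightarrow> (nat \<Rightarrow> real \<Rightarrow> real) \<Rightarrow> bool" where
  "solves_frac_cauchy \<alpha> \<beta> lam u \<longleftrightarrow>
     (\<forall>k. continuous_on {0..} (u k)) \<and>
     (\<forall>k. \<forall>t>0. \<exists>D. has_caputo_derivative \<beta> (u k) D t \<and>
        D + lam powr \<alpha> * frac_difference \<alpha> (\<lambda>j. u j t) k = 0) \<and>
     u 0 0 = 1 \<and> (\<forall>k\<ge>1. u k 0 = 0)"

end

(*
  The Laplace transform of F_t is computed by conditioning on L_t: E exp(-l F_t) = E exp(-l^alpha L_t).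
  By scaling of the stable laws, L_t has the law of (t / Y)^beta with Y = C_1, and the negative
  moments E Y^(-beta n) = n! / Gamma (beta n + 1) turn the right-hand side into the Mittag-Leffler
  function E_beta (-t^beta l^alpha).  Mixing Poisson laws shows that the generating function
  sum_k p_k z^k is this transform at l = lam (1 - z).  Expanding (1 - z)^(alpha n) by the binomial
  series gives
    p_k(t) = (-1)^k sum_n (-t^beta lam^alpha)^n binom(alpha n, k) / Gamma (beta n + 1),
  from which everything is read off termwise: the derivatives in lam, the fractional equation (by
  Vandermonde's identity binom(alpha (n + 1), k) = sum_j binom(alpha, j) binom(alpha n, k - j)) and
  the density, since P(T_k <= t) = 1 - sum_{j < k} p_j(t) and the alternating partial row sums of the
  binomial coefficients telescope.  Uniqueness of the solution: the difference w of two solutions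
  satisfies, inductively in k, the homogeneous Abel equation, and convolving with t^(beta - 1)
  turns it into a Volterra equation for the primitive of w that only 0 solves.

  For the last identity put X = A_1.  In law F_t = (t / Y)^(beta / alpha) X and
  F'_s = (s / X)^(alpha / beta) Y, so that F_t >= s and F'_s <= t have the same probability; now
  integrate over s with respect to the law of T_k.
*)
theory Submission
  imports Defs
begin

section \<open>Power series and the Gamma function\<close>

text \<open>The stable laws enter through their Laplace transforms: \<open>x powr (- a)\<close> is a
  Gamma integral of exponentials \<open>exp (- \<xi> * x)\<close> over \<xi>, whose expectations are
  known, and that yields the negative moments. The generating function is the hinge, because with
  \<open>l = lam * (1 - z)\<close> its expansion in z about 0 is at the same time an expansion in l
  about \<open>lam\<close>: the k-th derivative, the probability and the double series are three
  readings of one coefficient. The convergence of the double series rests on two crude estimates.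
  \<open>Gamma (x + 1)\<close> outgrows every geometric rate, and the generalized binomials are at
  most 2^k 2^n; the second is the reason for the disc |z| < 1/2. Two features of the paths shape the
  probabilistic half. An empty infimum has the default 0, so the inverse process is right-continuous
  on every path but monotone only almost surely. And the events L_t < s, C_s > t, L_t <= s are
  nested rather than equal, so laws are identified by squeezing distribution functions.\<close>

lemma higher_deriv_powser:
  fixes f :: "real \<Rightarrow> real"
  assumes "\<And>x. \<bar>x - a\<bar> < r \<Longrightarrow> (\<lambda>n. c n * (x - a) ^ n) sums f x" and r: "0 < r"
  shows "(deriv ^^ k) f a = fact k * c k"
  using assms(1)
proof (induction k arbitrary: f c)
  case 0
  from 0[of a] r have "f a = c 0" by simp
  then show ?case by simp
next
  case (Suc k)
  have sm: "summable (\<lambda>n. c n * y ^ n)" if "\<bar>y\<bar> < r" for y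
    using Suc.prems[of "y + a"] that by (auto simp: sums_iff)
  \<comment> \<open>The induction hypothesis is applied to \<open>deriv f\<close> with the
    coefficients \<open>diffs c\<close>, whose k-th entry is \<open>Suc k * c (Suc k)\<close>; this
    turns \<open>fact k\<close> into \<open>fact (Suc k)\<close>.\<close>
  have "(\<lambda>n. diffs c n * (x - a) ^ n) sums deriv f x" if x: "\<bar>x - a\<bar> < r" for x
  proof -
    obtain K where K: "\<bar>x - a\<bar> < K" "K < r" using x dense by blast
    have smK: "summable (\<lambda>n. c n * K ^ n)" using K by (intro sm) auto
    have "((\<lambda>y. \<Sum>n. c n * y ^ n) has_real_derivative (\<Sum>n. diffs c n * (x - a) ^ n)) (at (x - a))"
      by (rule termdiffs_strong[OF smK]) (use K in auto)
    then have "((\<lambda>y. \<Sum>n. c n * (y - a) ^ n) has_real_derivative (\<Sum>n. diffs c n * (x - a) ^ n)) (at x)"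
      using DERIV_shift[of "\<lambda>y. \<Sum>n. c n * y ^ n" _ x "- a"] by simp
    moreover have "eventually (\<lambda>y. (\<Sum>n. c n * (y - a) ^ n) = f y) (nhds x)"
    proof -
      have "eventually (\<lambda>y. y \<in> ball a r) (nhds x)"
        using x by (intro eventually_nhds_in_open) (auto simp: dist_real_def abs_minus_commute)
      then show ?thesis
        by eventually_elim (use Suc.prems in \<open>auto simp: sums_iff dist_real_def abs_minus_commute\<close>)
    qed
    ultimately have "(f has_real_derivative (\<Sum>n. diffs c n * (x - a) ^ n)) (at x)"
      by (simp cong: DERIV_cong_ev)
    then have "deriv f x = (\<Sum>n. diffs c n * (x - a) ^ n)" by (rule DERIV_imp_deriv)
    moreover have "summable (\<lambda>n. diffs c n * (x - a) ^ n)"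
      by (rule termdiff_converges[where K = r]) (use x sm in auto)
    ultimately show ?thesis by (simp add: summable_sums)
  qed
  from Suc.IH[OF this] show ?case
    by (simp add: diffs_def funpow_Suc_right del: funpow.simps)
qed

lemma powser_coeff_unique:
  fixes a b :: "nat \<Rightarrow> real"
  assumes r: "0 < r" and "\<And>z. \<bar>z\<bar> < r \<Longrightarrow> (\<lambda>n. a n * z ^ n) sums f z"
    and "\<And>z. \<bar>z\<bar> < r \<Longrightarrow> (\<lambda>n. b n * z ^ n) sums f z"
  shows "a n = b n"
proof -
  have "(deriv ^^ n) f 0 = fact n * a n"
    by (rule higher_deriv_powser[where r = r]) (use assms in auto)
  moreover have "(deriv ^^ n) f 0 = fact n * b n"
    by (rule higher_deriv_powser[where r = r]) (use assms in auto)
  ultimately show ?thesis by simp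
qed

text \<open>Substituting \<open>z = 1 - x / lam\<close> turns the expansion in z about 0 into one in
  x about \<open>lam\<close>. Each power of z contributes a factor \<open>- 1 / lam\<close>, which
  the prefactor cancels, and the disc of radius 1/2 becomes the ball of radius
  \<open>lam / 2\<close>.\<close>

lemma higher_deriv_of_generating_function:
  fixes g :: "real \<Rightarrow> real"
  assumes lam: "0 < lam" and g: "\<And>z. \<bar>z\<bar> < 1 / 2 \<Longrightarrow> (\<lambda>k. p k * z ^ k) sums g (lam * (1 - z))"
  shows "(- lam) ^ k / fact k * (deriv ^^ k) g lam = p k"
proof -
  have "(deriv ^^ k) g lam = fact k * (p k * (- 1 / lam) ^ k)"
  proof (rule higher_deriv_powser[where r = "lam / 2" and c = "\<lambda>k. p k * (- 1 / lam) ^ k"])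
    fix x assume x: "\<bar>x - lam\<bar> < lam / 2"
    define z where "z = - 1 / lam * (x - lam)"
    have "\<bar>z\<bar> < 1 / 2" using x lam by (simp add: z_def abs_mult field_simps)
    moreover have "lam * (1 - z) = x" using lam by (simp add: z_def field_simps)
    ultimately have "(\<lambda>k. p k * z ^ k) sums g x" using g[of z] by simp
    then show "(\<lambda>k. p k * (- 1 / lam) ^ k * (x - lam) ^ k) sums g x"
      by (simp only: z_def power_mult_distrib mult.assoc)
  qed (use lam in simp)
  moreover have "(- lam) ^ k * (- 1 / lam) ^ k = 1"
    using lam by (simp flip: power_mult_distrib)
  ultimately show ?thesis by (simp add: field_simps)
qed

section \<open>Growth of the Gamma function and convergence of Mittag-Leffler type series\<close>

lemma powr_exp_le_Gamma:
  fixes R x :: real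
  assumes "0 < R" "0 \<le> x"
  shows "R powr x * exp (- R) \<le> Gamma (x + 1)"
proof -
  \<comment> \<open>On \<open>{R..}\<close> the Gamma integrand dominates
    \<open>R powr x * exp (- t)\<close>. With R free, this bound stands in for Stirling's
    formula.\<close>
  have e: "((\<lambda>t. exp (- t)) has_integral exp (- R)) {R..}"
    using has_integral_exp_minus_to_infinity[of 1 R] by simp
  have "((\<lambda>t. R powr x * exp (- t)) has_integral (R powr x * exp (- R))) {R..}"
    by (rule has_integral_mult_right[OF e])
  then have "((\<lambda>t. if t \<in> {R..} then R powr x * exp (- t) else 0) has_integral (R powr x * exp (- R))) {0..}"
    using assms by (subst has_integral_restrict) auto
  then show ?thesis
  proof (rule has_integral_le)
    show "((\<lambda>t. t powr x / exp t) has_integral Gamma (x + 1)) {0..}"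
      using Gamma_integral_real[of "x + 1"] assms by simp
  qed (use assms in \<open>auto simp: exp_minus field_simps intro!: powr_mono2\<close>)
qed

text \<open>Taking R with \<open>R powr b = 2 * (M * \<bar>y\<bar> + 1)\<close> in the lower bound
  for Gamma leaves a geometric series of ratio 1/2; the summand 1 keeps the base positive. The
  offset d will be 1 for the series themselves and \<open>2 - \<beta>\<close> for their fractional
  integrals.\<close>

lemma summable_powser_Gamma:
  fixes b d K :: real
  assumes "0 < b" "1 \<le> d" "\<And>n. \<bar>c n\<bar> \<le> K * M ^ n" "0 \<le> M"
  shows "summable (\<lambda>n. c n * y ^ n / Gamma (b * real n + d))"
proof -
  define R where "R = (2 * (M * \<bar>y\<bar> + 1)) powr (1 / b)"
  have "0 \<le> M * \<bar>y\<bar>" using assms by simp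
  then have R: "0 < R" "R powr b = 2 * (M * \<bar>y\<bar> + 1)"
    using assms by (simp_all add: R_def powr_powr add_nonneg_eq_0_iff del: distrib_left_numeral)
  have "0 \<le> K" using assms(3)[of 0] by simp
  show ?thesis
  proof (rule summable_comparison_test'[of "\<lambda>n. K * exp R * R powr (1 - d) * (1/2) ^ n"])
    show "summable (\<lambda>n. K * exp R * R powr (1 - d) * (1/2 :: real) ^ n)"
      by (intro summable_mult summable_geometric) auto
    fix n :: nat
    have "0 \<le> b * real n" using assms by simp
    with assms(2) have x: "0 \<le> b * real n + d - 1" by linarith
    have G: "R powr (b * real n + d - 1) * exp (- R) \<le> Gamma (b * real n + d)"
      using powr_exp_le_Gamma[OF R(1) x] by simp
    have Rp: "R powr (b * real n + d - 1) = (2 * (M * \<bar>y\<bar> + 1)) ^ n / R powr (1 - d)"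
    proof -
      have "R powr (b * real n + d - 1) = (R powr b) powr real n * R powr (d - 1)"
        by (simp add: powr_powr powr_add[symmetric] algebra_simps)
      also have "(R powr b) powr real n = (2 * (M * \<bar>y\<bar> + 1)) ^ n"
        unfolding R(2) using \<open>0 \<le> M * \<bar>y\<bar>\<close> by (intro powr_realpow mult_pos_pos add_nonneg_pos) auto
      also have "R powr (d - 1) = 1 / R powr (1 - d)"
        by (metis minus_diff_eq powr_minus_divide)
      finally show ?thesis by simp
    qed
    have G0: "0 < Gamma (b * real n + d)" using x assms by (intro Gamma_real_pos) auto
    have pos: "0 < (2 * (M * \<bar>y\<bar> + 1)) ^ n" using \<open>0 \<le> M * \<bar>y\<bar>\<close> by (intro zero_less_power mult_pos_pos add_nonneg_pos) auto
    have "norm (c n * y ^ n / Gamma (b * real n + d)) \<le> K * M ^ n * \<bar>y\<bar> ^ n / Gamma (b * real n + d)"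
      using assms(3)[of n] G0 by (simp add: abs_mult power_abs divide_right_mono mult_right_mono)
    also have "\<dots> \<le> K * M ^ n * \<bar>y\<bar> ^ n / (R powr (b * real n + d - 1) * exp (- R))"
      using G R G0 \<open>0 \<le> K\<close> assms by (intro divide_left_mono mult_pos_pos) auto
    also have "\<dots> = K * (M * \<bar>y\<bar>) ^ n * exp R * R powr (1 - d) / (2 * (M * \<bar>y\<bar> + 1)) ^ n"
      unfolding Rp using R by (simp add: exp_minus field_simps power_mult_distrib)
    also have "\<dots> \<le> K * (M * \<bar>y\<bar> + 1) ^ n * exp R * R powr (1 - d) / (2 * (M * \<bar>y\<bar> + 1)) ^ n"
      using pos \<open>0 \<le> K\<close> R assms by (intro divide_right_mono mult_right_mono mult_left_mono power_mono) auto
    also have "\<dots> = K * exp R * R powr (1 - d) * (1/2) ^ n"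
    proof -
      define Q where "Q = M * \<bar>y\<bar> + 1"
      have "Q \<noteq> 0" using \<open>0 \<le> M * \<bar>y\<bar>\<close> by (simp add: Q_def)
      then show ?thesis
        unfolding Q_def[symmetric] power_mult_distrib by (simp add: power_one_over field_simps)
    qed
    finally show "norm (c n * y ^ n / Gamma (b * real n + d)) \<le> K * exp R * R powr (1 - d) * (1/2) ^ n" .
  qed
qed

text \<open>Factor by factor \<open>\<bar>x - i\<bar> \<le> n + i + 1\<close>, so the modulus is at
  most the ordinary binomial \<open>(n + k) choose k\<close>. The resulting bound is geometric in
  both indices, as the double series requires.\<close>

lemma abs_gbinomial_le:
  fixes x :: real
  assumes "\<bar>x\<bar> \<le> real n"
  shows "\<bar>x gchoose k\<bar> \<le> 2 ^ k * 2 ^ n"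
proof -
  have "\<bar>x gchoose k\<bar> = (\<Prod>i<k. \<bar>x - real i\<bar>) / fact k"
    by (simp add: gbinomial_prod_rev abs_prod atLeast0LessThan)
  also have "\<dots> \<le> (\<Prod>i<k. real (n + k) - real (k - Suc i)) / fact k"
    using assms by (intro divide_right_mono prod_mono) (auto simp: of_nat_diff)
  also have "(\<Prod>i<k. real (n + k) - real (k - Suc i)) = (\<Prod>i<k. real (n + k) - real i)"
    by (rule prod.nat_diff_reindex)
  also have "\<dots> / fact k = real ((n + k) choose k)"
    by (simp add: binomial_gbinomial gbinomial_prod_rev atLeast0LessThan)
  also have "\<dots> \<le> 2 ^ (n + k)"
    using binomial_le_pow2[of "n + k" k] by (metis of_nat_le_iff of_nat_numeral of_nat_power)
  finally show ?thesis by (simp add: power_add mult.commute)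
qed

lemma summable_mittag_leffler:
  "0 < b \<Longrightarrow> summable (\<lambda>n. z ^ n / Gamma (b * real n + 1))"
  using summable_powser_Gamma[of b 1 "\<lambda>_. 1" 1 1 z] by simp

section \<open>Stable laws\<close>

text \<open>Expand \<open>iexp (t * exp (- x))\<close> and integrate term by term, which is allowed
  because \<open>exp (- n * x) \<le> 1\<close> leaves the exponential series of
  \<open>\<bar>t\<bar>\<close> as a majorant. The n-th moment of \<open>exp (- X)\<close> is the
  Laplace transform of X at n.\<close>

lemma char_exp_minus_sums:
  assumes R: "real_distribution R" and nn: "AE x in R. 0 \<le> x"
  shows "(\<lambda>n. (\<i> * of_real t) ^ n / fact n * of_real (\<integral>x. exp (- real n * x) \<partial>R)) sums
    char (distr R borel (\<lambda>x. exp (- x))) t"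
proof -
  interpret real_distribution R by fact
  define f where "f n x = (\<i> * of_real t) ^ n / fact n * of_real (exp (- real n * x))" for n :: nat and x :: real
  have [measurable]: "f n \<in> borel_measurable R" for n unfolding f_def by simp
  have bnd: "AE x in R. norm (f n x) \<le> \<bar>t\<bar> ^ n / fact n" for n
    using nn
  proof eventually_elim
    case (elim x)
    then have "exp (- real n * x) \<le> 1" by simp
    then show ?case
      by (simp add: f_def norm_mult norm_divide norm_power divide_right_mono mult_left_le)
  qed
  have i: "integrable R (f n)" for n
    by (rule integrable_const_bound[OF bnd]) simp
  have "(\<integral>x. norm (f n x) \<partial>R) \<le> (\<integral>x. \<bar>t\<bar> ^ n / fact n \<partial>R)" for n
    using bnd[of n] i by (intro integral_mono_AE) auto
  then have b: "(\<integral>x. norm (f n x) \<partial>R) \<le> \<bar>t\<bar> ^ n / fact n" for n using prob_space by simp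
  have e: "summable (\<lambda>n. \<bar>t\<bar> ^ n / fact n)"
    using summable_exp[of "\<bar>t\<bar>"] by (simp add: field_simps)
  have "(\<lambda>n. integral\<^sup>L R (f n)) sums (\<integral>x. (\<Sum>n. f n x) \<partial>R)"
  proof (rule sums_integral[OF i])
    show "AE x in R. summable (\<lambda>i. norm (f i x))"
    proof -
      have "AE x in R. \<forall>n. norm (f n x) \<le> \<bar>t\<bar> ^ n / fact n"
        using bnd by (simp add: AE_all_countable)
      then show ?thesis
      proof eventually_elim
      case (elim x)
      then show ?case by (intro summable_comparison_test'[OF e]) auto
      qed
    qed
    show "summable (\<lambda>i. \<integral>x. norm (f i x) \<partial>R)"
      by (rule summable_comparison_test'[OF e]) (use b in auto)
  qed
  moreover have "(\<Sum>n. f n x) = iexp (t * exp (- x))" for x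
  proof -
    have "f n x = (\<i> * of_real (t * exp (- x))) ^ n /\<^sub>R fact n" for n
      by (simp add: f_def power_mult_distrib exp_of_nat_mult[symmetric] scaleR_conv_of_real
          field_simps flip: of_real_power)
    then show ?thesis by (simp add: exp_def)
  qed
  moreover have "integral\<^sup>L R (f n) = (\<i> * of_real t) ^ n / fact n * of_real (\<integral>x. exp (- real n * x) \<partial>R)" for n
    unfolding f_def[abs_def] by simp
  ultimately show ?thesis
    by (simp add: char_def integral_distr)
qed

text \<open>
  The values at the integers are the moments of \<open>exp (- X)\<close>, which is bounded, so they determine its
  characteristic function.
\<close>

lemma laplace_transform_unique:
  assumes P: "real_distribution P" "AE x in P. 0 \<le> x"
    and Q: "real_distribution Q" "AE x in Q. 0 \<le> x"
    and eq: "\<And>n::nat. (\<integral>x. exp (- real n * x) \<partial>P) = (\<integral>x. exp (- real n * x) \<partial>Q)"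
  shows "P = Q"
proof -
  interpret P: real_distribution P by fact
  interpret Q: real_distribution Q by fact
  have "char (distr P borel (\<lambda>x. exp (- x))) t = char (distr Q borel (\<lambda>x. exp (- x))) t" for t
    using char_exp_minus_sums[OF P, of t] char_exp_minus_sums[OF Q, of t] unfolding eq
    by (rule sums_unique2)
  then have "distr P borel (\<lambda>x. exp (- x)) = distr Q borel (\<lambda>x. exp (- x))"
    by (intro Levy_uniqueness P.real_distribution_distr Q.real_distribution_distr) auto
  \<comment> \<open>The map \<open>- ln\<close> undoes \<open>exp (- x)\<close> and recovers P and Q
    themselves.\<close>
  then have "distr (distr P borel (\<lambda>x. exp (- x))) borel (\<lambda>y. - ln y) =
      distr (distr Q borel (\<lambda>x. exp (- x))) borel (\<lambda>y. - ln y)" by simp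
  then have "distr P borel (\<lambda>x. x) = distr Q borel (\<lambda>x. x)"
    by (simp add: distr_distr o_def)
  then show ?thesis
    by (simp add: distr_id2 P.events_eq_borel Q.events_eq_borel)
qed

text \<open>The law at time 1. For \<open>\<nu> = 1\<close> it is the point mass at 1, so that what
  is proved of stable laws covers the deterministic case too.\<close>

definition stable_law :: "real \<Rightarrow> real measure \<Rightarrow> bool" where
  "stable_law \<nu> \<mu> \<longleftrightarrow> real_distribution \<mu> \<and> (AE x in \<mu>. 0 \<le> x) \<and>
     (\<forall>\<xi>\<ge>0. (\<integral>x. exp (- \<xi> * x) \<partial>\<mu>) = exp (- (\<xi> powr \<nu>)))"

lemma stable_law_unique: "stable_law \<nu> \<mu> \<Longrightarrow> stable_law \<nu> \<mu>' \<Longrightarrow> \<mu> = \<mu>'"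
  unfolding stable_law_def by (intro laplace_transform_unique) auto

text \<open>Self-similarity, read off from
  \<open>(n * s powr (1 / \<nu>)) powr \<nu> = s * n powr \<nu>\<close>. The case
  \<open>s = 0\<close> is included; both laws are then the point mass at 0.\<close>

lemma stable_law_scale:
  assumes \<mu>: "stable_law \<nu> \<mu>" and \<nu>: "0 < \<nu>" and s: "0 \<le> s"
    and \<rho>: "real_distribution \<rho>" "AE x in \<rho>. 0 \<le> x"
    and L: "\<And>\<xi>. 0 \<le> \<xi> \<Longrightarrow> (\<integral>x. exp (- \<xi> * x) \<partial>\<rho>) = exp (- s * \<xi> powr \<nu>)"
  shows "\<rho> = distr \<mu> borel (\<lambda>x. s powr (1 / \<nu>) * x)"
proof -
  interpret real_distribution \<mu> using \<mu> by (simp add: stable_law_def)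
  show ?thesis
  proof (rule laplace_transform_unique[OF \<rho>])
    show "real_distribution (distr \<mu> borel (\<lambda>x. s powr (1 / \<nu>) * x))" by simp
    show "AE x in distr \<mu> borel (\<lambda>x. s powr (1 / \<nu>) * x). 0 \<le> x"
      using \<mu> by (subst AE_distr_iff) (auto simp: stable_law_def)
    fix n :: nat
    have "(\<integral>x. exp (- real n * x) \<partial>distr \<mu> borel (\<lambda>x. s powr (1 / \<nu>) * x)) =
      (\<integral>x. exp (- (real n * s powr (1 / \<nu>)) * x) \<partial>\<mu>)"
      by (subst integral_distr) (auto simp: mult_ac)
    also have "\<dots> = exp (- ((real n * s powr (1 / \<nu>)) powr \<nu>))"
      using \<mu> by (simp add: stable_law_def)
    also have "(real n * s powr (1 / \<nu>)) powr \<nu> = s * real n powr \<nu>"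
      using \<nu> s by (simp add: powr_mult powr_powr)
    finally show "(\<integral>x. exp (- real n * x) \<partial>\<rho>) =
        (\<integral>x. exp (- real n * x) \<partial>distr \<mu> borel (\<lambda>x. s powr (1 / \<nu>) * x))"
      using L[of "real n"] by simp
  qed
qed

text \<open>The indicator of \<open>x \<le> 0\<close> lies below \<open>exp (- n * x)\<close>, whose
  expectation \<open>exp (- (n powr \<nu>))\<close> tends to 0. Hence negative powers are almost
  surely not evaluated at 0, where \<open>powr\<close> has the default value 0.\<close>

lemma stable_law_pos:
  assumes \<mu>: "stable_law \<nu> \<mu>" and \<nu>: "0 < \<nu>"
  shows "AE x in \<mu>. 0 < x"
proof -
  interpret real_distribution \<mu> using \<mu> by (simp add: stable_law_def)
  have nn: "AE x in \<mu>. 0 \<le> x" using \<mu> by (simp add: stable_law_def)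
  have "prob {x. x \<le> 0} \<le> exp (- (real n powr \<nu>))" for n :: nat
  proof -
    have "prob {x. x \<le> 0} = (\<integral>x. indicator {x. x \<le> 0} x \<partial>\<mu>)" by simp
    also have "\<dots> \<le> (\<integral>x. exp (- real n * x) \<partial>\<mu>)"
    proof (rule integral_mono_AE)
      show "integrable \<mu> (\<lambda>x. exp (- real n * x))"
        by (rule integrable_const_bound[where B = 1]) (use nn in auto)
      show "AE x in \<mu>. indicator {x. x \<le> 0} x \<le> exp (- real n * x)"
        by (intro always_eventually allI) (auto simp: indicator_def mult_nonneg_nonpos)
    qed (auto intro!: integrable_const_bound[where B = 1])
    finally show ?thesis using \<mu> by (simp add: stable_law_def)
  qed
  moreover have "(\<lambda>n. exp (- (real n powr \<nu>))) \<longlonglongrightarrow> 0"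
    using \<nu> by real_asymp
  ultimately have "prob {x. x \<le> 0} \<le> 0"
    by (intro LIMSEQ_le_const) auto
  then have "prob {x. x \<le> 0} = 0" by (simp add: measure_le_0_iff)
  then have "AE x in \<mu>. x \<notin> {x. x \<le> 0}" by (subst (asm) prob_eq_0) auto
  then show ?thesis by eventually_elim auto
qed

section \<open>Negative moments of stable laws\<close>

lemma nn_integral_powr_exp_powr:
  fixes s \<nu> :: real
  assumes "0 < s" "0 < \<nu>"
  shows "(\<integral>\<^sup>+x. ennreal (x powr (\<nu> * s - 1) * exp (- (x powr \<nu>))) * indicator {0<..} x \<partial>lborel)
    = ennreal (Gamma s / \<nu>)"
proof -
  \<comment> \<open>The integrand of \<open>Gamma s\<close> after the substitution
    \<open>t = x powr \<nu>\<close>, Jacobian included.\<close>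
  let ?g = "\<lambda>x. \<bar>\<nu> * x powr (\<nu> - 1)\<bar> * ((x powr \<nu>) powr (s - 1) / exp (x powr \<nu>))"
  have im: "(\<lambda>x. x powr \<nu>) ` {0<..} = {0<..}"
  proof safe
    fix y :: real assume "0 < y"
    then show "y \<in> (\<lambda>x. x powr \<nu>) ` {0<..}"
      using assms by (intro image_eqI[of _ _ "y powr (1 / \<nu>)"]) (auto simp: powr_powr)
  qed auto
  have inj: "inj_on (\<lambda>x. x powr \<nu>) {0<..}"
    by (rule inj_on_inverseI[of _ "\<lambda>y. y powr (1 / \<nu>)"]) (use assms in \<open>simp add: powr_powr\<close>)
  have G: "((\<lambda>t. t powr (s - 1) / exp t) has_integral Gamma s) {0<..}"
    using Gamma_integral_real[OF assms(1)]
    by (subst has_integral_spike_set_eq[of _ "{0..}"]) (auto intro: negligible_subset[of "{0}"])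
  then have "(\<lambda>t. t powr (s - 1) / exp t) absolutely_integrable_on (\<lambda>x. x powr \<nu>) ` {0<..} \<and>
      integral ((\<lambda>x. x powr \<nu>) ` {0<..}) (\<lambda>t. t powr (s - 1) / exp t) = Gamma s"
    unfolding im by (auto simp: has_integral_iff intro!: nonnegative_absolutely_integrable_1)
  then have "?g absolutely_integrable_on {0<..} \<and>
      integral {0<..} ?g = Gamma s"
    using assms
    by (subst has_absolute_integral_change_of_variables_1'[where f = "\<lambda>t. t powr (s - 1) / exp t"
          and g = "\<lambda>x. x powr \<nu>" and g' = "\<lambda>x. \<nu> * x powr (\<nu> - 1)"])
       (auto intro!: derivative_eq_intros inj)
  then have "(?g has_integral Gamma s) {0<..}"
    by (auto simp: has_integral_iff dest: set_lebesgue_integral_eq_integral)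
  then have "((\<lambda>x. ?g x / \<nu>) has_integral Gamma s / \<nu>) {0<..}"
    by (rule has_integral_divide)
  then have "((\<lambda>x. x powr (\<nu> * s - 1) * exp (- (x powr \<nu>))) has_integral Gamma s / \<nu>) {0<..}"
    by (rule has_integral_eq[rotated])
       (use assms in \<open>auto simp: powr_powr exp_minus field_simps abs_mult simp flip: powr_add\<close>)
  then show ?thesis
    by (intro nn_integral_has_integral_lebesgue') auto
qed

text \<open>The substitution \<open>t = x * \<xi>\<close> in the Gamma integral. It writes a
  negative power of x as a mixture of the exponentials \<open>exp (- \<xi> * x)\<close>; the
  nonnegative form lets Tonelli apply at once.\<close>

lemma nn_integral_powr_exp_scale:
  fixes a x :: real
  assumes "0 < a" "0 < x"
  shows "(\<integral>\<^sup>+\<xi>. ennreal (\<xi> powr (a - 1) * exp (- \<xi> * x)) * indicator {0<..} \<xi> \<partial>lborel)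
    = ennreal (Gamma a * x powr (- a))"
proof -
  let ?I = "\<integral>\<^sup>+\<xi>. ennreal (\<xi> powr (a - 1) * exp (- \<xi> * x)) * indicator {0<..} \<xi> \<partial>lborel"
  have G: "ennreal (Gamma a) = (\<integral>\<^sup>+t. ennreal (indicator {0..} t * t powr (a - 1) / exp t) \<partial>lborel)"
    by (rule Gamma_conv_nn_integral_real) fact
  also have "\<dots> = ennreal x * (\<integral>\<^sup>+t. ennreal (indicator {0..} (x * t) * (x * t) powr (a - 1) / exp (x * t)) \<partial>lborel)"
    using assms by (subst nn_integral_real_affine[where c = x and t = 0]) auto
  also have "(\<integral>\<^sup>+t. ennreal (indicator {0..} (x * t) * (x * t) powr (a - 1) / exp (x * t)) \<partial>lborel) =
     (\<integral>\<^sup>+t. ennreal (x powr (a - 1)) * (ennreal (t powr (a - 1) * exp (- t * x)) * indicator {0<..} t) \<partial>lborel)"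
    using assms
    by (intro nn_integral_cong)
       (auto simp: indicator_def powr_mult zero_le_mult_iff exp_minus field_simps ennreal_mult'[symmetric])
  also have "\<dots> = ennreal (x powr (a - 1)) * ?I"
    by (rule nn_integral_cmult) simp
  finally have "ennreal (Gamma a) = ennreal (x powr a) * ?I"
    using assms by (simp add: mult.assoc[symmetric] ennreal_mult'[symmetric] powr_mult_base)
  then have "ennreal (x powr (- a)) * ennreal (Gamma a) = (ennreal (x powr (- a)) * ennreal (x powr a)) * ?I"
    by (simp add: mult.assoc)
  then show ?thesis using assms
    by (simp add: ennreal_mult'[symmetric] mult.commute flip: powr_add)
qed

text \<open>Integrate the mixture representation of \<open>x powr (- (\<nu> * s))\<close> against
  \<open>\<mu>\<close>, exchange the integrals and insert the Laplace transform: what remains is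
  \<open>Gamma s / \<nu>\<close>. The shifts by 1 in the result absorb the factors s and
  \<open>\<nu> * s\<close>.\<close>

lemma stable_law_negative_moment:
  assumes \<mu>: "stable_law \<nu> \<mu>" and \<nu>: "0 < \<nu>" and s: "0 < s"
  shows "has_bochner_integral \<mu> (\<lambda>x. x powr (- (\<nu> * s))) (Gamma (s + 1) / Gamma (\<nu> * s + 1))"
proof -
  interpret real_distribution \<mu> using \<mu> by (simp add: stable_law_def)
  interpret pair_sigma_finite \<mu> lborel ..
  let ?I = "\<integral>\<^sup>+x. ennreal (x powr (- (\<nu> * s))) \<partial>\<mu>"
  have G: "0 < Gamma (\<nu> * s)" "0 < Gamma s" using \<nu> s by auto
  have "ennreal (Gamma (\<nu> * s)) * ?I =
     (\<integral>\<^sup>+x. (\<integral>\<^sup>+\<xi>. ennreal (\<xi> powr (\<nu> * s - 1) * exp (- \<xi> * x)) * indicator {0<..} \<xi> \<partial>lborel) \<partial>\<mu>)"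
    using \<nu> s
    by (subst nn_integral_cmult[symmetric])
       (auto intro!: nn_integral_cong_AE eventually_mono[OF stable_law_pos[OF \<mu> \<nu>]]
         simp: nn_integral_powr_exp_scale[unfolded mult_minus_left] ennreal_mult'[symmetric])
  also have "\<dots> = (\<integral>\<^sup>+\<xi>. (\<integral>\<^sup>+x. ennreal (\<xi> powr (\<nu> * s - 1) * exp (- \<xi> * x)) * indicator {0<..} \<xi> \<partial>\<mu>) \<partial>lborel)"
    by (intro Fubini'[symmetric]) simp
  also have "\<dots> = (\<integral>\<^sup>+\<xi>. ennreal (\<xi> powr (\<nu> * s - 1) * exp (- (\<xi> powr \<nu>))) * indicator {0<..} \<xi> \<partial>lborel)"
  proof (intro nn_integral_cong)
    fix \<xi> :: real
    show "(\<integral>\<^sup>+x. ennreal (\<xi> powr (\<nu> * s - 1) * exp (- \<xi> * x)) * indicator {0<..} \<xi> \<partial>\<mu>) =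
        ennreal (\<xi> powr (\<nu> * s - 1) * exp (- (\<xi> powr \<nu>))) * indicator {0<..} \<xi>"
    proof (cases "0 < \<xi>")
      case True
      have "integrable \<mu> (\<lambda>x. exp (- \<xi> * x))"
        by (rule integrable_const_bound[where B = 1]) (use \<mu> True in \<open>auto simp: stable_law_def\<close>)
      then have "(\<integral>\<^sup>+x. ennreal (exp (- \<xi> * x)) \<partial>\<mu>) = ennreal (\<integral>x. exp (- \<xi> * x) \<partial>\<mu>)"
        by (rule nn_integral_eq_integral) auto
      also have "(\<integral>x. exp (- \<xi> * x) \<partial>\<mu>) = exp (- (\<xi> powr \<nu>))"
        using \<mu> True by (simp add: stable_law_def)
      finally show ?thesis using True
        by (simp add: ennreal_mult' nn_integral_cmult)
    qed simp
  qed
  also have "\<dots> = ennreal (Gamma s / \<nu>)" by (rule nn_integral_powr_exp_powr[OF s \<nu>])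
  finally have eq: "ennreal (Gamma (\<nu> * s)) * ?I = ennreal (Gamma s / \<nu>)" .
  have "?I =
    ennreal (1 / Gamma (\<nu> * s)) * (ennreal (Gamma (\<nu> * s)) * ?I)"
    using G by (simp add: mult.assoc[symmetric] ennreal_mult'[symmetric])
  also have "\<dots> = ennreal (Gamma s / \<nu> / Gamma (\<nu> * s))"
    unfolding eq using G by (simp add: ennreal_mult'[symmetric]) (simp add: mult.commute)
  also have "Gamma s / \<nu> / Gamma (\<nu> * s) = Gamma (s + 1) / Gamma (\<nu> * s + 1)"
  proof -
    have "s \<notin> \<int>\<^sub>\<le>\<^sub>0" "\<nu> * s \<notin> \<int>\<^sub>\<le>\<^sub>0" using \<nu> s by (auto dest!: nonpos_Ints_nonpos simp: mult_le_0_iff)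
    then have "Gamma (s + 1) = s * Gamma s" "Gamma (\<nu> * s + 1) = \<nu> * s * Gamma (\<nu> * s)"
      by (simp_all add: Gamma_plus1)
    then show ?thesis using \<nu> s G by (simp only:) (simp add: field_simps)
  qed
  finally show ?thesis
    using \<nu> s by (intro has_bochner_integral_nn_integral divide_nonneg_pos Gamma_real_nonneg Gamma_real_pos add_pos_pos mult_pos_pos) auto
qed

text \<open>The moment \<open>fact n / Gamma (\<nu> * n + 1)\<close> cancels the factorial of the
  exponential series, which is how the Mittag-Leffler function arises. Absolute convergence is that
  of the same series at z in place of \<open>- z\<close>.\<close>

lemma stable_law_inverse_laplace:
  assumes \<mu>: "stable_law \<nu> \<mu>" and \<nu>: "0 < \<nu>" and z: "0 \<le> z"
  shows "(\<integral>x. exp (- z * x powr (- \<nu>)) \<partial>\<mu>) = mittag_leffler \<nu> (- z)"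
proof -
  interpret real_distribution \<mu> using \<mu> by (simp add: stable_law_def)
  define f where "f n x = (- z) ^ n / fact n * x powr (- (\<nu> * real n))" for n :: nat and x :: real
  \<comment> \<open>The moment formula asks for a positive exponent. For n = 0 the integrand
    \<open>x powr 0\<close> is 1 except at x = 0, hence almost everywhere.\<close>
  have m: "has_bochner_integral \<mu> (\<lambda>x. x powr (- (\<nu> * real n))) (fact n / Gamma (\<nu> * real n + 1))" for n
  proof (cases "n = 0")
    case True
    have "has_bochner_integral \<mu> (\<lambda>x. 1) (1 :: real)"
      using prob_space by (simp add: has_bochner_integral_iff)
    then have "has_bochner_integral \<mu> (\<lambda>x. x powr 0) 1"
      by (rule has_bochner_integralI_AE)
         (auto intro!: eventually_mono[OF stable_law_pos[OF \<mu> \<nu>]])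
    then show ?thesis using True by simp
  next
    case False
    then show ?thesis using stable_law_negative_moment[OF \<mu> \<nu>, of "real n"]
      by (simp add: Gamma_fact add.commute)
  qed
  have i: "integrable \<mu> (f n)" for n
    unfolding f_def using m[of n] by (auto simp: has_bochner_integral_iff)
  have I: "integral\<^sup>L \<mu> (f n) = (- z) ^ n / Gamma (\<nu> * real n + 1)" for n
    unfolding f_def using m[of n] by (simp add: has_bochner_integral_iff)
  have pw: "x powr (- (\<nu> * real n)) = (x powr (- \<nu>)) ^ n" if "0 < x" for x n
    using that by (simp add: powr_powr flip: powr_realpow)
  have "(\<lambda>n. integral\<^sup>L \<mu> (f n)) sums (\<integral>x. (\<Sum>n. f n x) \<partial>\<mu>)"
  proof (rule sums_integral[OF i])
    show "AE x in \<mu>. summable (\<lambda>n. norm (f n x))"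
      using stable_law_pos[OF \<mu> \<nu>]
    proof eventually_elim
      case (elim x)
      then have "norm (f n x) = inverse (fact n) * (z * x powr (- \<nu>)) ^ n" for n
        using z by (simp add: f_def pw abs_mult power_abs power_mult_distrib field_simps)
      then show ?case using summable_exp[of "z * x powr (- \<nu>)"] by simp
    qed
    have "(\<integral>x. norm (f n x) \<partial>\<mu>) = z ^ n / Gamma (\<nu> * real n + 1)" for n
      using m[of n] z unfolding f_def
      by (simp add: has_bochner_integral_iff abs_mult power_abs)
    then show "summable (\<lambda>n. \<integral>x. norm (f n x) \<partial>\<mu>)"
      using summable_mittag_leffler[OF \<nu>] by simp
  qed
  moreover have "(\<integral>x. (\<Sum>n. f n x) \<partial>\<mu>) = (\<integral>x. exp (- z * x powr (- \<nu>)) \<partial>\<mu>)"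
  proof (intro integral_cong_AE)
    show "AE x in \<mu>. (\<Sum>n. f n x) = exp (- z * x powr (- \<nu>))"
      using stable_law_pos[OF \<mu> \<nu>]
    proof eventually_elim
      case (elim x)
      then have "f n x = (- z * x powr (- \<nu>)) ^ n /\<^sub>R fact n" for n
        by (simp add: f_def pw power_mult_distrib[symmetric] field_simps)
      then show ?case by (simp add: exp_def)
    qed
  qed (use i in \<open>auto intro!: borel_measurable_suminf\<close>)
  ultimately show ?thesis by (simp add: I mittag_leffler_def sums_iff)
qed

section \<open>Caputo derivatives of Mittag-Leffler type series\<close>

text \<open>Affine substitution \<open>x = l + (u - l) * t\<close> in the Beta integral; kernels on
  \<open>[s, t]\<close> as well as on \<open>[0, t]\<close> occur below.\<close>

lemma has_bochner_integral_Beta: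
  fixes a b l u :: real
  assumes ab: "0 < a" "0 < b" and lu: "l < u"
  shows "has_bochner_integral lborel
    (\<lambda>x. indicator {l..u} x * ((x - l) powr (a - 1) * (u - x) powr (b - 1)))
    ((u - l) powr (a + b - 1) * Beta a b)"
proof -
  have i: "set_integrable lborel {0..1} (\<lambda>t. t powr (a - 1) * (1 - t) powr (b - 1))"
    by (rule integrable_Beta[OF ab])
  have "(LINT t:{0..1}|lborel. t powr (a - 1) * (1 - t) powr (b - 1)) = Beta a b"
    using has_integral_Beta_real[OF ab] set_borel_integral_eq_integral(2)[OF i]
    by (simp add: integral_unique)
  with i have 1: "has_bochner_integral lborel
      (\<lambda>t. indicator {0..1} t * (t powr (a - 1) * (1 - t) powr (b - 1))) (Beta a b)"
    by (simp add: has_bochner_integral_iff set_integrable_def set_lebesgue_integral_def)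
  have e: "(u - l) powr (a + b - 2) * (indicator {0..1} t * (t powr (a - 1) * (1 - t) powr (b - 1))) =
      indicator {l..u} (l + (u - l) * t) * ((l + (u - l) * t - l) powr (a - 1) * (u - (l + (u - l) * t)) powr (b - 1))" for t
  proof -
    have "u - (l + (u - l) * t) = (u - l) * (1 - t)" by (simp add: algebra_simps)
    moreover have "l + (u - l) * t \<le> u \<longleftrightarrow> t \<le> 1"
      using lu mult_le_cancel_left_pos[of "u - l" t 1] by (simp add: algebra_simps)
    moreover have "l \<le> l + (u - l) * t \<longleftrightarrow> 0 \<le> t"
      using lu by (simp add: zero_le_mult_iff)
    moreover have "(u - l) powr (a + b - 2) = (u - l) powr (a - 1) * (u - l) powr (b - 1)"
      by (simp flip: powr_add)
    ultimately show ?thesis using lu by (auto simp: indicator_def powr_mult)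
  qed
  have "has_bochner_integral lborel
    (\<lambda>t. (u - l) powr (a + b - 2) * (indicator {0..1} t * (t powr (a - 1) * (1 - t) powr (b - 1))))
    ((u - l) powr (a + b - 2) * Beta a b)"
    using 1 by (rule has_bochner_integral_mult_right)
  moreover have "(u - l) powr (a + b - 2) * Beta a b = ((u - l) powr (a + b - 1) * Beta a b) /\<^sub>R \<bar>u - l\<bar>"
    using lu by (simp add: field_simps powr_diff powr_numeral power2_eq_square)
  ultimately show ?thesis
    unfolding e using lu by (subst lborel_has_bochner_integral_real_affine_iff[of "u - l" _ _ l]) auto
qed

text \<open>For \<open>d n = z ^ n\<close> this is
  \<open>mittag_leffler \<beta> (z * t powr \<beta>)\<close>. The form
  \<open>(t powr \<beta>) ^ n\<close>, unlike \<open>t powr (\<beta> * n)\<close>, equals 1 for n =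
  0 also at t = 0, which makes the series continuous there.\<close>

definition ml_series :: "real \<Rightarrow> (nat \<Rightarrow> real) \<Rightarrow> real \<Rightarrow> real" where
  "ml_series \<beta> d t = (\<Sum>n. d n * (t powr \<beta>) ^ n / Gamma (\<beta> * real n + 1))"

text \<open>Chain rule for a power series in \<open>y = t powr \<beta>\<close>. The derivative is
  kept as \<open>1 / t\<close> times a series in the same y, so that it can later be combined with
  the original series coefficientwise.\<close>

lemma has_real_derivative_ml_powser:
  fixes \<beta> \<delta> :: real
  assumes "0 < \<beta>" "1 \<le> \<delta>" and d: "\<And>n. \<bar>d n\<bar> \<le> K * M ^ n" "0 \<le> M" and t: "0 < t"
  shows "((\<lambda>t. \<Sum>n. d n * (t powr \<beta>) ^ n / Gamma (\<beta> * real n + \<delta>)) has_real_derivative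
     (\<Sum>n. \<beta> * real n * d n * (t powr \<beta>) ^ n / Gamma (\<beta> * real n + \<delta>)) / t) (at t)"
    "summable (\<lambda>n. \<beta> * real n * d n * (t powr \<beta>) ^ n / Gamma (\<beta> * real n + \<delta>))"
proof -
  define e where "e n = d n / Gamma (\<beta> * real n + \<delta>)" for n
  have sm: "summable (\<lambda>n. e n * y ^ n)" for y
    using summable_powser_Gamma[OF assms(1-4), of y] by (simp add: e_def)
  let ?y = "t powr \<beta>"
  let ?T = "\<lambda>n. \<beta> * real n * d n * ?y ^ n / Gamma (\<beta> * real n + \<delta>)"
  have D: "((\<lambda>y. \<Sum>n. e n * y ^ n) has_real_derivative (\<Sum>n. diffs e n * ?y ^ n)) (at ?y)"
    by (rule termdiffs_strong_converges_everywhere[OF sm])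
  have sd: "summable (\<lambda>n. diffs e n * ?y ^ n)"
    by (rule termdiff_converges_all[OF sm])
  have "(\<lambda>n. real n * e n * ?y ^ (n - Suc 0)) sums (\<Sum>n. diffs e n * ?y ^ n)"
    using diffs_equiv[OF sd] by simp
  then have "(\<lambda>n. \<beta> * ?y * (real n * e n * ?y ^ (n - Suc 0))) sums (\<beta> * ?y * (\<Sum>n. diffs e n * ?y ^ n))"
    by (rule sums_mult)
  moreover have "\<beta> * ?y * (real n * e n * ?y ^ (n - Suc 0)) = ?T n" for n
    by (cases n) (simp_all add: e_def)
  ultimately have S: "(\<lambda>n. ?T n) sums (\<beta> * ?y * (\<Sum>n. diffs e n * ?y ^ n))"
    by simp
  then show "summable (\<lambda>n. ?T n)"
    by (rule sums_summable)
  have "((\<lambda>t. \<Sum>n. e n * (t powr \<beta>) ^ n) has_real_derivative (\<Sum>n. diffs e n * ?y ^ n) * (\<beta> * t powr (\<beta> - 1))) (at t)"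
    using D by (rule DERIV_chain2) (use t in \<open>auto intro!: derivative_eq_intros\<close>)
  moreover have "(\<Sum>n. diffs e n * ?y ^ n) * (\<beta> * t powr (\<beta> - 1)) =
    (\<Sum>n. ?T n) / t"
    using t by (simp add: sums_unique[OF S, symmetric] powr_diff)
  ultimately show "((\<lambda>t. \<Sum>n. d n * (t powr \<beta>) ^ n / Gamma (\<beta> * real n + \<delta>)) has_real_derivative
     (\<Sum>n. ?T n) / t) (at t)"
    by (simp add: e_def)
qed

lemma continuous_on_ml_series:
  assumes "0 < \<beta>" and d: "\<And>n. \<bar>d n\<bar> \<le> K * M ^ n" "0 \<le> M"
  shows "continuous_on {0..} (ml_series \<beta> d)"
proof -
  have sm: "summable (\<lambda>n. (d n / Gamma (\<beta> * real n + 1)) * y ^ n)" for y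
    using summable_powser_Gamma[OF assms(1) _ d, of 1 y] by simp
  have "continuous_on UNIV (\<lambda>y. \<Sum>n. (d n / Gamma (\<beta> * real n + 1)) * y ^ n)"
    by (intro continuous_at_imp_continuous_on ballI
        DERIV_isCont[OF termdiffs_strong_converges_everywhere[OF sm]])
  then have "continuous_on {0..} (\<lambda>t. \<Sum>n. (d n / Gamma (\<beta> * real n + 1)) * (t powr \<beta>) ^ n)"
    by (rule continuous_on_compose2) (use assms in \<open>auto intro!: continuous_on_powr' continuous_on_id continuous_on_const\<close>)
  then show ?thesis by (simp add: ml_series_def[abs_def])
qed

lemma ml_series_0 [simp]: "0 < \<beta> \<Longrightarrow> ml_series \<beta> d 0 = d 0"
  unfolding ml_series_def by (subst suminf_finite[of "{0}"]) auto

text \<open>Term by term this is the Beta integral of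
  \<open>s powr (\<beta> * n) * (t - s) powr (- \<beta>)\<close>. Its factor
  \<open>Gamma (\<beta> * n + 1)\<close> cancels the old denominator and
  \<open>Gamma (\<beta> * n + (2 - \<beta>))\<close> takes its place.\<close>

lemma riemann_liouville_ml_series:
  assumes \<beta>: "0 < \<beta>" "\<beta> < 1" and d: "\<And>n. \<bar>d n\<bar> \<le> K * M ^ n" "0 \<le> M" and t: "0 < t"
  shows "(LINT s:{0..t}|lborel. ml_series \<beta> d s / (t - s) powr \<beta>) =
     Gamma (1 - \<beta>) * (t powr (1 - \<beta>) * (\<Sum>n. d n * (t powr \<beta>) ^ n / Gamma (\<beta> * real n + (2 - \<beta>))))"
proof -
  define B where "B n s = indicator {0..t} s * (s powr (\<beta> * real n) * (t - s) powr (- \<beta>))" for n :: nat and s :: real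
  define f where "f n s = indicator {0..t} s * (d n * (s powr \<beta>) ^ n / Gamma (\<beta> * real n + 1) / (t - s) powr \<beta>)"
    for n :: nat and s :: real
  define g where "g n s = d n / Gamma (\<beta> * real n + 1) * B n s" for n :: nat and s :: real
  define x where "x = t powr \<beta>"
  have Bi: "has_bochner_integral lborel (B n) (Gamma (1 - \<beta>) * t powr (1 - \<beta>) *
      (Gamma (\<beta> * real n + 1) * (x ^ n / Gamma (\<beta> * real n + (2 - \<beta>)))))" for n
  proof -
    have "0 < \<beta> * real n + 1" using \<beta> by (simp add: add_nonneg_pos)
    from has_bochner_integral_Beta[OF this, of "1 - \<beta>" 0 t]
    have "has_bochner_integral lborel (B n) (t powr (\<beta> * real n + 1 - \<beta>) * Beta (\<beta> * real n + 1) (1 - \<beta>))"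
      using \<beta> t unfolding B_def by (simp add: algebra_simps)
    moreover have "t powr (\<beta> * real n + 1 - \<beta>) = t powr (1 - \<beta>) * x ^ n"
      using t by (simp add: x_def powr_powr powr_realpow[symmetric] flip: powr_add) (simp add: algebra_simps)
    ultimately show ?thesis by (simp add: Beta_def algebra_simps)
  qed
  have gi: "integrable lborel (g n)" for n
    unfolding g_def using Bi[of n] by (auto simp: has_bochner_integral_iff)
  have B0: "0 \<le> B n s" for n s by (simp add: B_def)
  have G0: "0 < Gamma (\<beta> * real n + 1)" for n using \<beta> by (intro Gamma_real_pos) (simp add: add_nonneg_pos)
  have gI: "integral\<^sup>L lborel (g n) = Gamma (1 - \<beta>) * t powr (1 - \<beta>) * (d n * x ^ n / Gamma (\<beta> * real n + (2 - \<beta>)))"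
    and gN: "(\<integral>s. norm (g n s) \<partial>lborel) = Gamma (1 - \<beta>) * t powr (1 - \<beta>) * (\<bar>d n\<bar> * x ^ n / Gamma (\<beta> * real n + (2 - \<beta>)))" for n
    using Bi[of n] G0[of n] B0[of n] unfolding g_def by (simp_all add: has_bochner_integral_iff abs_mult)
  \<comment> \<open>At s = 0 the terms with n = 0 can differ, since
    \<open>(0 powr \<beta>) ^ 0\<close> is 1 whereas \<open>0 powr 0\<close> is 0; this affects a
    null set only.\<close>
  have fg: "f n s = g n s" if "s \<noteq> 0" for n s
    using that by (auto simp: f_def g_def B_def indicator_def powr_minus_divide powr_powr powr_realpow[symmetric])
  have d': "\<And>n. \<bar>\<bar>d n\<bar>\<bar> \<le> K * M ^ n" using d by simp
  have d1: "1 \<le> 2 - \<beta>" using \<beta> by simp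
  have "(\<lambda>n. integral\<^sup>L lborel (g n)) sums (\<integral>s. (\<Sum>n. g n s) \<partial>lborel)"
  proof (rule sums_integral[OF gi])
    show "summable (\<lambda>n. \<integral>s. norm (g n s) \<partial>lborel)"
      unfolding gN by (rule summable_mult) (rule summable_powser_Gamma[OF \<beta>(1) d1 d' d(2)])
    have "AE s in lborel. s \<noteq> (0 :: real)" by (rule AE_lborel_singleton)
    then show "AE s in lborel. summable (\<lambda>n. norm (g n s))"
    proof eventually_elim
      case (elim s)
      have "summable (\<lambda>n. \<bar>d n\<bar> * (s powr \<beta>) ^ n / Gamma (\<beta> * real n + 1))"
        by (rule summable_powser_Gamma[OF \<beta>(1) _ d' d(2)]) simp
      then have "summable (\<lambda>n. indicator {0..t} s / (t - s) powr \<beta> * (\<bar>d n\<bar> * (s powr \<beta>) ^ n / Gamma (\<beta> * real n + 1)))"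
        by (rule summable_mult)
      moreover have "norm (f n s) = indicator {0..t} s / (t - s) powr \<beta> * (\<bar>d n\<bar> * (s powr \<beta>) ^ n / Gamma (\<beta> * real n + 1))" for n
        using G0[of n] by (simp add: f_def abs_mult power_abs)
      ultimately show ?case using elim by (simp add: fg)
    qed
  qed
  then have S: "(\<Sum>n. Gamma (1 - \<beta>) * t powr (1 - \<beta>) * (d n * x ^ n / Gamma (\<beta> * real n + (2 - \<beta>)))) = (\<integral>s. (\<Sum>n. g n s) \<partial>lborel)"
    by (simp add: gI sums_iff)
  have "(LINT s:{0..t}|lborel. ml_series \<beta> d s / (t - s) powr \<beta>) = (\<integral>s. (\<Sum>n. g n s) \<partial>lborel)"
    unfolding set_lebesgue_integral_def
  proof (intro integral_cong_AE)
    have [measurable]: "(\<lambda>s. ml_series \<beta> d s) \<in> borel_measurable borel"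
      unfolding ml_series_def[abs_def] by (intro borel_measurable_suminf) simp
    show "(\<lambda>s. indicator {0..t} s *\<^sub>R (ml_series \<beta> d s / (t - s) powr \<beta>)) \<in> borel_measurable lborel" by simp
    show "(\<lambda>s. \<Sum>n. g n s) \<in> borel_measurable lborel" using gi by (intro borel_measurable_suminf) auto
    have "AE s in lborel. s \<noteq> (0 :: real)" by (rule AE_lborel_singleton)
    then show "AE s in lborel. indicator {0..t} s *\<^sub>R (ml_series \<beta> d s / (t - s) powr \<beta>) = (\<Sum>n. g n s)"
    proof eventually_elim
      case (elim s)
      have "summable (\<lambda>n. d n * (s powr \<beta>) ^ n / Gamma (\<beta> * real n + 1))"
        by (rule summable_powser_Gamma[OF \<beta>(1) _ d]) simp
      note sm = suminf_mult[OF this, of "indicator {0..t} s / (t - s) powr \<beta>"]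
      have "g n s = indicator {0..t} s / (t - s) powr \<beta> * (d n * (s powr \<beta>) ^ n / Gamma (\<beta> * real n + 1))" for n
        using elim by (simp add: fg[symmetric] f_def)
      then show ?case by (simp only: sm) (simp add: ml_series_def)
    qed
  qed
  also have "\<dots> = Gamma (1 - \<beta>) * t powr (1 - \<beta>) * (\<Sum>n. d n * x ^ n / Gamma (\<beta> * real n + (2 - \<beta>)))"
    unfolding S[symmetric] by (rule suminf_mult) (rule summable_powser_Gamma[OF \<beta>(1) d1 d])
  finally show ?thesis by (simp add: x_def mult.assoc)
qed

text \<open>The Riemann-Liouville derivative sends t^(\<beta> n) / Gamma (\<beta> n + 1) to
  t^(\<beta> (n - 1)) / Gamma (\<beta> (n - 1) + 1), so the coefficients shift by one. For n = 0 the
  image is \<open>t powr (- \<beta>) / Gamma (1 - \<beta>)\<close>, precisely the term that the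
  Caputo correction removes.\<close>

lemma has_caputo_derivative_ml_series:
  assumes \<beta>: "0 < \<beta>" "\<beta> \<le> 1" and d: "\<And>n. \<bar>d n\<bar> \<le> K * M ^ n" "0 \<le> M" and t: "0 < t"
  shows "has_caputo_derivative \<beta> (ml_series \<beta> d) (ml_series \<beta> (\<lambda>n. d (Suc n)) t) t"
proof (cases "\<beta> = 1")
  case True
  define e where "e n = d n / fact n" for n
  have sm: "summable (\<lambda>n. e n * y ^ n)" for y
    using summable_powser_Gamma[OF \<beta>(1) _ d, of 1 y] by (simp add: e_def True Gamma_fact add.commute)
  have D: "((\<lambda>y. \<Sum>n. e n * y ^ n) has_real_derivative (\<Sum>n. diffs e n * t ^ n)) (at t)"
    by (rule termdiffs_strong_converges_everywhere[OF sm])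
  have "diffs e n = d (Suc n) / fact n" for n
    by (simp add: diffs_def e_def divide_simps)
  then have "(\<Sum>n. diffs e n * t ^ n) = ml_series \<beta> (\<lambda>n. d (Suc n)) t"
    using t by (simp add: ml_series_def True Gamma_fact add.commute)
  moreover have "eventually (\<lambda>y. (\<Sum>n. e n * y ^ n) = ml_series \<beta> d y) (nhds t)"
    using eventually_nhds_in_open[of "{0<..}" t] t
    by (auto simp: ml_series_def True Gamma_fact add.commute e_def elim!: eventually_mono)
  ultimately show ?thesis using D True
    by (simp add: has_caputo_derivative_def cong: DERIV_cong_ev)
next
  case False
  with \<beta> have b1: "\<beta> < 1" by simp
  define H where "H \<tau> = (\<Sum>n. d n * (\<tau> powr \<beta>) ^ n / Gamma (\<beta> * real n + (2 - \<beta>)))" for \<tau>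
  define x where "x = t powr \<beta>"
  let ?S = "\<Sum>n. \<beta> * real n * d n * x ^ n / Gamma (\<beta> * real n + (2 - \<beta>))"
  let ?D = "ml_series \<beta> (\<lambda>n. d (Suc n)) t"
  have d1: "1 \<le> 2 - \<beta>" using \<beta> by simp
  have G1: "Gamma (1 - \<beta>) > 0" using b1 by simp
  have smH: "summable (\<lambda>n. d n * x ^ n / Gamma (\<beta> * real n + (2 - \<beta>)))"
    by (rule summable_powser_Gamma[OF \<beta>(1) d1 d])
  note DH = has_real_derivative_ml_powser[OF \<beta>(1) d1 d t]
  have "((\<lambda>\<tau>. \<tau> powr (1 - \<beta>) * H \<tau>) has_real_derivative
      (1 - \<beta>) * t powr (- \<beta>) * H t + t powr (1 - \<beta>) *
      (?S / t)) (at t)"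
    unfolding H_def x_def
    by (rule derivative_eq_intros DH(1) refl | use t in simp)+
  also have "(1 - \<beta>) * t powr (- \<beta>) * H t + t powr (1 - \<beta>) *
      (?S / t) =
      t powr (- \<beta>) * ((1 - \<beta>) * H t + ?S)"
    using t by (simp add: powr_diff powr_minus_divide field_simps)
  also have "(1 - \<beta>) * H t + ?S =
     (\<Sum>n. (1 - \<beta>) * (d n * x ^ n / Gamma (\<beta> * real n + (2 - \<beta>))) + \<beta> * real n * d n * x ^ n / Gamma (\<beta> * real n + (2 - \<beta>)))"
    using suminf_add[OF summable_mult[OF smH, of "1 - \<beta>"] DH(2)[folded x_def]]
    by (simp only: suminf_mult[OF smH] H_def x_def[symmetric])
  \<comment> \<open>The product rule has produced the factor
    \<open>(1 - \<beta>) + \<beta> * n\<close>, which lowers the argument of Gamma by one.\<close>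
  also have "\<dots> = (\<Sum>n. d n * x ^ n / Gamma (\<beta> * real n + (1 - \<beta>)))"
  proof (rule suminf_cong)
    fix n
    have p: "0 < \<beta> * real n + (1 - \<beta>)" using \<beta> b1 by (simp add: add_nonneg_pos)
    then have "\<beta> * real n + (1 - \<beta>) \<notin> \<int>\<^sub>\<le>\<^sub>0" by (auto dest!: nonpos_Ints_nonpos)
    from Gamma_plus1[OF this]
    have "Gamma (\<beta> * real n + (2 - \<beta>)) = (\<beta> * real n + (1 - \<beta>)) * Gamma (\<beta> * real n + (1 - \<beta>))"
      by (simp add: algebra_simps)
    moreover have "Gamma (\<beta> * real n + (1 - \<beta>)) > 0" using p by simp
    ultimately show "(1 - \<beta>) * (d n * x ^ n / Gamma (\<beta> * real n + (2 - \<beta>))) + \<beta> * real n * d n * x ^ n / Gamma (\<beta> * real n + (2 - \<beta>)) =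
       d n * x ^ n / Gamma (\<beta> * real n + (1 - \<beta>))"
      using p by (simp add: divide_simps) (simp add: algebra_simps)
  qed
  \<comment> \<open>The head is the singular term; in the others
    \<open>\<beta> * Suc n + (1 - \<beta>)\<close> equals \<open>\<beta> * n + 1\<close>.\<close>
  also have "\<dots> = d 0 / Gamma (1 - \<beta>) + x * ?D"
  proof -
    have e: "d (Suc n) * x ^ Suc n / Gamma (\<beta> * real (Suc n) + (1 - \<beta>)) = x * (d (Suc n) * x ^ n / Gamma (\<beta> * real n + 1))" for n
      by (simp add: algebra_simps)
    have dS: "\<And>n. \<bar>d (Suc n)\<bar> \<le> (K * M) * M ^ n" using d(1)[of "Suc _"] by (simp add: mult_ac)
    have s: "summable (\<lambda>n. d (Suc n) * x ^ n / Gamma (\<beta> * real n + 1))"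
      by (rule summable_powser_Gamma[OF \<beta>(1) _ dS d(2)]) simp
    have "summable (\<lambda>n. d n * x ^ n / Gamma (\<beta> * real n + (1 - \<beta>)))"
      by (subst summable_Suc_iff[symmetric]) (simp only: e summable_mult s)
    from suminf_split_head[OF this] show ?thesis
      unfolding e suminf_mult[OF s] by (simp add: ml_series_def x_def)
  qed
  also have "t powr (- \<beta>) * (d 0 / Gamma (1 - \<beta>) + x * ?D) =
     d 0 * (t powr (- \<beta>) / Gamma (1 - \<beta>)) + ?D"
    using t by (simp add: x_def powr_minus field_simps)
  finally have D: "((\<lambda>\<tau>. \<tau> powr (1 - \<beta>) * H \<tau>) has_real_derivative
     d 0 * (t powr (- \<beta>) / Gamma (1 - \<beta>)) + ?D) (at t)" .
  have ev: "eventually (\<lambda>\<tau>. \<tau> powr (1 - \<beta>) * H \<tau> =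
      1 / Gamma (1 - \<beta>) * (LINT s:{0..\<tau>}|lborel. ml_series \<beta> d s / (\<tau> - s) powr \<beta>)) (nhds t)"
    using eventually_nhds_in_open[of "{0<..}" t] t G1
    by (auto simp: riemann_liouville_ml_series[OF \<beta>(1) b1 d] H_def elim!: eventually_mono)
  have "(ml_series \<beta> d \<longlongrightarrow> d 0) (at_right 0)"
  proof -
    have "(ml_series \<beta> d \<longlongrightarrow> ml_series \<beta> d 0) (at 0 within {0..})"
      using continuous_on_ml_series[OF \<beta>(1) d] by (simp add: continuous_on_def)
    then show ?thesis using \<beta> by (auto intro: tendsto_within_subset)
  qed
  moreover have "((\<lambda>\<tau>. 1 / Gamma (1 - \<beta>) * (LINT s:{0..\<tau>}|lborel. ml_series \<beta> d s / (\<tau> - s) powr \<beta>))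
      has_real_derivative d 0 * (t powr (- \<beta>) / Gamma (1 - \<beta>)) + ?D) (at t)"
    using D unfolding DERIV_cong_ev[OF refl ev refl] .
  ultimately show ?thesis
    unfolding has_caputo_derivative_def if_not_P[OF False]
    by (intro exI[of _ "d 0"] exI conjI) (assumption, assumption, simp)
qed

text \<open>Up to the factor \<open>(- c) ^ n\<close>, the coefficient of \<open>z ^ k\<close> in \<open>(1 - z) powr (\<alpha> * n)\<close>.\<close>

definition frac_coeff :: "real \<Rightarrow> real \<Rightarrow> nat \<Rightarrow> nat \<Rightarrow> real" where
  "frac_coeff \<alpha> c k n = (-1) ^ k * (- c) ^ n * (\<alpha> * real n gchoose k)"

lemma abs_frac_coeff_le:
  assumes "0 \<le> \<alpha>" "\<alpha> \<le> 1" "0 \<le> c"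
  shows "\<bar>frac_coeff \<alpha> c k n\<bar> \<le> 2 ^ k * (2 * c) ^ n"
proof -
  have "\<bar>\<alpha> * real n gchoose k\<bar> \<le> 2 ^ k * 2 ^ n"
    using assms by (intro abs_gbinomial_le) (auto simp: abs_mult intro: mult_left_le_one_le)
  from mult_right_mono[OF this, of "c ^ n"] assms show ?thesis
    by (simp add: frac_coeff_def abs_mult power_abs power_mult_distrib mult_ac)
qed

lemma frac_difference_eq: "frac_difference \<alpha> u k = (\<Sum>j\<le>k. (-1) ^ j * (\<alpha> gchoose j) * u (k - j))"
proof -
  have b: "(backward_shift ^^ j) u k = (if j \<le> k then u (k - j) else 0)" for j
  proof (induction j arbitrary: k)
    case (Suc j)
    then show ?case by (cases k) (auto simp: backward_shift_def)
  qed simp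
  show ?thesis unfolding frac_difference_def b
    by (subst suminf_finite[of "{..k}"]) auto
qed

text \<open>The coefficient form of (1 - z)^(\<alpha> (n + 1)) = (1 - z)^\<alpha> (1 - z)^(\<alpha>
  n). It turns a shift in n, which is the effect of the Caputo derivative, into the difference
  operator acting on k.\<close>

lemma frac_coeff_Suc:
  "frac_coeff \<alpha> c k (Suc n) = - c * frac_difference \<alpha> (\<lambda>j. frac_coeff \<alpha> c j n) k"
proof -
  have "frac_coeff \<alpha> c k (Suc n) = (-1) ^ k * (- c) ^ Suc n * (\<Sum>j\<le>k. (\<alpha> gchoose j) * (\<alpha> * real n gchoose (k - j)))"
    using gbinomial_Vandermonde[of \<alpha> "\<alpha> * real n" k]
    by (simp add: frac_coeff_def algebra_simps atLeast0AtMost)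
  also have "\<dots> = - c * (\<Sum>j\<le>k. (-1) ^ k * (- c) ^ n * ((\<alpha> gchoose j) * (\<alpha> * real n gchoose (k - j))))"
    by (simp add: sum_distrib_left mult_ac)
  also have "(\<Sum>j\<le>k. (-1) ^ k * (- c) ^ n * ((\<alpha> gchoose j) * (\<alpha> * real n gchoose (k - j)))) =
     (\<Sum>j\<le>k. (-1) ^ j * (\<alpha> gchoose j) * frac_coeff \<alpha> c (k - j) n)"
  proof (rule sum.cong)
    fix j assume "j \<in> {..k}"
    then have "(-1 :: real) ^ k = (-1) ^ j * (-1) ^ (k - j)" by (simp flip: power_add)
    then show "(-1) ^ k * (- c) ^ n * ((\<alpha> gchoose j) * (\<alpha> * real n gchoose (k - j))) =
        (-1) ^ j * (\<alpha> gchoose j) * frac_coeff \<alpha> c (k - j) n"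
      by (simp add: frac_coeff_def mult_ac)
  qed simp
  finally show ?thesis by (simp add: frac_difference_eq)
qed

section \<open>Uniqueness for the fractional Cauchy problem\<close>

lemma lborel_bounded_integrable:
  fixes w :: "real \<Rightarrow> real"
  assumes w: "continuous_on {0..T} w" and b: "\<beta> < 1" and "0 < t" "t \<le> T"
  shows "set_integrable lborel {0..t} (\<lambda>s. w s / (t - s) powr \<beta>)"
proof -
  obtain m where m: "\<And>s. s \<in> {0..T} \<Longrightarrow> \<bar>w s\<bar> \<le> m"
    using compact_imp_bounded[OF compact_continuous_image[OF w compact_Icc]]
    unfolding bounded_iff real_norm_def by blast
  have 1: "set_borel_measurable borel {0..t} w"
    unfolding set_borel_measurable_def using continuous_on_subset[OF w, of "{0..t}"] assms
    by (intro borel_measurable_continuous_on_indicator) auto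
  \<comment> \<open>The majorant \<open>m * (t - s) powr (- \<beta>)\<close>, spelled as a Beta
    integrand with parameters 1 and \<open>1 - \<beta>\<close>. At s = 0 its factor
    \<open>0 powr 0\<close> vanishes, so that point is excluded afterwards.\<close>
  have "integrable lborel (\<lambda>s. m * (indicator {0..t} s * ((s - 0) powr (1 - 1) * (t - s) powr ((1 - \<beta>) - 1))))"
    using has_bochner_integral_Beta[of 1 "1 - \<beta>" 0 t] assms
    by (intro integrable_mult_right) (auto simp: has_bochner_integral_iff)
  then show ?thesis
    unfolding set_integrable_def
  proof (rule Bochner_Integration.integrable_bound)
    have "(\<lambda>s. (indicator {0..t} s *\<^sub>R w s) / (t - s) powr \<beta>) \<in> borel_measurable borel"
      using 1 unfolding set_borel_measurable_def by simp
    then show "(\<lambda>s. indicator {0..t} s *\<^sub>R (w s / (t - s) powr \<beta>)) \<in> borel_measurable lborel" by simp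
    have "AE s in lborel. s \<noteq> (0 :: real)" by (rule AE_lborel_singleton)
    then show "AE s in lborel. norm (indicator {0..t} s *\<^sub>R (w s / (t - s) powr \<beta>)) \<le>
       norm (m * (indicator {0..t} s * ((s - 0) powr (1 - 1) * (t - s) powr ((1 - \<beta>) - 1))))"
    proof eventually_elim
      case (elim s)
      then show ?case using m[of s] assms
        by (auto simp: indicator_def abs_mult powr_minus_divide divide_right_mono)
    qed
  qed
qed

text \<open>Abel's inversion. Exchanging the order of integration over
  \<open>0 \<le> s \<le> \<tau> \<le> t\<close> leaves the integral of \<open>(\<tau> - s) powr (-
  \<beta>) * (t - \<tau>) powr (\<beta> - 1)\<close> over \<open>[s, t]\<close>; the exponents add
  up to -1, so it equals \<open>Beta (1 - \<beta>) \<beta>\<close> for every s < t.\<close>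

lemma abel_equation_convolution:
  fixes w :: "real \<Rightarrow> real"
  assumes w: "continuous_on {0..t} w" and \<beta>: "0 < \<beta>" "\<beta> < 1" and t: "0 < t"
  shows "(LINT \<tau>:{0..t}|lborel. (LINT s:{0..\<tau>}|lborel. w s / (\<tau> - s) powr \<beta>) * (t - \<tau>) powr (\<beta> - 1)) =
     Gamma (1 - \<beta>) * Gamma \<beta> * (LINT s:{0..t}|lborel. w s)"
proof -
  define W where "W s = indicator {0..t} s *\<^sub>R w s" for s
  have [measurable]: "W \<in> borel_measurable borel"
    unfolding W_def using w by (intro borel_measurable_continuous_on_indicator) auto
  have Wi: "integrable lborel W"
    using borel_integrable_compact[OF compact_Icc w] by (simp add: W_def[abs_def] set_integrable_def)
  define f where "f s \<tau> = W s * (indicator {s..t} \<tau> * ((\<tau> - s) powr (- \<beta>) * (t - \<tau>) powr (\<beta> - 1)))" for s \<tau> :: real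
  have [measurable]: "(\<lambda>x. f (fst x) (snd x)) \<in> borel_measurable (lborel \<Otimes>\<^sub>M lborel)"
  proof -
    have "(\<lambda>x. f (fst x) (snd x)) = (\<lambda>x. W (fst x) * ((if fst x \<le> snd x \<and> snd x \<le> t then 1 else 0) * ((snd x - fst x) powr (- \<beta>) * (t - snd x) powr (\<beta> - 1))))"
      by (auto simp: f_def fun_eq_iff indicator_def)
    also have "\<dots> \<in> borel_measurable (lborel \<Otimes>\<^sub>M lborel)" by measurable
    finally show ?thesis .
  qed
  \<comment> \<open>At s = t the interval degenerates and the Beta formula no longer applies; this
    single value of s is discarded.\<close>
  have B: "has_bochner_integral lborel (\<lambda>\<tau>. f s \<tau>) (Gamma (1 - \<beta>) * Gamma \<beta> * W s)" if "s \<noteq> t" for s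
  proof (cases "s \<in> {0..t}")
    case True
    with that have "s < t" by simp
    from has_bochner_integral_mult_right[OF has_bochner_integral_Beta[of "1 - \<beta>" \<beta> s t], of "W s"] this \<beta>
    show ?thesis by (simp add: f_def Beta_def mult_ac)
  qed (simp add: f_def W_def has_bochner_integral_zero)
  have Bn: "(\<integral>\<tau>. norm (f s \<tau>) \<partial>lborel) = Gamma (1 - \<beta>) * Gamma \<beta> * \<bar>W s\<bar>" if "s \<noteq> t" for s
  proof (cases "s \<in> {0..t}")
    case True
    with that have "s < t" by simp
    from has_bochner_integral_mult_right[OF has_bochner_integral_Beta[of "1 - \<beta>" \<beta> s t], of "\<bar>W s\<bar>"] this \<beta>
    show ?thesis by (simp add: f_def Beta_def abs_mult mult_ac has_bochner_integral_iff)
  qed (simp add: f_def W_def has_bochner_integral_zero)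
  have ae: "AE s in lborel. s \<noteq> t" by (rule AE_lborel_singleton)
  have int: "integrable (lborel \<Otimes>\<^sub>M lborel) (\<lambda>x. f (fst x) (snd x))"
  proof (rule lborel_pair.Fubini_integrable)
    show "AE s in lborel. integrable lborel (\<lambda>\<tau>. f (fst (s, \<tau>)) (snd (s, \<tau>)))"
      using ae by eventually_elim (use B in \<open>auto simp: has_bochner_integral_iff\<close>)
    have "integrable lborel (\<lambda>s. Gamma (1 - \<beta>) * Gamma \<beta> * \<bar>W s\<bar>)" using Wi by auto
    then show "integrable lborel (\<lambda>s. \<integral>\<tau>. norm (f (fst (s, \<tau>)) (snd (s, \<tau>))) \<partial>lborel)"
      by (rule integrable_cong_AE_imp)
         (use ae Bn in \<open>auto elim!: eventually_mono intro!: lborel.borel_measurable_lebesgue_integral\<close>)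
  qed simp
  have inner: "(\<integral>s. f s \<tau> \<partial>lborel) = indicator {0..t} \<tau> *\<^sub>R ((LINT s:{0..\<tau>}|lborel. w s / (\<tau> - s) powr \<beta>) * (t - \<tau>) powr (\<beta> - 1))" for \<tau>
  proof -
    have "f s \<tau> = indicator {0..t} \<tau> * (t - \<tau>) powr (\<beta> - 1) * (indicator {0..\<tau>} s *\<^sub>R (w s / (\<tau> - s) powr \<beta>))" for s
      by (auto simp: f_def W_def indicator_def powr_minus_divide)
    then have "(\<integral>s. f s \<tau> \<partial>lborel) = (\<integral>s. indicator {0..t} \<tau> * (t - \<tau>) powr (\<beta> - 1) * (indicator {0..\<tau>} s *\<^sub>R (w s / (\<tau> - s) powr \<beta>)) \<partial>lborel)"
      by (simp only:)
    also have "\<dots> = indicator {0..t} \<tau> * (t - \<tau>) powr (\<beta> - 1) * (LINT s:{0..\<tau>}|lborel. w s / (\<tau> - s) powr \<beta>)"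
      unfolding set_lebesgue_integral_def by (rule integral_mult_right_zero)
    finally show ?thesis by simp
  qed
  have "(\<integral>\<tau>. (\<integral>s. f s \<tau> \<partial>lborel) \<partial>lborel) = (\<integral>s. (\<integral>\<tau>. f s \<tau> \<partial>lborel) \<partial>lborel)"
    using lborel_pair.Fubini_integral[of f] int by (simp add: case_prod_beta')
  also have "\<dots> = (\<integral>s. Gamma (1 - \<beta>) * Gamma \<beta> * W s \<partial>lborel)"
    by (rule integral_cong_AE)
       (use ae B in \<open>auto elim!: eventually_mono simp: has_bochner_integral_iff intro!: lborel.borel_measurable_lebesgue_integral\<close>)
  also have "\<dots> = Gamma (1 - \<beta>) * Gamma \<beta> * (LINT s:{0..t}|lborel. w s)"
    by (simp add: W_def set_lebesgue_integral_def)
  finally show ?thesis by (simp add: inner set_lebesgue_integral_def)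
qed

text \<open>Reflecting by \<open>r = t - \<tau>\<close> and extending to the half-line gives a Gamma
  integral. The kernel therefore maps the weight \<open>exp (K * \<tau>)\<close> to at most
  \<open>Gamma \<beta> * K powr (- \<beta>)\<close> times itself, a factor that is small for large
  K.\<close>

lemma powr_exp_convolution_le:
  fixes t K :: real
  assumes \<beta>: "0 < \<beta>" and K: "0 < K"
  shows "(\<integral>\<^sup>+\<tau>. ennreal (indicator {0..t} \<tau> * ((t - \<tau>) powr (\<beta> - 1) * exp (K * \<tau>))) \<partial>lborel)
    \<le> ennreal (exp (K * t) * (Gamma \<beta> * K powr (- \<beta>)))"
proof -
  have "(\<integral>\<^sup>+\<tau>. ennreal (indicator {0..t} \<tau> * ((t - \<tau>) powr (\<beta> - 1) * exp (K * \<tau>))) \<partial>lborel) =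
    (\<integral>\<^sup>+r. ennreal (indicator {0..t} (t - r) * (r powr (\<beta> - 1) * exp (K * (t - r)))) \<partial>lborel)"
    by (subst nn_integral_real_affine[where c = "-1" and t = t]) auto
  also have "\<dots> \<le> (\<integral>\<^sup>+r. ennreal (exp (K * t)) * (ennreal (r powr (\<beta> - 1) * exp (- r * K)) * indicator {0<..} r) \<partial>lborel)"
  proof (rule nn_integral_mono)
    fix r :: real
    have "exp (K * (t - r)) = exp (K * t) * exp (- r * K)" by (simp add: algebra_simps flip: exp_add)
    then show "ennreal (indicator {0..t} (t - r) * (r powr (\<beta> - 1) * exp (K * (t - r)))) \<le>
       ennreal (exp (K * t)) * (ennreal (r powr (\<beta> - 1) * exp (- r * K)) * indicator {0<..} r)"
      by (cases "r = 0") (auto simp: indicator_def ennreal_mult'[symmetric] mult_ac)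
  qed
  also have "\<dots> = ennreal (exp (K * t)) * (\<integral>\<^sup>+r. ennreal (r powr (\<beta> - 1) * exp (- r * K)) * indicator {0<..} r \<partial>lborel)"
    by (rule nn_integral_cmult) simp
  also have "\<dots> = ennreal (exp (K * t)) * ennreal (Gamma \<beta> * K powr (- \<beta>))"
    by (simp only: nn_integral_powr_exp_scale[OF \<beta> K])
  finally show ?thesis by (simp add: ennreal_mult')
qed

text \<open>In the sup norm on \<open>[0, t]\<close> weighted by \<open>exp (- K * s)\<close> the
  Volterra operator is a contraction for large K. At a point s where the weighted maximum m is
  attained, the equation yields \<open>m \<le> m / 2\<close>.\<close>

lemma abel_volterra_zero:
  fixes W :: "real \<Rightarrow> real"
  assumes W: "continuous_on {0..} W" and \<beta>: "0 < \<beta>"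
    and eq: "\<And>t. 0 < t \<Longrightarrow> W t = q * (LINT \<tau>:{0..t}|lborel. W \<tau> * (t - \<tau>) powr (\<beta> - 1))"
    and W0: "W 0 = 0" and t: "0 \<le> t"
  shows "W t = 0"
proof -
  define g where "g K = \<bar>q\<bar> * (Gamma \<beta> * K powr (- \<beta>))" for K
  have "(g \<longlongrightarrow> 0) at_top"
    unfolding g_def using \<beta> by real_asymp
  then have "eventually (\<lambda>K. g K < 1 / 2) at_top" by (rule order_tendstoD) simp
  then have "eventually (\<lambda>K. g K < 1 / 2 \<and> 0 < K) at_top"
    using eventually_gt_at_top[of 0] by (rule eventually_conj)
  then obtain K where K: "g K < 1 / 2" "0 < K" by (auto simp: eventually_at_top_linorder)
  have c: "continuous_on {0..t} (\<lambda>s. \<bar>W s\<bar> * exp (- K * s))"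
    using continuous_on_subset[OF W] by (intro continuous_intros) auto
  obtain s where s: "s \<in> {0..t}" and ms: "\<And>r. r \<in> {0..t} \<Longrightarrow> \<bar>W r\<bar> * exp (- K * r) \<le> \<bar>W s\<bar> * exp (- K * s)"
    using continuous_attains_sup[OF compact_Icc _ c] t by fastforce
  define m where "m = \<bar>W s\<bar> * exp (- K * s)"
  have bnd: "\<bar>W r\<bar> \<le> m * exp (K * r)" if "r \<in> {0..t}" for r
  proof -
    have "\<bar>W r\<bar> = \<bar>W r\<bar> * exp (- K * r) * exp (K * r)" by (simp flip: exp_add)
    also have "\<dots> \<le> m * exp (K * r)" unfolding m_def by (intro mult_right_mono ms that) auto
    finally show ?thesis .
  qed
  have "m = 0"
  proof (cases "s = 0")
    case True
    then show ?thesis using W0 by (simp add: m_def)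
  next
    case False
    with s have s0: "0 < s" by simp
  let ?G = "exp (K * s) * (Gamma \<beta> * K powr (- \<beta>))"
    define Z where "Z = (LINT \<tau>:{0..s}|lborel. W \<tau> * (s - \<tau>) powr (\<beta> - 1))"
    have m0: "0 \<le> m" by (simp add: m_def)
    have G0: "0 \<le> Gamma \<beta>" using \<beta> by simp
    have "ennreal \<bar>Z\<bar> \<le> (\<integral>\<^sup>+\<tau>. ennreal (norm (indicator {0..s} \<tau> *\<^sub>R (W \<tau> * (s - \<tau>) powr (\<beta> - 1)))) \<partial>lborel)"
      (is "_ \<le> (\<integral>\<^sup>+\<tau>. ennreal (norm (?f \<tau>)) \<partial>lborel)")
    \<comment> \<open>A non-integrable function has the integral 0 by convention, so the bound holds
      in either case.\<close>
    proof (cases "integrable lborel ?f")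
      case True
      then show ?thesis
        unfolding Z_def set_lebesgue_integral_def real_norm_def[symmetric]
        by (rule integral_norm_bound_ennreal)
    qed (simp add: Z_def set_lebesgue_integral_def not_integrable_integral_eq)
    also have "\<dots> \<le> (\<integral>\<^sup>+\<tau>. ennreal m * ennreal (indicator {0..s} \<tau> * ((s - \<tau>) powr (\<beta> - 1) * exp (K * \<tau>))) \<partial>lborel)"
    proof (rule nn_integral_mono)
      fix \<tau> :: real
      have "norm (indicator {0..s} \<tau> *\<^sub>R (W \<tau> * (s - \<tau>) powr (\<beta> - 1))) = indicator {0..s} \<tau> * (s - \<tau>) powr (\<beta> - 1) * \<bar>W \<tau>\<bar>"
        by (simp add: abs_mult mult_ac)
      also have "\<dots> \<le> indicator {0..s} \<tau> * (s - \<tau>) powr (\<beta> - 1) * (m * exp (K * \<tau>))"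
        using bnd[of \<tau>] s by (auto simp: indicator_def intro!: mult_left_mono)
      finally show "ennreal (norm (indicator {0..s} \<tau> *\<^sub>R (W \<tau> * (s - \<tau>) powr (\<beta> - 1)))) \<le>
         ennreal m * ennreal (indicator {0..s} \<tau> * ((s - \<tau>) powr (\<beta> - 1) * exp (K * \<tau>)))"
        using m0 by (simp add: ennreal_mult'[symmetric] mult_ac)
    qed
    also have "\<dots> \<le> ennreal m * ennreal ?G"
      by (subst nn_integral_cmult) (auto intro!: mult_left_mono powr_exp_convolution_le \<beta> K)
    also have "\<dots> = ennreal (m * ?G)"
      using m0 by (simp add: ennreal_mult')
    finally have "\<bar>Z\<bar> \<le> m * ?G"
      using m0 G0 by (subst (asm) ennreal_le_iff) auto
    then have "\<bar>q\<bar> * \<bar>Z\<bar> \<le> \<bar>q\<bar> * (m * ?G)"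
      by (intro mult_left_mono) auto
    then have "\<bar>W s\<bar> \<le> m * exp (K * s) * g K"
      using eq[OF s0] by (simp add: Z_def g_def abs_mult mult_ac)
    then have "\<bar>W s\<bar> * exp (- K * s) \<le> m * exp (K * s) * g K * exp (- K * s)"
      by (intro mult_right_mono) auto
    also have "\<dots> = m * g K * (exp (K * s) * exp (- K * s))" by (simp add: mult_ac)
    also have "\<dots> = m * g K" by (simp flip: exp_add)
    also have "\<dots> \<le> m * (1 / 2)" using K m0 by (intro mult_left_mono) auto
    finally have "m \<le> m * (1 / 2)" by (simp only: m_def)
    with m0 show ?thesis by simp
  qed
  then show ?thesis using bnd[of t] t by simp
qed

text \<open>With V the Abel integral and W the primitive of w, \<open>V + c * W\<close> is constant
  for positive times, and the constant is 0 since both parts tend to 0 at 0. Abel's inversion of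
  \<open>V = - c * W\<close> is a Volterra equation for W; so W vanishes, and with it its derivative
  w.\<close>

lemma abel_derivative_zero:
  fixes w :: "real \<Rightarrow> real"
  assumes w: "continuous_on {0..} w" and \<beta>: "0 < \<beta>" "\<beta> < 1"
    and D: "\<And>t. 0 < t \<Longrightarrow> ((\<lambda>\<tau>. LINT s:{0..\<tau>}|lborel. w s / (\<tau> - s) powr \<beta>)
        has_real_derivative (- c * w t)) (at t)"
    and t: "0 < t"
  shows "w t = 0"
proof -
  define V where "V \<tau> = (LINT s:{0..\<tau>}|lborel. w s / (\<tau> - s) powr \<beta>)" for \<tau>
  define W where "W \<tau> = integral {0..\<tau>} w" for \<tau>
  have wc: "continuous_on {0..T} w" for T using w by (rule continuous_on_subset) auto
  have W0: "W 0 = 0" by (simp add: W_def)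
  have WL: "(LINT s:{0..T}|lborel. w s) = W T" for T
    unfolding W_def by (rule set_borel_integral_eq_integral(2)) (use borel_integrable_compact[OF compact_Icc wc] in \<open>unfold set_integrable_def\<close>)
  have DW: "(W has_real_derivative w \<tau>) (at \<tau>)" if "0 < \<tau>" for \<tau>
  proof -
    have "(W has_real_derivative w \<tau>) (at \<tau> within {0..\<tau> + 1})"
      unfolding W_def using that by (intro integral_has_real_derivative wc) auto
    then show ?thesis using that by (simp add: at_within_Icc_at)
  qed
  have Wc: "continuous_on {0..} W"
  proof -
    have cT: "continuous_on {0..T} W" for T
      unfolding W_def by (intro indefinite_integral_continuous_1 integrable_continuous_real wc)
    have "isCont W \<tau>" if "0 < \<tau>" for \<tau> using DW[OF that] by (rule DERIV_isCont)
    moreover have "continuous (at 0 within {0..}) W"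
    proof -
      have "continuous (at 0 within {0..1}) W"
        using cT[of 1] by (simp add: continuous_on_eq_continuous_within)
      moreover have "at 0 within {0..1::real} = at 0 within {0..}"
        by (rule at_within_nhd[of _ "{..<1}"]) auto
      ultimately show ?thesis by simp
    qed
    ultimately show ?thesis
      unfolding continuous_on_eq_continuous_within
      by (metis atLeast_iff continuous_at_imp_continuous_at_within le_less)
  qed
  have V: "V \<tau> = - c * W \<tau>" if \<tau>: "0 < \<tau>" for \<tau>
  proof -
    define h where "h r = V r + c * W r" for r
    have Dh: "(h has_real_derivative 0) (at r)" if "0 < r" for r
      using DERIV_add[OF D[OF that] DERIV_cmult[OF DW[OF that], of c]]
      by (simp add: h_def[abs_def] V_def[abs_def])
    then obtain C where C: "\<And>r. 0 < r \<Longrightarrow> h r = C"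
      using has_field_derivative_zero_constant[of "{0<..}" h, OF _ has_field_derivative_at_within[OF Dh]] by auto
    obtain m where m: "\<And>s. s \<in> {0..1} \<Longrightarrow> \<bar>w s\<bar> \<le> m"
      using compact_imp_bounded[OF compact_continuous_image[OF wc compact_Icc]]
      unfolding bounded_iff real_norm_def by blast
    \<comment> \<open>Boundedness of w near 0 makes V of order \<open>r powr (1 - \<beta>)\<close>,
      which determines the constant of integration.\<close>
    have Vb: "\<bar>V r\<bar> \<le> m * (r powr (1 - \<beta>) * Beta 1 (1 - \<beta>))" if r: "0 < r" "r < 1" for r
    proof -
      define B where "B s = m * (indicator {0..r} s * ((s - 0) powr (1 - 1) * (r - s) powr ((1 - \<beta>) - 1)))" for s
      have B: "has_bochner_integral lborel B (m * ((r - 0) powr (1 + (1 - \<beta>) - 1) * Beta 1 (1 - \<beta>)))"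
        unfolding B_def using r \<beta> by (intro has_bochner_integral_mult_right has_bochner_integral_Beta) auto
      have i: "integrable lborel (\<lambda>s. indicator {0..r} s *\<^sub>R (w s / (r - s) powr \<beta>))"
        using lborel_bounded_integrable[OF wc[of 1] \<beta>(2), of r] r by (simp add: set_integrable_def)
      have "\<bar>V r\<bar> \<le> (\<integral>s. \<bar>indicator {0..r} s *\<^sub>R (w s / (r - s) powr \<beta>)\<bar> \<partial>lborel)"
        unfolding V_def set_lebesgue_integral_def by (rule integral_abs_bound)
      also have "\<dots> \<le> integral\<^sup>L lborel B"
      proof (rule integral_mono_AE)
        have "AE s in lborel. s \<noteq> (0 :: real)" by (rule AE_lborel_singleton)
        then show "AE s in lborel. \<bar>indicator {0..r} s *\<^sub>R (w s / (r - s) powr \<beta>)\<bar> \<le> B s"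
        proof eventually_elim
          case (elim s)
          then show ?case using m[of s] r
            by (auto simp: B_def indicator_def powr_minus_divide divide_right_mono)
        qed
      qed (use integrable_abs[OF i] B in \<open>simp_all add: has_bochner_integral_iff\<close>)
      finally show ?thesis using B by (simp add: has_bochner_integral_iff)
    qed
    have "(V \<longlongrightarrow> 0) (at_right 0)"
    proof (rule Lim_null_comparison)
      show "eventually (\<lambda>r. norm (V r) \<le> m * (r powr (1 - \<beta>) * Beta 1 (1 - \<beta>))) (at_right 0)"
        using eventually_at_right_less[of 0] eventually_at_right_real[of 0 1]
        by (auto elim!: eventually_mono intro: Vb)
      show "((\<lambda>r. m * (r powr (1 - \<beta>) * Beta 1 (1 - \<beta>))) \<longlongrightarrow> 0) (at_right 0)"
        using \<beta> by real_asymp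
    qed
    moreover have "(W \<longlongrightarrow> 0) (at_right 0)"
    proof -
      have "(W \<longlongrightarrow> W 0) (at 0 within {0..})"
        using Wc by (simp add: continuous_on_def)
      then show ?thesis using W0 by (auto intro: tendsto_within_subset)
    qed
    ultimately have "(h \<longlongrightarrow> 0 + c * 0) (at_right 0)"
      unfolding h_def by (intro tendsto_intros)
    moreover have "(h \<longlongrightarrow> C) (at_right 0)"
      by (rule tendsto_eventually) (use eventually_at_right_less[of 0] C in \<open>auto elim!: eventually_mono\<close>)
    ultimately have "C = 0" by (simp add: tendsto_unique[OF trivial_limit_at_right_real])
    with C[OF \<tau>] show ?thesis by (simp add: h_def)
  qed
  \<comment> \<open>The relation between V and W is wanted on the closed interval of the
    convolution, hence at 0 as well.\<close>
  have V0: "V 0 = 0"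
  proof -
    have "AE s in lborel. s \<noteq> (0 :: real)" by (rule AE_lborel_singleton)
    then show ?thesis unfolding V_def set_lebesgue_integral_def
      by (intro integral_eq_zero_AE) (auto elim!: eventually_mono simp: indicator_def)
  qed
  define G where "G = Gamma (1 - \<beta>) * Gamma \<beta>"
  have G: "0 < G" unfolding G_def using \<beta> by simp
  have eqW: "W r = - c / G * (LINT \<tau>:{0..r}|lborel. W \<tau> * (r - \<tau>) powr (\<beta> - 1))" if r: "0 < r" for r
  proof -
    have "G * W r = (LINT \<tau>:{0..r}|lborel. V \<tau> * (r - \<tau>) powr (\<beta> - 1))"
      using abel_equation_convolution[OF wc \<beta> r] by (simp add: V_def WL G_def)
    also have "\<dots> = (LINT \<tau>:{0..r}|lborel. - c * (W \<tau> * (r - \<tau>) powr (\<beta> - 1)))"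
      using V V0 W0 by (intro set_lebesgue_integral_cong) (auto simp: le_less)
    also have "\<dots> = - c * (LINT \<tau>:{0..r}|lborel. W \<tau> * (r - \<tau>) powr (\<beta> - 1))"
      by (rule set_integral_mult_right)
    finally show ?thesis using G by (simp add: field_simps)
  qed
  have z: "W r = 0" if "0 \<le> r" for r
    by (rule abel_volterra_zero[OF Wc \<beta>(1) eqW W0 that])
  have "eventually (\<lambda>r. r \<in> {0<..}) (nhds t)" using t by (intro eventually_nhds_in_open) auto
  then have "eventually (\<lambda>r. W r = 0) (nhds t)" by eventually_elim (simp add: z)
  from DERIV_cong_ev[OF refl this refl] DW[OF t] have "((\<lambda>r. 0) has_real_derivative w t) (at t)" by simp
  then show ?thesis using DERIV_unique DERIV_const by blast
qed


text \<open>The coefficient of \<open>(I - B)^\<alpha>\<close> at j = 0 is 1 and the other terms see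
  only indices below k. This triangular form reduces the system to one scalar equation for each
  k.\<close>

lemma frac_difference_diff:
  assumes "\<And>j. j < k \<Longrightarrow> u j = v j"
  shows "frac_difference \<alpha> u k - frac_difference \<alpha> v k = u k - v k"
proof -
  have "frac_difference \<alpha> u k - frac_difference \<alpha> v k =
    (\<Sum>j\<le>k. (-1) ^ j * (\<alpha> gchoose j) * (u (k - j) - v (k - j)))"
    by (simp add: frac_difference_eq sum_subtractf algebra_simps)
  also have "\<dots> = (\<Sum>j\<in>{0}. (-1) ^ j * (\<alpha> gchoose j) * (u (k - j) - v (k - j)))"
    using assms by (intro sum.mono_neutral_right) auto
  finally show ?thesis by simp
qed

lemma linear_ode_zero:
  fixes w :: "real \<Rightarrow> real"
  assumes w: "continuous_on {0..} w" "w 0 = 0"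
    and D: "\<And>t. 0 < t \<Longrightarrow> (w has_real_derivative - c * w t) (at t)" and t: "0 \<le> t"
  shows "w t = 0"
proof (cases "t = 0")
  case False
  with t have t0: "0 < t" by simp
  have "exp (c * t) * w t = exp (c * 0) * w 0"
  proof (rule DERIV_isconst2[OF t0])
    show "continuous_on {0..t} (\<lambda>t. exp (c * t) * w t)"
      using continuous_on_subset[OF w(1)] by (intro continuous_intros) auto
    show "((\<lambda>t. exp (c * t) * w t) has_real_derivative 0) (at s)" if "0 < s" for s
      by (rule derivative_eq_intros D[OF that] refl | simp)+
  qed (use t0 in auto)
  with w show ?thesis by simp
qed (use w in simp)

lemma frac_cauchy_unique:
  assumes \<beta>: "0 < \<beta>" "\<beta> \<le> 1"
    and u: "solves_frac_cauchy \<alpha> \<beta> lam u" and v: "solves_frac_cauchy \<alpha> \<beta> lam v" and t: "0 \<le> t"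
  shows "u k t = v k t"
  using t
proof (induction k arbitrary: t rule: less_induct)
  case (less k)
  define c where "c = lam powr \<alpha>"
  define w where "w t = u k t - v k t" for t
  have cu: "continuous_on {0..} (u k)" and cv: "continuous_on {0..} (v k)"
    using u v by (auto simp: solves_frac_cauchy_def)
  have wc: "continuous_on {0..} w" unfolding w_def by (intro continuous_intros cu cv)
  have w0: "u k 0 = v k 0"
    using u v by (cases "k = 0") (auto simp: solves_frac_cauchy_def)
  have DD: "\<exists>D E. has_caputo_derivative \<beta> (u k) D s \<and> has_caputo_derivative \<beta> (v k) E s \<and> D - E = - c * w s"
    if s: "0 < s" for s
  proof -
    obtain D E where D: "has_caputo_derivative \<beta> (u k) D s" "D + c * frac_difference \<alpha> (\<lambda>j. u j s) k = 0"
      and E: "has_caputo_derivative \<beta> (v k) E s" "E + c * frac_difference \<alpha> (\<lambda>j. v j s) k = 0"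
      using u v s unfolding solves_frac_cauchy_def c_def by blast
    have "D - E = - c * (frac_difference \<alpha> (\<lambda>j. u j s) k - frac_difference \<alpha> (\<lambda>j. v j s) k)"
      using D(2) E(2) by (simp add: algebra_simps)
    also have "\<dots> = - c * w s"
      using less.IH s unfolding w_def by (subst frac_difference_diff) auto
    finally show ?thesis using D E by blast
  qed
  have "w t = 0"
  proof (cases "\<beta> = 1")
    case True
    show ?thesis
    proof (rule linear_ode_zero[OF wc _ _ less.prems])
      fix s :: real assume s: "0 < s"
      show "(w has_real_derivative - c * w s) (at s)"
        using DD[OF s] unfolding has_caputo_derivative_def if_P[OF True] w_def
        by (metis DERIV_diff)
    qed (simp add: w_def w0)
  next
    case False
    with \<beta> have b1: "\<beta> < 1" by simp
    define J where "J f \<tau> = (LINT s:{0..\<tau>}|lborel. f s / (\<tau> - s) powr \<beta>)" for f :: "real \<Rightarrow> real" and \<tau>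
    have G: "0 < Gamma (1 - \<beta>)" using b1 by simp
    \<comment> \<open>The definition of the Caputo derivative quantifies the limit at 0
      existentially. Continuity pins it to the value at 0, so the correction terms of the two
      solutions cancel.\<close>
    have lim: "b = f 0" if "(f \<longlongrightarrow> b) (at_right 0)" "continuous_on {0..} f" for f :: "real \<Rightarrow> real" and b
    proof -
      have "(f \<longlongrightarrow> f 0) (at 0 within {0..})" using that(2) by (simp add: continuous_on_def)
      then have "(f \<longlongrightarrow> f 0) (at_right 0)" by (rule tendsto_within_subset) auto
      with that(1) show ?thesis by (rule tendsto_unique[OF trivial_limit_at_right_real])
    qed
    have Jw: "J w \<tau> = J (u k) \<tau> - J (v k) \<tau>" if "0 < \<tau>" for \<tau>
    proof -
      have "set_integrable lborel {0..\<tau>} (\<lambda>s. f s / (\<tau> - s) powr \<beta>)" if "continuous_on {0..} f" for f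
        by (rule lborel_bounded_integrable[where T = \<tau>]) (use that b1 \<open>0 < \<tau>\<close> in \<open>auto intro: continuous_on_subset\<close>)
      from set_integral_diff(2)[OF this[OF cu] this[OF cv]] show ?thesis
        by (simp add: J_def w_def diff_divide_distrib)
    qed
    have D: "(J w has_real_derivative - (Gamma (1 - \<beta>) * c) * w s) (at s)" if s: "0 < s" for s
    proof -
      obtain D E where DE: "has_caputo_derivative \<beta> (u k) D s" "has_caputo_derivative \<beta> (v k) E s" "D - E = - c * w s"
        using DD[OF s] by blast
      obtain b R where R: "(u k \<longlongrightarrow> b) (at_right 0)"
          "((\<lambda>\<tau>. 1 / Gamma (1 - \<beta>) * J (u k) \<tau>) has_real_derivative R) (at s)"
          "D = R - b * (s powr (- \<beta>) / Gamma (1 - \<beta>))"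
        using DE(1) unfolding has_caputo_derivative_def if_not_P[OF False] J_def by blast
      obtain b' R' where R': "(v k \<longlongrightarrow> b') (at_right 0)"
          "((\<lambda>\<tau>. 1 / Gamma (1 - \<beta>) * J (v k) \<tau>) has_real_derivative R') (at s)"
          "E = R' - b' * (s powr (- \<beta>) / Gamma (1 - \<beta>))"
        using DE(2) unfolding has_caputo_derivative_def if_not_P[OF False] J_def by blast
      have "b = b'" using lim[OF R(1) cu] lim[OF R'(1) cv] w0 by simp
      then have RR: "R - R' = - c * w s" using R(3) R'(3) DE(3) by simp
      have "((\<lambda>\<tau>. Gamma (1 - \<beta>) * (1 / Gamma (1 - \<beta>) * J (u k) \<tau> - 1 / Gamma (1 - \<beta>) * J (v k) \<tau>))
          has_real_derivative Gamma (1 - \<beta>) * (R - R')) (at s)"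
        by (intro DERIV_cmult DERIV_diff R R')
      moreover have "Gamma (1 - \<beta>) * (1 / Gamma (1 - \<beta>) * J (u k) \<tau> - 1 / Gamma (1 - \<beta>) * J (v k) \<tau>) = J (u k) \<tau> - J (v k) \<tau>" for \<tau>
        using G by (simp add: right_diff_distrib)
      ultimately have "((\<lambda>\<tau>. J (u k) \<tau> - J (v k) \<tau>) has_real_derivative - (Gamma (1 - \<beta>) * c) * w s) (at s)"
        by (simp add: RR mult.assoc)
      moreover have "eventually (\<lambda>\<tau>. J w \<tau> = J (u k) \<tau> - J (v k) \<tau>) (nhds s)"
        using eventually_nhds_in_open[of "{0<..}" s] s by (auto elim!: eventually_mono simp: Jw)
      ultimately show ?thesis by (subst DERIV_cong_ev[OF refl _ refl])
    qed
    show ?thesis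
    proof (cases "t = 0")
      case False
      with less.prems show ?thesis
        by (intro abel_derivative_zero[OF wc \<beta>(1) b1 D[unfolded J_def]]) auto
    qed (simp add: w_def w0)
  qed
  then show ?case by (simp add: w_def)
qed

section \<open>The explicit solution\<close>

text \<open>The law of the space-time fractional Poisson process, with c standing for
  \<open>lam powr \<alpha>\<close>. That the values are nonnegative is not visible in this
  alternating form; it will follow from their meaning as probabilities.\<close>

definition frac_pmf :: "real \<Rightarrow> real \<Rightarrow> real \<Rightarrow> nat \<Rightarrow> real \<Rightarrow> real" where
  "frac_pmf \<alpha> \<beta> c k = ml_series \<beta> (frac_coeff \<alpha> c k)"

lemma ml_series_frac_coeff_Suc:
  assumes \<alpha>: "0 \<le> \<alpha>" "\<alpha> \<le> 1" and \<beta>: "0 < \<beta>" and c: "0 \<le> c"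
  shows "ml_series \<beta> (\<lambda>n. frac_coeff \<alpha> c k (Suc n)) t = - c * frac_difference \<alpha> (\<lambda>j. frac_pmf \<alpha> \<beta> c j t) k"
proof -
  have s: "summable (\<lambda>n. frac_coeff \<alpha> c j n * (t powr \<beta>) ^ n / Gamma (\<beta> * real n + 1))" for j
    by (rule summable_powser_Gamma[OF \<beta> _ abs_frac_coeff_le[OF \<alpha> c]]) (use c in auto)
  have "frac_coeff \<alpha> c k (Suc n) * (t powr \<beta>) ^ n / Gamma (\<beta> * real n + 1) =
     - c * (\<Sum>j\<le>k. (-1) ^ j * (\<alpha> gchoose j) * (frac_coeff \<alpha> c (k - j) n * (t powr \<beta>) ^ n / Gamma (\<beta> * real n + 1)))" for n
    unfolding frac_coeff_Suc frac_difference_eq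
    by (simp add: sum_distrib_left sum_distrib_right sum_divide_distrib mult_ac)
  moreover have "(\<lambda>n. - c * (\<Sum>j\<le>k. (-1) ^ j * (\<alpha> gchoose j) * (frac_coeff \<alpha> c (k - j) n * (t powr \<beta>) ^ n / Gamma (\<beta> * real n + 1))))
     sums (- c * (\<Sum>j\<le>k. (-1) ^ j * (\<alpha> gchoose j) * frac_pmf \<alpha> \<beta> c (k - j) t))"
    unfolding frac_pmf_def ml_series_def by (intro sums_mult sums_sum summable_sums s)
  ultimately show ?thesis by (simp add: ml_series_def frac_difference_eq sums_iff)
qed

lemma frac_pmf_0: "0 < \<beta> \<Longrightarrow> frac_pmf \<alpha> \<beta> c k 0 = (if k = 0 then 1 else 0)"
  by (cases k) (auto simp: frac_pmf_def frac_coeff_def)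

lemma continuous_on_frac_pmf:
  assumes "0 \<le> \<alpha>" "\<alpha> \<le> 1" "0 < \<beta>" "0 \<le> c"
  shows "continuous_on {0..} (frac_pmf \<alpha> \<beta> c k)"
  unfolding frac_pmf_def
  by (rule continuous_on_ml_series[OF assms(3) abs_frac_coeff_le[OF assms(1,2,4)]]) (use assms in auto)

lemma frac_pmf_solves_frac_cauchy:
  assumes \<alpha>: "0 \<le> \<alpha>" "\<alpha> \<le> 1" and \<beta>: "0 < \<beta>" "\<beta> \<le> 1"
  shows "solves_frac_cauchy \<alpha> \<beta> lam (frac_pmf \<alpha> \<beta> (lam powr \<alpha>))"
  unfolding solves_frac_cauchy_def
proof (intro conjI allI impI)
  fix k and t :: real assume t: "0 < t"
  let ?c = "lam powr \<alpha>"
  have "has_caputo_derivative \<beta> (frac_pmf \<alpha> \<beta> ?c k) (ml_series \<beta> (\<lambda>n. frac_coeff \<alpha> ?c k (Suc n)) t) t"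
    unfolding frac_pmf_def
    by (rule has_caputo_derivative_ml_series[OF \<beta> abs_frac_coeff_le[OF \<alpha>] _ t]) auto
  moreover have "ml_series \<beta> (\<lambda>n. frac_coeff \<alpha> ?c k (Suc n)) t + ?c * frac_difference \<alpha> (\<lambda>j. frac_pmf \<alpha> \<beta> ?c j t) k = 0"
    using ml_series_frac_coeff_Suc[OF \<alpha> \<beta>(1)] by simp
  ultimately show "\<exists>D. has_caputo_derivative \<beta> (frac_pmf \<alpha> \<beta> ?c k) D t \<and>
      D + ?c * frac_difference \<alpha> (\<lambda>j. frac_pmf \<alpha> \<beta> ?c j t) k = 0" by blast
qed (use assms in \<open>auto simp: frac_pmf_0 intro: continuous_on_frac_pmf\<close>)

text \<open>The alternating partial sum of the binomials of \<open>\<alpha> * n\<close> up to k - 1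
  is, up to sign, the binomial of \<open>\<alpha> * n - 1\<close> at k - 1. The factor n, to be
  supplied by differentiating t^(\<beta> n), lets the absorption identity raise it to the binomial
  of \<open>\<alpha> * n\<close> at k; this is the origin of \<open>k / \<alpha>\<close> in the
  density.\<close>

lemma sum_frac_coeff:
  assumes "\<alpha> \<noteq> 0" "1 \<le> k"
  shows "- (\<Sum>j<k. frac_coeff \<alpha> c j n) * real n = real k / \<alpha> * frac_coeff \<alpha> c k n"
proof -
  obtain m where k: "k = Suc m" using assms by (cases k) auto
  have "(\<Sum>j<k. frac_coeff \<alpha> c j n) = (- c) ^ n * (\<Sum>j\<le>m. (\<alpha> * real n gchoose j) * (-1) ^ j)"
    by (simp add: k lessThan_Suc_atMost frac_coeff_def sum_distrib_left mult_ac)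
  also have "\<dots> = (- c) ^ n * ((-1) ^ m * (\<alpha> * real n - 1 gchoose m))"
    by (simp add: gbinomial_sum_lower_neg)
  finally have "- (\<Sum>j<k. frac_coeff \<alpha> c j n) * real n =
     (- c) ^ n * (-1) ^ k / \<alpha> * (\<alpha> * real n * (\<alpha> * real n - 1 gchoose m))"
    using assms by (simp add: k)
  also have "\<alpha> * real n * (\<alpha> * real n - 1 gchoose m) = real k * (\<alpha> * real n gchoose k)"
    unfolding k by (rule gbinomial_absorption[symmetric])
  finally show ?thesis by (simp add: frac_coeff_def mult_ac)
qed

lemma has_real_derivative_frac_tail:
  assumes \<alpha>: "0 < \<alpha>" "\<alpha> \<le> 1" and \<beta>: "0 < \<beta>" and c: "0 \<le> c" and k: "1 \<le> k" and t: "0 < t"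
  shows "((\<lambda>t. 1 - (\<Sum>j<k. frac_pmf \<alpha> \<beta> c j t)) has_real_derivative
     \<beta> * real k / (\<alpha> * t) * frac_pmf \<alpha> \<beta> c k t) (at t)"
proof -
  have a0: "0 \<le> \<alpha>" using \<alpha> by simp
  define x where "x = t powr \<beta>"
  let ?S = "\<lambda>j. \<Sum>n. \<beta> * real n * frac_coeff \<alpha> c j n * x ^ n / Gamma (\<beta> * real n + 1)"
  let ?T = "\<lambda>j n. \<beta> * real n * frac_coeff \<alpha> c j n * x ^ n / Gamma (\<beta> * real n + 1)"
  have b: "\<bar>frac_coeff \<alpha> c j n\<bar> \<le> 2 ^ j * (2 * c) ^ n" for j n by (rule abs_frac_coeff_le[OF a0 \<alpha>(2) c])
  have c2: "0 \<le> 2 * c" using c by simp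
  note D = has_real_derivative_ml_powser[OF \<beta> order_refl b c2 t, folded x_def]
  have "(frac_pmf \<alpha> \<beta> c j has_real_derivative ?S j / t) (at t)" for j
    using D(1)[of j] unfolding frac_pmf_def ml_series_def[abs_def] .
  then have "((\<lambda>t. 1 - (\<Sum>j<k. frac_pmf \<alpha> \<beta> c j t)) has_real_derivative 0 - (\<Sum>j<k. ?S j / t)) (at t)"
    by (intro DERIV_diff DERIV_const DERIV_sum)
  moreover have "0 - (\<Sum>j<k. ?S j / t) = \<beta> * real k / (\<alpha> * t) * frac_pmf \<alpha> \<beta> c k t"
  proof -
    have "(\<lambda>n. - (\<Sum>j<k. ?T j n)) sums (- (\<Sum>j<k. ?S j))"
      by (intro sums_minus sums_sum summable_sums D(2))
    moreover have "- (\<Sum>j<k. ?T j n) =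
        \<beta> * real k / \<alpha> * (frac_coeff \<alpha> c k n * x ^ n / Gamma (\<beta> * real n + 1))" for n
    proof -
      have "- (\<Sum>j<k. ?T j n) =
          \<beta> * (- (\<Sum>j<k. frac_coeff \<alpha> c j n) * real n) * x ^ n / Gamma (\<beta> * real n + 1)"
        by (simp add: sum_distrib_left sum_distrib_right sum_divide_distrib mult_ac sum_negf)
      also have "- (\<Sum>j<k. frac_coeff \<alpha> c j n) * real n = real k / \<alpha> * frac_coeff \<alpha> c k n"
        using \<alpha> k by (intro sum_frac_coeff) auto
      finally show ?thesis by simp
    qed
    moreover have "(\<lambda>n. \<beta> * real k / \<alpha> * (frac_coeff \<alpha> c k n * x ^ n / Gamma (\<beta> * real n + 1))) sums
        (\<beta> * real k / \<alpha> * frac_pmf \<alpha> \<beta> c k t)"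
      unfolding frac_pmf_def ml_series_def x_def
      by (intro sums_mult summable_sums summable_powser_Gamma[OF \<beta> order_refl b c2])
    ultimately have "- (\<Sum>j<k. ?S j) = \<beta> * real k / \<alpha> * frac_pmf \<alpha> \<beta> c k t"
      by (simp add: sums_unique2)
    moreover have "0 - (\<Sum>j<k. ?S j / t) = - (\<Sum>j<k. ?S j) / t"
      by (simp add: sum_divide_distrib)
    ultimately show ?thesis by simp
  qed
  ultimately show ?thesis by simp
qed

text \<open>The double series has the majorant \<open>(2 * \<bar>z\<bar>) ^ k * v n\<close>,
  summable for \<open>\<bar>z\<bar> < 1 / 2\<close>, so the sums may be exchanged. For fixed n the
  sum over k is the binomial series of \<open>(1 - z) powr (\<alpha> * n)\<close>.\<close>

lemma frac_pmf_generating_function: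
  assumes \<alpha>: "0 < \<alpha>" "\<alpha> \<le> 1" and \<beta>: "0 < \<beta>" and c: "0 \<le> c" and z: "\<bar>z\<bar> < 1 / 2"
  shows "(\<lambda>k. frac_pmf \<alpha> \<beta> c k t * z ^ k) sums mittag_leffler \<beta> (- (t powr \<beta>) * c * (1 - z) powr \<alpha>)"
proof -
  define x where "x = t powr \<beta>"
  define f where "f k n = frac_coeff \<alpha> c k n * x ^ n / Gamma (\<beta> * real n + 1) * z ^ k" for k n
  define v where "v n = (2 * c) ^ n * x ^ n / Gamma (\<beta> * real n + 1)" for n
  have x0: "0 \<le> x" by (simp add: x_def)
  have G0: "0 < Gamma (\<beta> * real n + 1)" for n using \<beta> by (intro Gamma_real_pos) (simp add: add_nonneg_pos)
  have sv: "summable v" unfolding v_def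
    by (rule summable_powser_Gamma[OF \<beta>, of 1 _ 1 "2 * c"]) (use c in auto)
  have v0: "0 \<le> v n" for n using c x0 G0[of n] by (simp add: v_def)
  have b: "norm (f k n) \<le> (2 * \<bar>z\<bar>) ^ k * v n" for k n
  proof -
    have "norm (f k n) = \<bar>frac_coeff \<alpha> c k n\<bar> * (x ^ n / Gamma (\<beta> * real n + 1) * \<bar>z\<bar> ^ k)"
      using x0 G0[of n] by (simp add: f_def abs_mult power_abs)
    also have "\<dots> \<le> (2 ^ k * (2 * c) ^ n) * (x ^ n / Gamma (\<beta> * real n + 1) * \<bar>z\<bar> ^ k)"
      using abs_frac_coeff_le[of \<alpha> c k n] \<alpha> c x0 G0[of n] by (intro mult_right_mono) auto
    finally show ?thesis by (simp add: v_def power_mult_distrib mult_ac)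
  qed
  have snf: "summable (\<lambda>n. norm (f k n))" for k
    by (rule summable_comparison_test'[OF summable_mult[OF sv]]) (use b in auto)
  have sg: "summable (\<lambda>k. (2 * \<bar>z\<bar>) ^ k)" using z by (intro summable_geometric) auto
  \<comment> \<open>Summation over n is treated as integration against the counting measure, so that
    \<open>sums_integral\<close> performs the exchange.\<close>
  have i: "integrable (count_space UNIV) (f k)" for k
    using snf by (simp add: integrable_count_space_nat_iff)
  have a: "AE n in count_space UNIV. summable (\<lambda>k. norm (f k n))"
  proof (rule AE_I2)
    show "summable (\<lambda>k. norm (f k n))" for n
      by (rule summable_comparison_test'[OF summable_mult2[OF sg, of "v n"]]) (use b in auto)
  qed
  have s: "summable (\<lambda>k. \<integral>n. norm (f k n) \<partial>count_space UNIV)"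
  proof (rule summable_comparison_test'[OF summable_mult2[OF sg, of "suminf v"]])
    fix k
    have "(\<integral>n. norm (f k n) \<partial>count_space UNIV) = (\<Sum>n. norm (f k n))"
      using i[of k] by (intro integral_count_space_nat) auto
    also have "\<dots> \<le> (\<Sum>n. (2 * \<bar>z\<bar>) ^ k * v n)"
      by (intro suminf_le b snf summable_mult sv)
    also have "\<dots> = (2 * \<bar>z\<bar>) ^ k * suminf v" by (rule suminf_mult[OF sv])
    finally show "norm (\<integral>n. norm (f k n) \<partial>count_space UNIV) \<le> (2 * \<bar>z\<bar>) ^ k * suminf v"
      by (simp add: abs_of_nonneg integral_nonneg)
  qed
  have "(\<lambda>k. \<integral>n. f k n \<partial>count_space UNIV) sums (\<integral>n. (\<Sum>k. f k n) \<partial>count_space UNIV)"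
    by (rule sums_integral[OF i a s])
  moreover have "(\<integral>n. f k n \<partial>count_space UNIV) = frac_pmf \<alpha> \<beta> c k t * z ^ k" for k
  proof -
    have "summable (\<lambda>n. frac_coeff \<alpha> c k n * x ^ n / Gamma (\<beta> * real n + 1))"
      by (rule summable_powser_Gamma[OF \<beta> order_refl abs_frac_coeff_le]) (use \<alpha> c in auto)
    from suminf_mult2[OF this, of "z ^ k"] have "(\<Sum>n. f k n) = frac_pmf \<alpha> \<beta> c k t * z ^ k"
      by (simp add: f_def frac_pmf_def ml_series_def x_def)
    then show ?thesis using integral_count_space_nat[OF i[of k]] by simp
  qed
  moreover have "(\<integral>n. (\<Sum>k. f k n) \<partial>count_space UNIV) = mittag_leffler \<beta> (- x * c * (1 - z) powr \<alpha>)"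
  proof -
    have "(\<Sum>k. f k n) = (- x * c * (1 - z) powr \<alpha>) ^ n / Gamma (\<beta> * real n + 1)" for n
    proof -
      have "(\<lambda>k. (\<alpha> * real n gchoose k) * (- z) ^ k) sums (1 + - z) powr (\<alpha> * real n)"
        using z by (intro gen_binomial_real) simp
      then have "(\<lambda>k. (- c) ^ n * x ^ n / Gamma (\<beta> * real n + 1) * ((\<alpha> * real n gchoose k) * (- z) ^ k)) sums
          ((- c) ^ n * x ^ n / Gamma (\<beta> * real n + 1) * (1 + - z) powr (\<alpha> * real n))"
        by (rule sums_mult)
      moreover have "(- c) ^ n * x ^ n / Gamma (\<beta> * real n + 1) * ((\<alpha> * real n gchoose k) * (- z) ^ k) = f k n" for k
        by (simp add: f_def frac_coeff_def power_minus[of z] mult_ac)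
      moreover have "(- c) ^ n * x ^ n / Gamma (\<beta> * real n + 1) * (1 + - z) powr (\<alpha> * real n) =
          (- x * c * (1 - z) powr \<alpha>) ^ n / Gamma (\<beta> * real n + 1)"
      proof -
        have "(1 + - z) powr (\<alpha> * real n) = ((1 - z) powr \<alpha>) ^ n"
          using z by (simp add: powr_powr[symmetric] powr_realpow)
        moreover have "(- x * c * (1 - z) powr \<alpha>) ^ n = (- c) ^ n * x ^ n * ((1 - z) powr \<alpha>) ^ n"
          by (simp only: power_mult_distrib[symmetric]) (simp add: mult_ac)
        ultimately show ?thesis by (simp only:) simp
      qed
      ultimately show ?thesis by (simp add: sums_iff)
    qed
    then show ?thesis
      using integral_count_space_nat[OF integrable_suminf[OF i a s]] by (simp add: mittag_leffler_def)
  qed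
  ultimately show ?thesis by (simp add: x_def)
qed

text \<open>Differentiation at t > 0 is local, the limit at 0 is one-sided and the integrals run
  over \<open>{0..\<tau>}\<close>, so nonnegative times decide. It is there that \<open>p\<close>
  will be identified with the explicit solution.\<close>

lemma has_caputo_derivative_cong:
  assumes eq: "\<And>s. 0 \<le> s \<Longrightarrow> u s = v s" and t: "0 < t" and v: "has_caputo_derivative \<beta> v D t"
  shows "has_caputo_derivative \<beta> u D t"
proof (cases "\<beta> = 1")
  case True
  have ev: "eventually (\<lambda>s. u s = v s) (nhds t)"
    using eventually_nhds_in_open[of "{0<..}" t] t eq by (auto elim!: eventually_mono)
  show ?thesis
    using v True DERIV_cong_ev[OF refl ev refl] by (simp add: has_caputo_derivative_def)
next
  case False
  have "eventually (\<lambda>s. v s = u s) (at_right 0)"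
    using eventually_at_right_less[of 0] eq by (auto elim!: eventually_mono)
  then have lim: "(u \<longlongrightarrow> c) (at_right 0)" if "(v \<longlongrightarrow> c) (at_right 0)" for c
    using that by (rule Lim_transform_eventually[rotated])
  have "(LINT s:{0..\<tau>}|lborel. u s / (\<tau> - s) powr \<beta>) = (LINT s:{0..\<tau>}|lborel. v s / (\<tau> - s) powr \<beta>)" for \<tau>
    by (intro set_lebesgue_integral_cong) (auto simp: eq)
  then show ?thesis using v lim unfolding has_caputo_derivative_def if_not_P[OF False] by (simp only:) blast
qed

lemma solves_frac_cauchy_cong:
  assumes eq: "\<And>k t. 0 \<le> t \<Longrightarrow> u k t = v k t" and v: "solves_frac_cauchy \<alpha> \<beta> lam v"
  shows "solves_frac_cauchy \<alpha> \<beta> lam u"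
  unfolding solves_frac_cauchy_def
proof (intro conjI allI impI)
  fix k
  have "continuous_on {0..} (v k)" using v by (auto simp: solves_frac_cauchy_def)
  then show "continuous_on {0..} (u k)" by (rule continuous_on_eq) (simp add: eq)
  fix t :: real assume t: "0 < t"
  obtain D where D: "has_caputo_derivative \<beta> (v k) D t"
    "D + lam powr \<alpha> * frac_difference \<alpha> (\<lambda>j. v j t) k = 0"
    using v t unfolding solves_frac_cauchy_def by blast
  have "has_caputo_derivative \<beta> (u k) D t"
    by (rule has_caputo_derivative_cong[OF _ t D(1)]) (rule eq)
  with D(2) show "\<exists>D. has_caputo_derivative \<beta> (u k) D t \<and>
      D + lam powr \<alpha> * frac_difference \<alpha> (\<lambda>j. u j t) k = 0"
    using t by (auto simp: eq)
qed (use v in \<open>auto simp: solves_frac_cauchy_def eq\<close>)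

section \<open>Stable subordinators\<close>

text \<open>Brings the deterministic case \<open>\<nu> = 1\<close> and the proper subordinators
  under one set of facts.\<close>

lemma stable_subordinatorD:
  assumes S: "stable_subordinator M \<nu> A"
  shows "prob_space M"
    and "\<And>t. 0 \<le> t \<Longrightarrow> A t \<in> borel_measurable M"
    and "\<And>\<omega>. \<omega> \<in> space M \<Longrightarrow> A 0 \<omega> = 0"
    and "\<And>\<omega>. \<omega> \<in> space M \<Longrightarrow> mono_on {0..} (\<lambda>t. A t \<omega>)"
    and "\<And>t \<omega>. 0 \<le> t \<Longrightarrow> \<omega> \<in> space M \<Longrightarrow> continuous (at_right t) (\<lambda>t. A t \<omega>)"
    and "\<And>t \<xi>. 0 \<le> t \<Longrightarrow> 0 \<le> \<xi> \<Longrightarrow> (\<integral>\<omega>. exp (- \<xi> * A t \<omega>) \<partial>M) = exp (- t * \<xi> powr \<nu>)"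
proof -
  show M: "prob_space M" using S by (simp add: stable_subordinator_def)
  interpret prob_space M by fact
  have 1: "A t \<omega> = t" if "\<nu> = 1" "0 \<le> t" "\<omega> \<in> space M" for t \<omega>
    using S that by (simp add: stable_subordinator_def)
  show "A t \<in> borel_measurable M" if "0 \<le> t" for t
  proof (cases "\<nu> = 1")
    case True
    have "A t \<in> borel_measurable M \<longleftrightarrow> (\<lambda>\<omega>. t) \<in> borel_measurable M"
      by (rule measurable_cong) (use True 1 that in auto)
    then show ?thesis by simp
  qed (use S that in \<open>simp add: stable_subordinator_def\<close>)
  show "A 0 \<omega> = 0" "mono_on {0..} (\<lambda>t. A t \<omega>)" if "\<omega> \<in> space M" for \<omega>
    using S that by (cases "\<nu> = 1"; simp add: stable_subordinator_def mono_on_def)+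
  show "continuous (at_right t) (\<lambda>t. A t \<omega>)" if "0 \<le> t" "\<omega> \<in> space M" for t \<omega>
  proof (cases "\<nu> = 1")
    case True
    have "((\<lambda>s. s) \<longlongrightarrow> t) (at_right t)" by (rule tendsto_ident_at)
    then have "((\<lambda>s. A s \<omega>) \<longlongrightarrow> t) (at_right t)"
      by (rule Lim_transform_eventually)
         (use eventually_at_right_less[of t] 1[OF True] that in \<open>auto elim!: eventually_mono\<close>)
    then show ?thesis using 1[OF True] that by (simp add: continuous_within)
  qed (use S that in \<open>simp add: stable_subordinator_def\<close>)
  show "(\<integral>\<omega>. exp (- \<xi> * A t \<omega>) \<partial>M) = exp (- t * \<xi> powr \<nu>)" if "0 \<le> t" "0 \<le> \<xi>" for t \<xi>
  proof (cases "\<nu> = 1")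
    case True
    have "(\<integral>\<omega>. exp (- \<xi> * A t \<omega>) \<partial>M) = (\<integral>\<omega>. exp (- \<xi> * t) \<partial>M)"
      by (rule Bochner_Integration.integral_cong) (use 1[OF True] that in auto)
    then show ?thesis using True that by (simp add: prob_space mult.commute)
  qed (use S that in \<open>simp add: stable_subordinator_def\<close>)
qed

lemma stable_subordinator_nonneg:
  assumes "stable_subordinator M \<nu> A" "0 \<le> t" "\<omega> \<in> space M"
  shows "0 \<le> A t \<omega>"
  using stable_subordinatorD(3,4)[OF assms(1,3)] assms(2)
  by (metis atLeast_iff monotone_onD order_refl)

lemma
  assumes S: "stable_subordinator M \<nu> A" and \<nu>: "0 < \<nu>"
  shows stable_subordinator_law: "stable_law \<nu> (distr M borel (A 1))"
    and stable_subordinator_scale: "0 \<le> s \<Longrightarrow>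
      distr M borel (A s) = distr (distr M borel (A 1)) borel (\<lambda>x. s powr (1 / \<nu>) * x)"
proof -
  interpret prob_space M by (rule stable_subordinatorD[OF S])
  note meas = stable_subordinatorD(2)[OF S]
  have d: "real_distribution (distr M borel (A s))" if "0 \<le> s" for s
    using meas[OF that] by simp
  have nn: "AE x in distr M borel (A s). 0 \<le> x" if "0 \<le> s" for s
    using meas[OF that] stable_subordinator_nonneg[OF S that] by (subst AE_distr_iff) auto
  have L: "(\<integral>x. exp (- \<xi> * x) \<partial>distr M borel (A s)) = exp (- s * \<xi> powr \<nu>)" if "0 \<le> s" "0 \<le> \<xi>" for s \<xi>
    using meas[OF that(1)] stable_subordinatorD(6)[OF S that] by (subst integral_distr) auto
  show law: "stable_law \<nu> (distr M borel (A 1))"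
    unfolding stable_law_def using d nn L[of 1] by auto
  show "0 \<le> s \<Longrightarrow> distr M borel (A s) = distr (distr M borel (A 1)) borel (\<lambda>x. s powr (1 / \<nu>) * x)"
    by (rule stable_law_scale[OF law \<nu> _ d nn L])
qed

lemma (in prob_space) AE_ex_of_tendsto_0:
  assumes "\<And>n::nat. {\<omega> \<in> space M. P n \<omega>} \<in> sets M" "(\<lambda>n. prob {\<omega> \<in> space M. \<not> P n \<omega>}) \<longlonglongrightarrow> 0"
  shows "AE \<omega> in M. \<exists>n. P n \<omega>"
proof -
  have m [measurable]: "{\<omega> \<in> space M. \<not> P n \<omega>} \<in> sets M" for n
  proof -
    have "{\<omega> \<in> space M. \<not> P n \<omega>} = space M - {\<omega> \<in> space M. P n \<omega>}" by auto
    then show ?thesis using assms(1)[of n] by simp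
  qed
  have B: "{\<omega> \<in> space M. \<forall>n. \<not> P n \<omega>} \<in> sets M"
    using m by (simp add: sets.sets_Collect_countable_All)
  have "prob {\<omega> \<in> space M. \<forall>n. \<not> P n \<omega>} \<le> prob {\<omega> \<in> space M. \<not> P n \<omega>}" for n
    by (intro finite_measure_mono) auto
  then have "prob {\<omega> \<in> space M. \<forall>n. \<not> P n \<omega>} \<le> 0"
    by (intro LIMSEQ_le_const[OF assms(2)]) auto
  then have "prob {\<omega> \<in> space M. \<forall>n. \<not> P n \<omega>} = 0" by (simp add: measure_le_0_iff)
  then have "AE \<omega> in M. \<omega> \<notin> {\<omega> \<in> space M. \<forall>n. \<not> P n \<omega>}" using B by (subst (asm) prob_eq_0) auto
  then show ?thesis using AE_space by eventually_elim auto
qed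

text \<open>Chernoff's bound with exponent 1: the probability of \<open>A n \<le> m\<close> is at
  most \<open>exp m\<close> times the Laplace transform of \<open>A n\<close> at 1, that is
  \<open>exp (m - n)\<close>. Outside a null set the infima defining the inverse process are thus
  over nonempty sets.\<close>

lemma stable_subordinator_unbounded:
  assumes S: "stable_subordinator M \<nu> A" and \<nu>: "0 < \<nu>"
  shows "AE \<omega> in M. \<forall>x. \<exists>s\<ge>0. x < A s \<omega>"
proof -
  interpret prob_space M by (rule stable_subordinatorD[OF S])
  have [measurable]: "A (real n) \<in> borel_measurable M" for n by (rule stable_subordinatorD(2)[OF S]) simp
  have "AE \<omega> in M. \<exists>n::nat. real m < A (real n) \<omega>" for m :: nat
  proof (rule AE_ex_of_tendsto_0)
    let ?B = "\<lambda>n. {\<omega> \<in> space M. \<not> real m < A (real n) \<omega>}"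
    have b: "prob (?B n) \<le> exp (real m) * exp (- real n)" for n
    proof -
      have "prob (?B n) = (\<integral>\<omega>. indicator (?B n) \<omega> \<partial>M)"
        by simp
      also have "\<dots> \<le> (\<integral>\<omega>. exp (real m) * exp (- 1 * A (real n) \<omega>) \<partial>M)"
      proof (rule integral_mono)
        have "integrable M (\<lambda>\<omega>. exp (- 1 * A (real n) \<omega>))"
          by (rule integrable_const_bound[where B = 1]) (use stable_subordinator_nonneg[OF S] in auto)
        then show "integrable M (\<lambda>\<omega>. exp (real m) * exp (- 1 * A (real n) \<omega>))" by simp
        show "indicator (?B n) \<omega> \<le> exp (real m) * exp (- 1 * A (real n) \<omega>)" for \<omega>
          by (auto simp: indicator_def simp flip: exp_add)
      qed (auto intro!: integrable_const_bound[where B = 1])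
      also have "\<dots> = exp (real m) * exp (- real n)"
        using stable_subordinatorD(6)[OF S, of "real n" 1] by simp
      finally show ?thesis .
    qed
    have "(\<lambda>n. exp (real m) * exp (- real n)) \<longlonglongrightarrow> 0" by real_asymp
    then show "(\<lambda>n. prob (?B n)) \<longlonglongrightarrow> 0"
      by (rule tendsto_sandwich[OF _ _ tendsto_const, rotated 2]) (use b in \<open>auto intro!: always_eventually\<close>)
  qed simp
  then have "AE \<omega> in M. \<forall>m::nat. \<exists>n::nat. real m < A (real n) \<omega>" by (simp add: AE_all_countable)
  then show ?thesis
  proof eventually_elim
    case (elim \<omega>)
    show ?case
    proof
      fix x :: real
      obtain m :: nat where "x < real m" using reals_Archimedean2 by blast
      with elim obtain n :: nat where "x < A (real n) \<omega>" by (metis less_trans)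
      then show "\<exists>s\<ge>0. x < A s \<omega>" by (intro exI[of _ "real n"]) auto
    qed
  qed
qed

section \<open>Processes at independent random times\<close>

text \<open>
  Evaluation of a path at a random time is not measurable on the product space of all paths.
  Approximating the time from the right by grid points makes it so, and changes nothing for
  right-continuous paths.
\<close>

definition path_eval :: "(real \<Rightarrow> real) \<Rightarrow> real \<Rightarrow> real" where
  "path_eval a r = lim (\<lambda>n. a ((real (nat \<lfloor>real (Suc n) * r\<rfloor>) + 1) / real (Suc n)))"

lemma measurable_path_eval [measurable]:
  "(\<lambda>(a, r). path_eval a r) \<in> borel_measurable (path_space \<Otimes>\<^sub>M borel)"
proof -
  have [measurable]: "(\<lambda>x. fst x ((real i + 1) / real (Suc n))) \<in> borel_measurable (path_space \<Otimes>\<^sub>M borel)" for i n :: nat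
  proof -
    have "(\<lambda>a. a ((real i + 1) / real (Suc n))) \<in> borel_measurable path_space"
      unfolding path_space_def by (rule measurable_component_singleton) simp
    then show ?thesis by (rule measurable_compose[OF measurable_fst])
  qed
  \<comment> \<open>The grid index is measurable with countably many values, which reduces
    evaluation to fixed coordinates.\<close>
  have "(\<lambda>x. fst x ((real (nat \<lfloor>real (Suc n) * snd x\<rfloor>) + 1) / real (Suc n))) \<in> borel_measurable (path_space \<Otimes>\<^sub>M borel)" for n
    by (rule measurable_compose_countable[where f = "\<lambda>i x. fst x ((real i + 1) / real (Suc n))"
          and g = "\<lambda>x. nat \<lfloor>real (Suc n) * snd x\<rfloor>"]) measurable
  then show ?thesis
    unfolding path_eval_def case_prod_beta' by (intro borel_measurable_lim_metric)
qed

lemma path_eval_path_of: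
  assumes r: "0 \<le> r" and X: "continuous (at_right r) (\<lambda>t. X t \<omega>)"
  shows "path_eval (path_of X \<omega>) r = X r \<omega>"
proof -
  \<comment> \<open>The \<open>+ 1\<close> puts the grid point strictly to the right of r, as
    \<open>at_right\<close> demands, and at distance at most \<open>1 / Suc n\<close>.\<close>
  define g where "g n = (real (nat \<lfloor>real (Suc n) * r\<rfloor>) + 1) / real (Suc n)" for n
  have g: "r < g n \<and> g n \<le> r + 1 / real (Suc n)" for n
  proof -
    have "0 \<le> real (Suc n) * r" using r by simp
    then have e: "real (nat \<lfloor>real (Suc n) * r\<rfloor>) = of_int \<lfloor>real (Suc n) * r\<rfloor>" by simp
    define m where "m = real (nat \<lfloor>real (Suc n) * r\<rfloor>)"
    have m: "r * real (Suc n) < m + 1" "m \<le> r * real (Suc n)"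
      unfolding m_def e by (simp_all only: mult.commute[of r]) linarith+
    have "r < (m + 1) / real (Suc n)"
      using m(1) by (subst pos_less_divide_eq) auto
    moreover have "(m + 1) / real (Suc n) \<le> r + 1 / real (Suc n)"
      using divide_right_mono[OF m(2), of "real (Suc n)"] by (simp add: add_divide_distrib del: of_nat_Suc)
    ultimately show ?thesis by (simp only: g_def m_def)
  qed
  have "(\<lambda>n. r + 1 / real (Suc n)) \<longlonglongrightarrow> r" by real_asymp
  then have "g \<longlonglongrightarrow> r"
    by (rule tendsto_sandwich[OF _ _ tendsto_const, rotated 2]) (use g in \<open>auto intro!: always_eventually less_imp_le\<close>)
  then have "filterlim g (at_right r) sequentially"
    using g by (auto simp: filterlim_at intro!: always_eventually)
  moreover have "((\<lambda>t. X t \<omega>) \<longlongrightarrow> X r \<omega>) (at_right r)" using X by (simp add: continuous_within)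
  ultimately have "(\<lambda>n. X (g n) \<omega>) \<longlonglongrightarrow> X r \<omega>" by (rule filterlim_compose[rotated])
  moreover have "path_of X \<omega> (g n) = X (g n) \<omega>" for n
    using g[of n] r by (simp add: path_of_def)
  ultimately show ?thesis unfolding path_eval_def g_def[symmetric] by (simp add: limI)
qed

text \<open>
  A third form of independence, for values of two different types, in which Fubini's theorem applies
  directly.
\<close>

definition joint_indep ::
  "'a measure \<Rightarrow> 'b measure \<Rightarrow> ('a \<Rightarrow> 'b) \<Rightarrow> 'c measure \<Rightarrow> ('a \<Rightarrow> 'c) \<Rightarrow> bool" where
  "joint_indep M S X T Y \<longleftrightarrow> X \<in> measurable M S \<and> Y \<in> measurable M T \<and>
     distr M (S \<Otimes>\<^sub>M T) (\<lambda>\<omega>. (X \<omega>, Y \<omega>)) = distr M S X \<Otimes>\<^sub>M distr M T Y"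

lemma (in prob_space) joint_indep_of_indep_var: "indep_var S X T Y \<Longrightarrow> joint_indep M S X T Y"
  by (simp add: joint_indep_def indep_var_distribution_eq)

lemma (in prob_space) joint_indep_of_indep_elements:
  assumes "indep_elements M S X T Y"
  shows "joint_indep M S X T Y"
proof -
  have [measurable]: "X \<in> measurable M S" "Y \<in> measurable M T"
    and ind: "indep_set {X -` A \<inter> space M |A. A \<in> sets S} {Y -` B \<inter> space M |B. B \<in> sets T}"
    using assms by (auto simp: indep_elements_def)
  interpret X: prob_space "distr M S X" by (rule prob_space_distr) simp
  interpret Y: prob_space "distr M T Y" by (rule prob_space_distr) simp
  have "distr M S X \<Otimes>\<^sub>M distr M T Y = distr M (S \<Otimes>\<^sub>M T) (\<lambda>\<omega>. (X \<omega>, Y \<omega>))"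
  proof (rule pair_measure_eqI)
    fix A B assume AB: "A \<in> sets (distr M S X)" "B \<in> sets (distr M T Y)"
    then have [measurable]: "A \<in> sets S" "B \<in> sets T" by auto
    have "prob ((X -` A \<inter> space M) \<inter> (Y -` B \<inter> space M)) = prob (X -` A \<inter> space M) * prob (Y -` B \<inter> space M)"
      by (rule indep_setD[OF ind]) auto
    moreover have "(\<lambda>\<omega>. (X \<omega>, Y \<omega>)) -` (A \<times> B) \<inter> space M = (X -` A \<inter> space M) \<inter> (Y -` B \<inter> space M)"
      by auto
    ultimately show "emeasure (distr M S X) A * emeasure (distr M T Y) B =
        emeasure (distr M (S \<Otimes>\<^sub>M T) (\<lambda>\<omega>. (X \<omega>, Y \<omega>))) (A \<times> B)"
      by (simp add: emeasure_distr emeasure_eq_measure ennreal_mult')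
  qed (auto intro: X.sigma_finite_measure_axioms Y.sigma_finite_measure_axioms)
  then show ?thesis by (simp add: joint_indep_def)
qed

lemma (in prob_space) joint_indep_compose:
  assumes "joint_indep M S X T Y" and f [measurable]: "f \<in> measurable S S'" and g [measurable]: "g \<in> measurable T T'"
  shows "joint_indep M S' (\<lambda>\<omega>. f (X \<omega>)) T' (\<lambda>\<omega>. g (Y \<omega>))"
proof -
  have [measurable]: "X \<in> measurable M S" "Y \<in> measurable M T"
    and J: "distr M (S \<Otimes>\<^sub>M T) (\<lambda>\<omega>. (X \<omega>, Y \<omega>)) = distr M S X \<Otimes>\<^sub>M distr M T Y"
    using assms(1) by (auto simp: joint_indep_def)
  interpret Y: prob_space "distr M T Y" by (rule prob_space_distr) simp
  interpret Z: prob_space "distr (distr M T Y) T' g" by (rule Y.prob_space_distr) simp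
  have "distr M S' (\<lambda>\<omega>. f (X \<omega>)) \<Otimes>\<^sub>M distr M T' (\<lambda>\<omega>. g (Y \<omega>)) =
      distr (distr M S X) S' f \<Otimes>\<^sub>M distr (distr M T Y) T' g"
    by (simp add: distr_distr o_def)
  also have "\<dots> = distr (distr M S X \<Otimes>\<^sub>M distr M T Y) (S' \<Otimes>\<^sub>M T') (\<lambda>(x, y). (f x, g y))"
    by (rule pair_measure_distr) (auto intro: Z.sigma_finite_measure_axioms)
  also have "\<dots> = distr M (S' \<Otimes>\<^sub>M T') (\<lambda>\<omega>. (f (X \<omega>), g (Y \<omega>)))"
    unfolding J[symmetric] by (subst distr_distr) (auto simp: o_def)
  finally show ?thesis by (simp add: joint_indep_def)
qed

lemma joint_indep_cong:
  assumes "\<And>\<omega>. \<omega> \<in> space M \<Longrightarrow> Y \<omega> = Y' \<omega>"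
  shows "joint_indep M S X T Y \<longleftrightarrow> joint_indep M S X T Y'"
proof -
  have "Y \<in> measurable M T \<longleftrightarrow> Y' \<in> measurable M T" by (rule measurable_cong) (rule assms)
  moreover have "distr M T Y = distr M T Y'" by (rule distr_cong) (auto simp: assms)
  moreover have "distr M (S \<Otimes>\<^sub>M T) (\<lambda>\<omega>. (X \<omega>, Y \<omega>)) = distr M (S \<Otimes>\<^sub>M T) (\<lambda>\<omega>. (X \<omega>, Y' \<omega>))"
    by (rule distr_cong) (auto simp: assms)
  ultimately show ?thesis by (simp add: joint_indep_def)
qed

text \<open>With A, the inverse process and the counting process in this order, these are the two
  independences that conditioning uses: the first two from each other, and the third from any
  measurable functional of their pair.\<close>

lemma (in prob_space) joint_indep_of_triple:
  assumes ind: "indep_vars (\<lambda>_. path_space) (\<lambda>i. Z i) {..<3::nat}"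
  shows "joint_indep M path_space (Z 0) path_space (Z 1)"
    and "f \<in> measurable (path_space \<Otimes>\<^sub>M path_space) S \<Longrightarrow>
      joint_indep M path_space (Z 2) S (\<lambda>\<omega>. f (Z 0 \<omega>, Z 1 \<omega>))"
proof -
  have comp: "(\<lambda>h. h i) \<in> measurable (PiM I (\<lambda>_. path_space)) path_space" if "i \<in> I" for i :: nat and I
    using that by (rule measurable_component_singleton)
  have "indep_var (PiM {0} (\<lambda>_. path_space)) (\<lambda>\<omega>. restrict (\<lambda>i. Z i \<omega>) {0})
      (PiM {1} (\<lambda>_. path_space)) (\<lambda>\<omega>. restrict (\<lambda>i. Z i \<omega>) {1})"
    by (rule indep_var_restrict[OF ind]) auto
  from joint_indep_compose[OF joint_indep_of_indep_var[OF this] comp[of 0] comp[of 1]]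
  show "joint_indep M path_space (Z 0) path_space (Z 1)" by simp
  assume f: "f \<in> measurable (path_space \<Otimes>\<^sub>M path_space) S"
  have I: "indep_var (PiM {2} (\<lambda>_. path_space)) (\<lambda>\<omega>. restrict (\<lambda>i. Z i \<omega>) {2})
      (PiM {0, 1} (\<lambda>_. path_space)) (\<lambda>\<omega>. restrict (\<lambda>i. Z i \<omega>) {0, 1})"
    by (rule indep_var_restrict[OF ind]) auto
  have m: "(\<lambda>h. f (h 0, h 1)) \<in> measurable (PiM {0, 1::nat} (\<lambda>_. path_space)) S"
    by (rule measurable_compose[OF measurable_Pair f]) (auto intro: comp)
  show "joint_indep M path_space (Z 2) S (\<lambda>\<omega>. f (Z 0 \<omega>, Z 1 \<omega>))"
    using joint_indep_compose[OF joint_indep_of_indep_var[OF I] comp[of 2] m] by simp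
qed

lemma path_of_measurable_component:
  assumes "path_of X \<in> measurable M path_space" "0 \<le> t"
  shows "X t \<in> borel_measurable M"
proof -
  have "(\<lambda>a. a t) \<in> borel_measurable path_space"
    unfolding path_space_def by (rule measurable_component_singleton) (use assms in simp)
  from measurable_compose[OF assms(1) this] show ?thesis
    using assms(2) by (simp add: path_of_def)
qed

text \<open>Conditioning on the random time. Writing the evaluation as \<open>path_eval\<close>
  makes the event a measurable set of pairs (path, time), and its measure under the product law is
  the integral of its sections.\<close>

lemma (in prob_space)
  assumes J: "joint_indep M path_space (path_of X) borel R"
    and R: "\<And>\<omega>. \<omega> \<in> space M \<Longrightarrow> 0 \<le> R \<omega>"
    and X: "\<And>t \<omega>. 0 \<le> t \<Longrightarrow> \<omega> \<in> space M \<Longrightarrow> continuous (at_right t) (\<lambda>t. X t \<omega>)"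
  shows random_time_measurable: "(\<lambda>\<omega>. X (R \<omega>) \<omega>) \<in> borel_measurable M"
    and random_time_emeasure: "B \<in> sets borel \<Longrightarrow> emeasure M {\<omega> \<in> space M. X (R \<omega>) \<omega> \<in> B} =
      (\<integral>\<^sup>+r. emeasure M {\<omega> \<in> space M. X r \<omega> \<in> B} \<partial>distr M borel R)"
proof -
  have [measurable]: "path_of X \<in> measurable M path_space" "R \<in> borel_measurable M"
    and J: "distr M (path_space \<Otimes>\<^sub>M borel) (\<lambda>\<omega>. (path_of X \<omega>, R \<omega>)) = distr M path_space (path_of X) \<Otimes>\<^sub>M distr M borel R"
    using J by (auto simp: joint_indep_def)
  have e: "X (R \<omega>) \<omega> = path_eval (path_of X \<omega>) (R \<omega>)" if "\<omega> \<in> space M" for \<omega>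
    by (rule path_eval_path_of[where X = X, OF R[OF that] X[OF R[OF that] that], symmetric])
  have "(\<lambda>\<omega>. path_eval (path_of X \<omega>) (R \<omega>)) \<in> borel_measurable M" by measurable
  then show "(\<lambda>\<omega>. X (R \<omega>) \<omega>) \<in> borel_measurable M"
    using e by (simp cong: measurable_cong)
  interpret P: prob_space "distr M path_space (path_of X)" by (rule prob_space_distr) simp
  interpret Q: prob_space "distr M borel R" by (rule prob_space_distr) simp
  interpret PQ: pair_sigma_finite "distr M path_space (path_of X)" "distr M borel R" ..
  assume [measurable]: "B \<in> sets borel"
  define A where "A = (\<lambda>(a, r). path_eval a r) -` B \<inter> space (path_space \<Otimes>\<^sub>M borel)"
  have A [measurable]: "A \<in> sets (path_space \<Otimes>\<^sub>M borel)" unfolding A_def by measurable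
  have "emeasure M {\<omega> \<in> space M. X (R \<omega>) \<omega> \<in> B} = emeasure (distr M (path_space \<Otimes>\<^sub>M borel) (\<lambda>\<omega>. (path_of X \<omega>, R \<omega>))) A"
  proof (subst emeasure_distr)
    have "path_of X \<omega> \<in> space path_space" if "\<omega> \<in> space M" for \<omega>
      using that by (rule measurable_space[of "path_of X" M path_space, rotated]) simp
    then have "(\<lambda>\<omega>. (path_of X \<omega>, R \<omega>)) -` A \<inter> space M = {\<omega> \<in> space M. X (R \<omega>) \<omega> \<in> B}"
      unfolding A_def by (auto simp: e space_pair_measure)
    then show "emeasure M {\<omega> \<in> space M. X (R \<omega>) \<omega> \<in> B} =
        emeasure M ((\<lambda>\<omega>. (path_of X \<omega>, R \<omega>)) -` A \<inter> space M)" by simp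
  qed simp_all
  also have "\<dots> = (\<integral>\<^sup>+r. emeasure (distr M path_space (path_of X)) ((\<lambda>a. (a, r)) -` A) \<partial>distr M borel R)"
    unfolding J by (rule PQ.emeasure_pair_measure_alt2) simp
  also have "\<dots> = (\<integral>\<^sup>+r. emeasure M {\<omega> \<in> space M. X r \<omega> \<in> B} \<partial>distr M borel R)"
  proof (rule nn_integral_cong_AE)
    have "AE r in distr M borel R. 0 \<le> r" using R by (subst AE_distr_iff) auto
    then show "AE r in distr M borel R. emeasure (distr M path_space (path_of X)) ((\<lambda>a. (a, r)) -` A) =
        emeasure M {\<omega> \<in> space M. X r \<omega> \<in> B}"
    proof eventually_elim
      case (elim r)
      have [measurable]: "(\<lambda>a. (a, r)) -` A \<in> sets path_space" by (rule sets_Pair2[OF A])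
      have "path_of X \<omega> \<in> space path_space" if "\<omega> \<in> space M" for \<omega>
        using that by (rule measurable_space[of "path_of X" M path_space, rotated]) simp
      moreover have "path_eval (path_of X \<omega>) r = X r \<omega>" if "\<omega> \<in> space M" for \<omega>
        by (rule path_eval_path_of[where X = X, OF elim X[OF elim that]])
      ultimately have "path_of X -` ((\<lambda>a. (a, r)) -` A) \<inter> space M = {\<omega> \<in> space M. X r \<omega> \<in> B}"
        unfolding A_def by (auto simp: space_pair_measure)
      then show ?case by (subst emeasure_distr) simp_all
    qed
  qed
  finally show "emeasure M {\<omega> \<in> space M. X (R \<omega>) \<omega> \<in> B} =
      (\<integral>\<^sup>+r. emeasure M {\<omega> \<in> space M. X r \<omega> \<in> B} \<partial>distr M borel R)" .
qed

section \<open>The inverse of a stable subordinator\<close>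

lemma first_time_nonneg: "S \<subseteq> {0..} \<Longrightarrow> 0 \<le> first_time S"
  unfolding first_time_def by (auto intro!: cInf_greatest)

lemma first_time_le:
  assumes "s \<in> S" "S \<subseteq> {0..}"
  shows "first_time S \<le> s"
proof -
  have "bdd_below S" using assms(2) by (rule bdd_below_mono[rotated]) simp
  then show ?thesis using assms(1) by (auto simp: first_time_def intro: cInf_lower)
qed

lemma first_time_less_iff:
  assumes "S \<noteq> {}" "S \<subseteq> {0..}"
  shows "first_time S < b \<longleftrightarrow> (\<exists>s\<in>S. s < b)"
proof -
  have "bdd_below S" using assms(2) by (rule bdd_below_mono[rotated]) simp
  then show ?thesis using assms(1) by (simp add: first_time_def cInf_less_iff)
qed

lemma inverse_process_nonneg: "0 \<le> inverse_process C t \<omega>"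
  unfolding inverse_process_def by (rule first_time_nonneg) auto

lemma inverse_process_le: "0 \<le> s \<Longrightarrow> t < C s \<omega> \<Longrightarrow> inverse_process C t \<omega> \<le> s"
  unfolding inverse_process_def by (rule first_time_le) auto

lemma less_of_inverse_process_less:
  assumes "mono_on {0..} (\<lambda>s. C s \<omega>)" "\<exists>s\<ge>0. t < C s \<omega>" "inverse_process C t \<omega> < s"
  shows "t < C s \<omega>"
proof -
  obtain r where "0 \<le> r" "t < C r \<omega>" "r < s"
    using assms(2,3) unfolding inverse_process_def by (subst (asm) first_time_less_iff) auto
  then show ?thesis using monotone_onD[OF assms(1), of r s] by auto
qed

text \<open>A point s with \<open>t < C s\<close> stays admissible for all u slightly above t, so
  the infimum cannot jump up; if no point is admissible at t, none is later, and the value remains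
  the default 0. The second claim is only local: because of that default, monotonicity over long
  times may fail on exceptional paths.\<close>

lemma inverse_process_right_cont:
  shows "((\<lambda>t. inverse_process C t \<omega>) \<longlongrightarrow> inverse_process C t \<omega>) (at_right t)"
    and "eventually (\<lambda>s. inverse_process C t \<omega> \<le> inverse_process C s \<omega>) (at_right t)"
proof -
  define S where "S t = {s. 0 \<le> s \<and> t < C s \<omega>}" for t
  have L: "inverse_process C t \<omega> = first_time (S t)" for t by (simp add: inverse_process_def S_def)
  have S0: "S t \<subseteq> {0..}" for t by (auto simp: S_def)
  have sub: "S u \<subseteq> S t" if "t \<le> u" for t u using that by (auto simp: S_def)
  have "((\<lambda>t. first_time (S t)) \<longlongrightarrow> first_time (S t)) (at_right t) \<and>
      eventually (\<lambda>s. first_time (S t) \<le> first_time (S s)) (at_right t)"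
  proof (cases "S t = {}")
    case True
    then have "S u = {}" if "t < u" for u using sub[of t u] that by auto
    then have ev: "eventually (\<lambda>u. first_time (S u) = first_time (S t)) (at_right t)"
      using eventually_at_right_less[of t] True by (auto elim!: eventually_mono)
    then show ?thesis
      by (auto intro: tendsto_eventually elim!: eventually_mono)
  next
    case False
    then obtain s0 where s0: "s0 \<in> S t" by blast
    have near: "eventually (\<lambda>u. t < u \<and> u < C s \<omega>) (at_right t)" if "s \<in> S t" for s
      using that eventually_at_right_less[of t] eventually_at_right_real[of t "C s \<omega>"]
      by (auto simp: S_def elim!: eventually_mono)
    have ge: "eventually (\<lambda>u. first_time (S t) \<le> first_time (S u)) (at_right t)"
      using near[OF s0]
    proof eventually_elim
      case (elim u)
      with s0 have "S u \<noteq> {}" by (auto simp: S_def)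
      then show ?case
        using first_time_le[OF _ S0, of _ t] sub[of t u] elim
        by (auto simp: first_time_def[of "S u"] intro!: cInf_greatest)
    qed
    have "((\<lambda>t. first_time (S t)) \<longlongrightarrow> first_time (S t)) (at_right t)"
    proof (rule order_tendstoI)
      fix a assume "a < first_time (S t)"
      then show "eventually (\<lambda>u. a < first_time (S u)) (at_right t)"
        using ge by (auto elim!: eventually_mono)
    next
      fix a assume "first_time (S t) < a"
      then obtain s where s: "s \<in> S t" "s < a" using first_time_less_iff[OF False S0] by blast
      from near[OF s(1)] show "eventually (\<lambda>u. first_time (S u) < a) (at_right t)"
      proof eventually_elim
        case (elim u)
        then have "s \<in> S u" using s by (auto simp: S_def)
        then show ?case using first_time_le[of s "S u"] S0 s(2) by (meson le_less_trans)
      qed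
    qed
    with ge show ?thesis by blast
  qed
  then show "((\<lambda>t. inverse_process C t \<omega>) \<longlongrightarrow> inverse_process C t \<omega>) (at_right t)"
    "eventually (\<lambda>s. inverse_process C t \<omega> \<le> inverse_process C s \<omega>) (at_right t)"
    by (simp_all add: L)
qed

text \<open>Right-continuity of f can be used only when g approaches its limit from above, possibly
  with equality. For this reason a one-sided inequality accompanies the right limits of the time
  changes.\<close>

lemma tendsto_compose_at_right:
  fixes g :: "'c \<Rightarrow> real" and f :: "real \<Rightarrow> 'd::topological_space"
  assumes g: "(g \<longlongrightarrow> r) F" "eventually (\<lambda>x. r \<le> g x) F" and f: "continuous (at_right r) f"
  shows "((\<lambda>x. f (g x)) \<longlongrightarrow> f r) F"
proof (rule topological_tendstoI)
  fix S assume "open S" "f r \<in> S"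
  moreover have "(f \<longlongrightarrow> f r) (at_right r)" using f by (simp add: continuous_within)
  ultimately have "eventually (\<lambda>y. f y \<in> S) (at_right r)" by (auto dest: topological_tendstoD)
  then obtain b where b: "r < b" "\<And>y. r < y \<Longrightarrow> y < b \<Longrightarrow> f y \<in> S"
    unfolding eventually_at_right_field by auto
  have "eventually (\<lambda>x. g x < b) F" using g(1) b(1) by (rule order_tendstoD)
  with g(2) show "eventually (\<lambda>x. f (g x) \<in> S) F"
  proof eventually_elim
    case (elim x)
    then show ?case using b(2)[of "g x"] \<open>f r \<in> S\<close> by (cases "g x = r") auto
  qed
qed

lemma time_change_right_cont:
  assumes A: "\<And>t. 0 \<le> t \<Longrightarrow> continuous (at_right t) (\<lambda>t. A t \<omega>)"
    and L: "0 \<le> L t \<omega>" "continuous (at_right t) (\<lambda>t. L t \<omega>)"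
      "eventually (\<lambda>s. L t \<omega> \<le> L s \<omega>) (at_right t)"
  shows "continuous (at_right t) (\<lambda>t. time_change A L t \<omega>)"
  using tendsto_compose_at_right[of "\<lambda>t. L t \<omega>" "L t \<omega>" "at_right t" "\<lambda>t. A t \<omega>"] A[OF L(1)] L
  by (simp add: continuous_within time_change_def)

lemma inverse_process_mono:
  assumes "t \<le> u" "\<exists>s\<ge>0. u < C s \<omega>"
  shows "inverse_process C t \<omega> \<le> inverse_process C u \<omega>"
proof -
  have ne: "{s. 0 \<le> s \<and> u < C s \<omega>} \<noteq> {}" and sub: "{s. 0 \<le> s \<and> u < C s \<omega>} \<subseteq> {s. 0 \<le> s \<and> t < C s \<omega>}"
    using assms by auto
  moreover have "bdd_below {s. 0 \<le> s \<and> t < C s \<omega>}" by (rule bdd_belowI[of _ 0]) auto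
  ultimately show ?thesis
    unfolding inverse_process_def first_time_def by (auto intro!: cInf_superset_mono)
qed

text \<open>Points before r have values at most \<open>C r\<close> and are not admissible. It serves
  to show that the time change takes arbitrarily large values.\<close>

lemma le_inverse_process:
  assumes "mono_on {0..} (\<lambda>s. C s \<omega>)" "\<exists>s\<ge>0. C r \<omega> < C s \<omega>" "0 \<le> r"
  shows "r \<le> inverse_process C (C r \<omega>) \<omega>"
  unfolding inverse_process_def first_time_def using assms(2)
proof (simp, intro conjI impI cInf_greatest)
  fix s assume s: "s \<in> {s. 0 \<le> s \<and> C r \<omega> < C s \<omega>}"
  show "r \<le> s"
  proof (rule ccontr)
    assume "\<not> r \<le> s"
    then show False using monotone_onD[OF assms(1), of s r] s assms(3) by auto
  qed
qed auto

lemma time_change_subordinator_right_cont: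
  assumes A: "stable_subordinator M \<alpha> A" and \<omega>: "\<omega> \<in> space M"
  shows "continuous (at_right t) (\<lambda>t. time_change A (inverse_process C) t \<omega>)"
    and "eventually (\<lambda>s. time_change A (inverse_process C) t \<omega> \<le> time_change A (inverse_process C) s \<omega>) (at_right t)"
proof -
  show "continuous (at_right t) (\<lambda>t. time_change A (inverse_process C) t \<omega>)"
    using inverse_process_right_cont(1)[where C = C and t = t and \<omega> = \<omega>] inverse_process_right_cont(2)[where C = C and t = t and \<omega> = \<omega>] inverse_process_nonneg[of C t \<omega>] stable_subordinatorD(5)[OF A _ \<omega>]
    by (intro time_change_right_cont) (auto simp: continuous_within)
  show "eventually (\<lambda>s. time_change A (inverse_process C) t \<omega> \<le> time_change A (inverse_process C) s \<omega>) (at_right t)"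
    using inverse_process_right_cont(2)[where C = C and t = t and \<omega> = \<omega>]
  proof eventually_elim
    case (elim s)
    then show ?case unfolding time_change_def
      using monotone_onD[OF stable_subordinatorD(4)[OF A \<omega>], of "inverse_process C t \<omega>" "inverse_process C s \<omega>"]
        inverse_process_nonneg[of C _ \<omega>] by auto
  qed
qed

lemma time_change_subordinator_nonneg:
  assumes "stable_subordinator M \<alpha> A" "\<omega> \<in> space M"
  shows "0 \<le> time_change A (inverse_process C) t \<omega>"
  unfolding time_change_def using stable_subordinator_nonneg[OF assms(1) inverse_process_nonneg assms(2)] .

text \<open>Tailored to the inverse process, for which only nested events are available. The gap
  between \<open>{..<s}\<close> and \<open>{..s}\<close> closes by right-continuity of the
  distribution functions.\<close>

lemma real_distribution_eq_sandwich:
  assumes P: "real_distribution P" and Q: "real_distribution Q"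
    and le: "\<And>s. measure P {..<s} \<le> measure Q {..<s}" "\<And>s. measure Q {..<s} \<le> measure P {..s}"
  shows "P = Q"
proof (rule cdf_unique[OF P Q], rule ext)
  fix s :: real
  interpret P: real_distribution P by fact
  interpret Q: real_distribution Q by fact
  have ev: "eventually (\<lambda>u. s < u) (at_right s)" by (rule eventually_at_right_less)
  show "cdf P s = cdf Q s"
  proof (rule antisym)
    have "eventually (\<lambda>u. cdf P s \<le> cdf Q u) (at_right s)"
      using ev
    proof eventually_elim
      case (elim u)
      have "cdf P s \<le> measure P {..<u}"
        unfolding cdf_def by (rule P.finite_measure_mono) (use elim in auto)
      also have "\<dots> \<le> measure Q {..<u}" by (rule le)
      also have "\<dots> \<le> cdf Q u" unfolding cdf_def by (rule Q.finite_measure_mono) auto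
      finally show ?case .
    qed
    moreover have "(cdf Q \<longlongrightarrow> cdf Q s) (at_right s)"
      using Q.cdf_is_right_cont[of s] by (simp add: continuous_within)
    ultimately show "cdf P s \<le> cdf Q s"
      by (intro tendsto_lowerbound[of _ _ "at_right s"]) auto
    have "eventually (\<lambda>u. cdf Q s \<le> cdf P u) (at_right s)"
      using ev
    proof eventually_elim
      case (elim u)
      have "cdf Q s \<le> measure Q {..<u}"
        unfolding cdf_def by (rule Q.finite_measure_mono) (use elim in auto)
      also have "\<dots> \<le> cdf P u" unfolding cdf_def by (rule le)
      finally show ?case .
    qed
    moreover have "(cdf P \<longlongrightarrow> cdf P s) (at_right s)"
      using P.cdf_is_right_cont[of s] by (simp add: continuous_within)
    ultimately show "cdf Q s \<le> cdf P s"
      by (intro tendsto_lowerbound[of _ _ "at_right s"]) auto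
  qed
qed

lemma powr_ratio_less_iff:
  fixes t y s \<beta> :: real
  assumes "0 \<le> t" "0 < y" "0 < s" "0 < \<beta>"
  shows "(t / y) powr \<beta> < s \<longleftrightarrow> t < s powr (1 / \<beta>) * y"
proof -
  have "(t / y) powr \<beta> < s \<longleftrightarrow> (t / y) powr \<beta> < (s powr (1 / \<beta>)) powr \<beta>"
    using assms by (simp add: powr_powr)
  also have "\<dots> \<longleftrightarrow> t / y < s powr (1 / \<beta>)"
    using assms by (metis divide_nonneg_pos linorder_not_less powr_ge_zero powr_less_mono2 powr_mono2 less_imp_le)
  also have "\<dots> \<longleftrightarrow> t < s powr (1 / \<beta>) * y"
    using assms by (simp add: pos_divide_less_eq)
  finally show ?thesis .
qed

text \<open>Up to a null set L_t < s implies t < C_s, which in turn implies L_t \<le> s. By scaling,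
  for s > 0 the event t < C_s has the probability of \<open>(t / y) powr \<beta> < s\<close> under
  the law of C_1.\<close>

lemma distr_inverse_process:
  assumes S: "stable_subordinator M \<beta> C" and \<beta>: "0 < \<beta>" and t: "0 \<le> t"
    and Lm: "inverse_process C t \<in> borel_measurable M"
  shows "distr M borel (inverse_process C t) = distr (distr M borel (C 1)) borel (\<lambda>y. (t / y) powr \<beta>)"
proof -
  interpret prob_space M by (rule stable_subordinatorD[OF S])
  let ?L = "inverse_process C t"
  let ?\<mu> = "distr M borel (C 1)"
  note [measurable] = Lm
  have [measurable]: "C s \<in> borel_measurable M" if "0 \<le> s" for s
    by (rule stable_subordinatorD(2)[OF S that])
  have law: "stable_law \<beta> ?\<mu>" by (rule stable_subordinator_law[OF S \<beta>])
  interpret \<mu>: real_distribution ?\<mu> using law by (simp add: stable_law_def)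
  have ne: "AE \<omega> in M. \<exists>s\<ge>0. t < C s \<omega>"
    using stable_subordinator_unbounded[OF S \<beta>] by eventually_elim auto
  have P: "measure (distr M borel ?L) B = prob {\<omega> \<in> space M. ?L \<omega> \<in> B}" if "B \<in> sets borel" for B
    using that by (subst measure_distr) (auto intro!: arg_cong[where f = prob])
  have Q: "measure (distr ?\<mu> borel (\<lambda>y. (t / y) powr \<beta>)) {..<s} =
      (if 0 < s then prob {\<omega> \<in> space M. t < C s \<omega>} else 0)" for s
  proof -
    have "measure (distr ?\<mu> borel (\<lambda>y. (t / y) powr \<beta>)) {..<s} = measure ?\<mu> {y. (t / y) powr \<beta> < s}"
      by (subst measure_distr) (auto intro!: arg_cong[where f = "measure ?\<mu>"])
    also have "\<dots> = (if 0 < s then prob {\<omega> \<in> space M. t < C s \<omega>} else 0)"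
    proof (cases "0 < s")
      case True
      have "measure ?\<mu> {y. (t / y) powr \<beta> < s} = measure ?\<mu> {y. t < s powr (1 / \<beta>) * y}"
      proof (rule \<mu>.finite_measure_eq_AE)
        show "AE y in ?\<mu>. y \<in> {y. (t / y) powr \<beta> < s} \<longleftrightarrow> y \<in> {y. t < s powr (1 / \<beta>) * y}"
          using stable_law_pos[OF law \<beta>]
          by eventually_elim (use powr_ratio_less_iff t True \<beta> in auto)
      qed auto
      also have "\<dots> = measure (distr ?\<mu> borel (\<lambda>y. s powr (1 / \<beta>) * y)) {t<..}"
        by (subst measure_distr) (auto intro!: arg_cong[where f = "measure ?\<mu>"])
      also have "\<dots> = measure (distr M borel (C s)) {t<..}"
        using stable_subordinator_scale[OF S \<beta>, of s] True by simp
      also have "\<dots> = prob {\<omega> \<in> space M. t < C s \<omega>}"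
        using True by (subst measure_distr) (auto intro!: arg_cong[where f = prob])
      finally show ?thesis using True by simp
    next
      case False
      then have "{y. (t / y) powr \<beta> < s} = {}" by (auto simp: not_less intro: order_trans)
      then show ?thesis using False by simp
    qed
    finally show ?thesis .
  qed
  show ?thesis
  proof (rule real_distribution_eq_sandwich)
    show "real_distribution (distr M borel ?L)" by simp
    show "real_distribution (distr ?\<mu> borel (\<lambda>y. (t / y) powr \<beta>))" by simp
    fix s
    show "measure (distr M borel ?L) {..<s} \<le> measure (distr ?\<mu> borel (\<lambda>y. (t / y) powr \<beta>)) {..<s}"
    proof (cases "0 < s")
      case True
      then have [measurable]: "C s \<in> borel_measurable M" by simp
      have "prob {\<omega> \<in> space M. ?L \<omega> < s} \<le> prob {\<omega> \<in> space M. t < C s \<omega>}"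
      proof (rule finite_measure_mono_AE)
        show "AE \<omega> in M. \<omega> \<in> {\<omega> \<in> space M. ?L \<omega> < s} \<longrightarrow> \<omega> \<in> {\<omega> \<in> space M. t < C s \<omega>}"
          using ne by eventually_elim (auto intro: less_of_inverse_process_less stable_subordinatorD(4)[OF S])
      qed measurable
      then show ?thesis using True by (simp add: P Q)
    next
      case False
      then have "{\<omega> \<in> space M. ?L \<omega> < s} = {}"
        using inverse_process_nonneg[of C t] by (auto simp: not_less intro: order_trans)
      then have "prob {\<omega> \<in> space M. ?L \<omega> < s} = 0" by (simp only: measure_empty)
      then show ?thesis using False by (simp add: P Q)
    qed
    show "measure (distr ?\<mu> borel (\<lambda>y. (t / y) powr \<beta>)) {..<s} \<le> measure (distr M borel ?L) {..s}"
      by (auto simp: P Q intro!: finite_measure_mono inverse_process_le)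
  qed
qed

text \<open>Conditioning on the independent time L_t = r replaces A at time r by
  \<open>r powr (1 / \<alpha>)\<close> times A_1; inserting the law of L_t makes the exponent
  \<open>\<beta> / \<alpha>\<close>. The product measure expresses that the two stable variables are
  independent in law.\<close>

lemma distr_time_change:
  assumes A: "stable_subordinator M \<alpha> A" and C: "stable_subordinator M \<beta> C"
    and \<alpha>: "0 < \<alpha>" and \<beta>: "0 < \<beta>"
    and J: "joint_indep M path_space (path_of A) path_space (path_of (inverse_process C))" and t: "0 \<le> t"
  shows "time_change A (inverse_process C) t \<in> borel_measurable M"
    and "distr M borel (time_change A (inverse_process C) t) =
      distr (distr M borel (A 1) \<Otimes>\<^sub>M distr M borel (C 1)) borel (\<lambda>(x, y). (t / y) powr (\<beta> / \<alpha>) * x)"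
proof -
  interpret prob_space M by (rule stable_subordinatorD[OF A])
  let ?L = "inverse_process C t"
  let ?F = "time_change A (inverse_process C) t"
  have Lm [measurable]: "?L \<in> borel_measurable M"
    using J t by (intro path_of_measurable_component) (auto simp: joint_indep_def)
  have Am [measurable]: "A s \<in> borel_measurable M" if "0 \<le> s" for s
    by (rule stable_subordinatorD(2)[OF A that])
  have [measurable]: "C 1 \<in> borel_measurable M"
    by (rule stable_subordinatorD(2)[OF C]) simp
  have J': "joint_indep M path_space (path_of A) borel ?L"
  proof -
    have "(\<lambda>a. a t) \<in> borel_measurable path_space"
      unfolding path_space_def by (rule measurable_component_singleton) (use t in simp)
    from joint_indep_compose[OF J measurable_ident_sets[OF refl] this] show ?thesis
      using t by (simp add: path_of_def[abs_def])
  qed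
  note right = stable_subordinatorD(5)[OF A]
  show m [measurable]: "?F \<in> borel_measurable M"
    unfolding time_change_def[abs_def]
    by (rule random_time_measurable[OF J' inverse_process_nonneg right])
  let ?a = "distr M borel (A 1)" and ?c = "distr M borel (C 1)"
  interpret a: prob_space ?a by (rule prob_space_distr) simp
  interpret c: prob_space ?c by (rule prob_space_distr) simp
  interpret ac: pair_sigma_finite ?a ?c ..
  show "distr M borel ?F =
      distr (?a \<Otimes>\<^sub>M ?c) borel (\<lambda>(x, y). (t / y) powr (\<beta> / \<alpha>) * x)"
  proof (rule measure_eqI)
    fix B assume "B \<in> sets (distr M borel ?F)"
    then have [measurable]: "B \<in> sets borel" by simp
    have "emeasure (distr M borel ?F) B =
        emeasure M {\<omega> \<in> space M. A (?L \<omega>) \<omega> \<in> B}"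
      by (subst emeasure_distr) (auto simp: time_change_def intro!: arg_cong[where f = "emeasure M"])
    also have "\<dots> = (\<integral>\<^sup>+r. emeasure M {\<omega> \<in> space M. A r \<omega> \<in> B} \<partial>distr M borel ?L)"
      by (rule random_time_emeasure[OF J' inverse_process_nonneg right]) auto
    also have "\<dots> = (\<integral>\<^sup>+r. emeasure ?a {x. r powr (1 / \<alpha>) * x \<in> B} \<partial>distr M borel ?L)"
    proof (rule nn_integral_cong_AE)
      have "AE r in distr M borel ?L. 0 \<le> r" using inverse_process_nonneg[of C t] by (subst AE_distr_iff) auto
      then show "AE r in distr M borel ?L. emeasure M {\<omega> \<in> space M. A r \<omega> \<in> B} = emeasure ?a {x. r powr (1 / \<alpha>) * x \<in> B}"
      proof eventually_elim
        case (elim r)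
        have "emeasure M {\<omega> \<in> space M. A r \<omega> \<in> B} = emeasure (distr M borel (A r)) B"
          using elim by (subst emeasure_distr) (auto intro!: arg_cong[where f = "emeasure M"])
        also have "\<dots> = emeasure ?a {x. r powr (1 / \<alpha>) * x \<in> B}"
          unfolding stable_subordinator_scale[OF A \<alpha> elim]
          by (subst emeasure_distr) (auto intro!: arg_cong[where f = "emeasure ?a"])
        finally show ?case .
      qed
    qed
    also have "\<dots> = (\<integral>\<^sup>+y. emeasure ?a {x. ((t / y) powr \<beta>) powr (1 / \<alpha>) * x \<in> B} \<partial>?c)"
    proof -
      have 1: "{x \<in> space (borel \<Otimes>\<^sub>M ?a). fst x powr (1 / \<alpha>) * snd x \<in> B} \<in> sets (borel \<Otimes>\<^sub>M ?a)"
        by measurable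
      have "(\<lambda>r::real. emeasure ?a (Pair r -` {x \<in> space (borel \<Otimes>\<^sub>M ?a). fst x powr (1 / \<alpha>) * snd x \<in> B})) \<in> borel_measurable borel"
        by (rule a.measurable_emeasure_Pair[OF 1])
      moreover have "Pair r -` {x \<in> space (borel \<Otimes>\<^sub>M ?a). fst x powr (1 / \<alpha>) * snd x \<in> B} = {x. r powr (1 / \<alpha>) * x \<in> B}" for r :: real
        by (auto simp: space_pair_measure)
      ultimately have [measurable]: "(\<lambda>r::real. emeasure ?a {x. r powr (1 / \<alpha>) * x \<in> B}) \<in> borel_measurable borel"
        by simp
      show ?thesis
        unfolding distr_inverse_process[OF C \<beta> t Lm] by (rule nn_integral_distr) simp_all
    qed
    also have "\<dots> = (\<integral>\<^sup>+y. emeasure ?a {x. (t / y) powr (\<beta> / \<alpha>) * x \<in> B} \<partial>?c)"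
      by (simp add: powr_powr)
    also have "\<dots> = emeasure (?a \<Otimes>\<^sub>M ?c) {z. (t / snd z) powr (\<beta> / \<alpha>) * fst z \<in> B}"
    proof -
      have "{z \<in> space (?a \<Otimes>\<^sub>M ?c). (t / snd z) powr (\<beta> / \<alpha>) * fst z \<in> B} \<in> sets (?a \<Otimes>\<^sub>M ?c)"
        by measurable
      then have "{z. (t / snd z) powr (\<beta> / \<alpha>) * fst z \<in> B} \<in> sets (?a \<Otimes>\<^sub>M ?c)"
        by (simp add: space_pair_measure)
      from ac.emeasure_pair_measure_alt2[OF this] show ?thesis by simp
    qed
    also have "\<dots> = emeasure (distr (?a \<Otimes>\<^sub>M ?c) borel (\<lambda>(x, y). (t / y) powr (\<beta> / \<alpha>) * x)) B"
      by (subst emeasure_distr) (auto simp: space_pair_measure case_prod_beta' intro!: arg_cong[where f = "emeasure (?a \<Otimes>\<^sub>M ?c)"])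
    finally show "emeasure (distr M borel ?F) B =
        emeasure (distr (?a \<Otimes>\<^sub>M ?c) borel (\<lambda>(x, y). (t / y) powr (\<beta> / \<alpha>) * x)) B" .
  qed simp
qed

section \<open>Duality between the two time changes\<close>

lemma le_powr_ratio_iff:
  fixes s t x y a b :: real
  assumes "0 \<le> s" "0 \<le> t" "0 < x" "0 < y" "0 < a" "0 < b"
  shows "s \<le> (t / y) powr (b / a) * x \<longleftrightarrow> (s / x) powr (a / b) * y \<le> t"
\<comment> \<open>The comparison of powers asks for a positive bound; for s = 0 both inequalities
  are trivially true.\<close>
proof (cases "s = 0")
  case False
  then have "s \<le> (t / y) powr (b / a) * x \<longleftrightarrow> \<not> (t / y) powr (b / a) < s / x"
    using assms by (simp add: not_less pos_divide_le_eq)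
  also have "\<dots> \<longleftrightarrow> \<not> t < (s / x) powr (1 / (b / a)) * y"
    using assms False by (subst powr_ratio_less_iff) auto
  finally show ?thesis by (simp add: not_less)
qed (use assms in auto)

text \<open>One pair (x, y) serves for both laws, and for positive x and y the two inequalities are
  equivalent. The product measures come in opposite orders, hence the swap of coordinates.\<close>

lemma stable_product_duality:
  assumes a: "stable_law \<alpha> a" and c: "stable_law \<beta> c" and \<alpha>: "0 < \<alpha>" and \<beta>: "0 < \<beta>"
    and s: "0 \<le> s" and t: "0 \<le> t"
  shows "emeasure (distr (a \<Otimes>\<^sub>M c) borel (\<lambda>(x, y). (t / y) powr (\<beta> / \<alpha>) * x)) {s..} =
    emeasure (distr (c \<Otimes>\<^sub>M a) borel (\<lambda>(y, x). (s / x) powr (\<alpha> / \<beta>) * y)) {..t}"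
proof -
  interpret a: real_distribution a using a by (simp add: stable_law_def)
  interpret c: real_distribution c using c by (simp add: stable_law_def)
  interpret ac: pair_prob_space a c ..
  let ?P = "a \<Otimes>\<^sub>M c"
  let ?U = "{z \<in> space ?P. (s / fst z) powr (\<alpha> / \<beta>) * snd z \<le> t}"
  let ?V = "{z \<in> space ?P. s \<le> (t / snd z) powr (\<beta> / \<alpha>) * fst z}"
  have "emeasure (distr (c \<Otimes>\<^sub>M a) borel (\<lambda>(y, x). (s / x) powr (\<alpha> / \<beta>) * y)) {..t} =
    emeasure (distr ?P borel (\<lambda>(x, y). (s / x) powr (\<alpha> / \<beta>) * y)) {..t}"
    by (subst ac.distr_pair_swap) (simp add: distr_distr o_def case_prod_beta')
  also have "\<dots> = emeasure (distr ?P borel (\<lambda>(x, y). (t / y) powr (\<beta> / \<alpha>) * x)) {s..}"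
  proof -
    have pos: "AE z in ?P. 0 < fst z \<and> 0 < snd z"
    proof (rule ac.AE_pair_measure)
      show "{z \<in> space ?P. 0 < fst z \<and> 0 < snd z} \<in> sets ?P" by measurable
      show "AE x in a. AE y in c. 0 < fst (x, y) \<and> 0 < snd (x, y)"
        using stable_law_pos[OF a \<alpha>]
      proof eventually_elim
        case (elim x)
        show ?case using stable_law_pos[OF c \<beta>] by eventually_elim (use elim in auto)
      qed
    qed
    have m1: "?U \<in> sets ?P" by measurable
    have m2: "?V \<in> sets ?P" by measurable
    have "emeasure ?P ?U = emeasure ?P ?V"
    proof (rule emeasure_eq_AE[OF _ m1 m2])
      show "AE z in ?P. z \<in> ?U \<longleftrightarrow> z \<in> ?V"
        using pos by eventually_elim (use le_powr_ratio_iff s t \<alpha> \<beta> in auto)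
    qed
    then show ?thesis
      by (simp add: emeasure_distr case_prod_beta' vimage_def Int_def conj_commute)
  qed
  finally show ?thesis by simp
qed

section \<open>Poisson processes and waiting times\<close>

lemma poisson_processD:
  assumes N: "poisson_process M lam N"
  shows "prob_space M"
    and "\<And>t. 0 \<le> t \<Longrightarrow> N t \<in> measurable M (count_space UNIV)"
    and "\<And>\<omega>. \<omega> \<in> space M \<Longrightarrow> N 0 \<omega> = 0"
    and "\<And>\<omega>. \<omega> \<in> space M \<Longrightarrow> mono_on {0..} (\<lambda>t. N t \<omega>)"
    and "\<And>t \<omega>. 0 \<le> t \<Longrightarrow> \<omega> \<in> space M \<Longrightarrow> continuous (at_right t) (\<lambda>t. N t \<omega>)"
  using N by (auto simp: poisson_process_def)

lemma poisson_process_prob: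
  assumes N: "poisson_process M lam N" and lam: "0 < lam" and t: "0 \<le> t"
  shows "measure M {\<omega> \<in> space M. N t \<omega> = k} = exp (- (lam * t)) * (lam * t) ^ k / fact k"
\<comment> \<open>The Poisson law of the increments is prescribed for s < t only. At t = 0 the path
  starts in 0, and \<open>0 ^ 0 = 1\<close> makes the formula correct.\<close>
proof (cases "t = 0")
  case True
  interpret prob_space M by (rule poisson_processD[OF N])
  have "{\<omega> \<in> space M. N t \<omega> = k} = (if k = 0 then space M else {})"
    using poisson_processD(3)[OF N] True by auto
  then show ?thesis using True prob_space by simp
next
  case False
  with t have t0: "0 < t" by simp
  interpret prob_space M by (rule poisson_processD[OF N])
  have m [measurable]: "N t \<in> measurable M (count_space UNIV)" by (rule poisson_processD(2)[OF N t])
  have "distr M (count_space UNIV) (\<lambda>\<omega>. N t \<omega> - N 0 \<omega>) = measure_pmf (poisson_pmf (lam * (t - 0)))"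
    using N t0 unfolding poisson_process_def by blast
  moreover have "distr M (count_space UNIV) (\<lambda>\<omega>. N t \<omega> - N 0 \<omega>) = distr M (count_space UNIV) (N t)"
    by (rule distr_cong) (use poisson_processD(3)[OF N] in auto)
  ultimately have "distr M (count_space UNIV) (N t) = measure_pmf (poisson_pmf (lam * t))" by simp
  then have "measure (distr M (count_space UNIV) (N t)) {k} = pmf (poisson_pmf (lam * t)) k"
    by (simp add: measure_pmf_single)
  moreover have "measure (distr M (count_space UNIV) (N t)) {k} = prob {\<omega> \<in> space M. N t \<omega> = k}"
    by (subst measure_distr) (auto intro!: arg_cong[where f = prob])
  ultimately show ?thesis using lam t0 by (simp add: mult.commute)
qed

lemma poisson_process_unbounded:
  assumes N: "poisson_process M lam N" and lam: "0 < lam"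
  shows "AE \<omega> in M. \<forall>k. \<exists>s\<ge>0. k \<le> N s \<omega>"
proof -
  interpret prob_space M by (rule poisson_processD[OF N])
  have [measurable]: "N (real n) \<in> measurable M (count_space UNIV)" for n by (rule poisson_processD(2)[OF N]) simp
  have "AE \<omega> in M. \<exists>n::nat. k \<le> N (real n) \<omega>" for k
  proof (rule AE_ex_of_tendsto_0)
    have "prob {\<omega> \<in> space M. \<not> k \<le> N (real n) \<omega>} = (\<Sum>j<k. exp (- (lam * real n)) * (lam * real n) ^ j / fact j)" for n
    proof -
      have "prob {\<omega> \<in> space M. \<not> k \<le> N (real n) \<omega>} = prob (\<Union>j<k. {\<omega> \<in> space M. N (real n) \<omega> = j})"
        by (intro arg_cong[where f = prob]) auto
      also have "\<dots> = (\<Sum>j<k. prob {\<omega> \<in> space M. N (real n) \<omega> = j})"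
        by (rule finite_measure_finite_Union) (auto simp: disjoint_family_on_def)
      finally show ?thesis by (simp add: poisson_process_prob[OF N lam])
    qed
    moreover have "(\<lambda>n. \<Sum>j<k. exp (- (lam * real n)) * (lam * real n) ^ j / fact j) \<longlonglongrightarrow> (\<Sum>j<k. 0)"
      by (intro tendsto_sum) (use lam in real_asymp)
    ultimately show "(\<lambda>n. prob {\<omega> \<in> space M. \<not> k \<le> N (real n) \<omega>}) \<longlonglongrightarrow> 0" by simp
  qed simp
  then have "AE \<omega> in M. \<forall>k. \<exists>n::nat. k \<le> N (real n) \<omega>" by (simp add: AE_all_countable)
  then show ?thesis by eventually_elim (metis of_nat_0_le_iff)
qed

section \<open>Waiting times of right-continuous counting paths\<close>

lemma eventually_eq_of_right_cont:
  fixes X :: "real \<Rightarrow> nat"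
  assumes "continuous (at_right t) X"
  shows "eventually (\<lambda>s. X s = X t) (at_right t)"
proof -
  have "(X \<longlongrightarrow> X t) (at_right t)" using assms by (simp add: continuous_within)
  \<comment> \<open>Singletons are open in the discrete topology of the naturals, so
    right-continuity means being constant for a while.\<close>
  from topological_tendstoD[OF this discrete_topology_class.open_discrete[of "{X t}"]] show ?thesis by simp
qed

lemma continuous_real_of_nat:
  fixes X :: "real \<Rightarrow> nat"
  assumes "continuous (at_right t) X"
  shows "continuous (at_right t) (\<lambda>s. real (X s))"
  unfolding continuous_within
  by (rule tendsto_eventually) (use eventually_eq_of_right_cont[OF assms] in \<open>auto elim!: eventually_mono\<close>)

lemma waiting_time_nonneg: "0 \<le> waiting_time X k \<omega>"
  unfolding waiting_time_def by (rule first_time_nonneg) auto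

text \<open>The value at s persists on an interval to the right, and that interval contains a
  rational. Events about the waiting time thereby involve countably many coordinates.\<close>

lemma rational_time_of_right_cont:
  fixes X :: "real \<Rightarrow> nat"
  assumes X: "continuous (at_right s) X" and s: "0 \<le> s" "k \<le> X s" "s < b"
  shows "\<exists>q\<in>\<rat> \<inter> {0..<b}. k \<le> X q"
proof -
  obtain d where d: "s < d" "\<And>y. s < y \<Longrightarrow> y < d \<Longrightarrow> X y = X s"
    using eventually_eq_of_right_cont[OF X] unfolding eventually_at_right_field by auto
  obtain q where q: "q \<in> \<rat>" "s < q" "q < min d b"
    using Rats_dense_in_real[of s "min d b"] d s by auto
  then show ?thesis using d(2)[of q] s by (intro bexI[of _ q]) auto
qed

text \<open>The second alternative is the default value: a path that never reaches k has waiting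
  time 0. The description is exact on each path, because measurability is wanted for
  \<open>waiting_time\<close> itself and not up to null sets.\<close>

lemma waiting_time_less_iff:
  assumes X: "\<And>t. 0 \<le> t \<Longrightarrow> continuous (at_right t) (\<lambda>t. X t \<omega>)"
  shows "waiting_time X k \<omega> < b \<longleftrightarrow>
    (\<exists>q\<in>\<rat> \<inter> {0..<b}. k \<le> X q \<omega>) \<or> (0 < b \<and> (\<forall>q\<in>\<rat> \<inter> {0..}. X q \<omega> < k))"
proof (cases "\<exists>t\<ge>0. k \<le> X t \<omega>")
  case True
  then have ne: "{t. 0 \<le> t \<and> k \<le> X t \<omega>} \<noteq> {}" by auto
  obtain s where s: "0 \<le> s" "k \<le> X s \<omega>" using True by auto
  have "\<exists>q\<in>\<rat> \<inter> {0..<s + 1}. k \<le> X q \<omega>"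
    by (rule rational_time_of_right_cont[OF X]) (use s in auto)
  then have "\<not> (\<forall>q\<in>\<rat> \<inter> {0..}. X q \<omega> < k)" by force
  moreover have "waiting_time X k \<omega> < b \<longleftrightarrow> (\<exists>s. 0 \<le> s \<and> k \<le> X s \<omega> \<and> s < b)"
    unfolding waiting_time_def by (subst first_time_less_iff[OF ne]) auto
  moreover have "(\<exists>s. 0 \<le> s \<and> k \<le> X s \<omega> \<and> s < b) \<longleftrightarrow> (\<exists>q\<in>\<rat> \<inter> {0..<b}. k \<le> X q \<omega>)"
    using rational_time_of_right_cont[OF X] by fastforce
  ultimately show ?thesis by blast
next
  case False
  then have e: "{t. 0 \<le> t \<and> k \<le> X t \<omega>} = {}" by auto
  have "waiting_time X k \<omega> = 0" unfolding waiting_time_def e by (simp add: first_time_def)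
  moreover have "X q \<omega> < k" if "0 \<le> q" for q using False that by (meson not_le)
  moreover have "\<not> k \<le> X q \<omega>" if "0 \<le> q" for q using False that by auto
  ultimately show ?thesis by auto
qed

lemma measurable_waiting_time:
  assumes m: "\<And>t. 0 \<le> t \<Longrightarrow> X t \<in> measurable M (count_space UNIV)"
    and X: "\<And>t \<omega>. 0 \<le> t \<Longrightarrow> \<omega> \<in> space M \<Longrightarrow> continuous (at_right t) (\<lambda>t. X t \<omega>)"
  shows "waiting_time X k \<in> borel_measurable M"
proof (rule borel_measurable_iff_less[THEN iffD2], rule allI)
  fix b
  have [measurable]: "{\<omega> \<in> space M. k \<le> X q \<omega>} \<in> sets M" "{\<omega> \<in> space M. X q \<omega> < k} \<in> sets M" if "0 \<le> q" for q
    using m[OF that] by (auto intro!: measurable_count_space_eq2_countable[THEN iffD1])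
  have "{\<omega> \<in> space M. waiting_time X k \<omega> < b} =
    (\<Union>q\<in>\<rat> \<inter> {0..<b}. {\<omega> \<in> space M. k \<le> X q \<omega>}) \<union>
    (if 0 < b then (\<Inter>q\<in>\<rat> \<inter> {0..}. {\<omega> \<in> space M. X q \<omega> < k}) else {})" (is "_ = ?A \<union> ?B")
  proof (intro set_eqI)
    have z: "(0::real) \<in> \<rat> \<inter> {0..}" by auto
    show "\<omega> \<in> {\<omega> \<in> space M. waiting_time X k \<omega> < b} \<longleftrightarrow> \<omega> \<in> ?A \<union> ?B" for \<omega>
    proof (cases "\<omega> \<in> space M")
      case True
      show ?thesis using waiting_time_less_iff[of X \<omega> k b] X[OF _ True] True by auto
    next
      case False
      then show ?thesis using z by auto
    qed
  qed
  moreover have "?A \<in> sets M"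
    by (intro sets.countable_UN') (auto simp: countable_rat intro: countable_subset[of _ \<rat>])
  moreover have "(\<Inter>q\<in>\<rat> \<inter> {0::real..}. {\<omega> \<in> space M. X q \<omega> < k}) \<in> sets M"
    by (intro sets.countable_INT') (auto simp: countable_rat intro: countable_subset[of _ \<rat>])
  ultimately show "{\<omega> \<in> space M. waiting_time X k \<omega> < b} \<in> sets M" by simp
qed

text \<open>The infimum is attained: a path below k at t keeps its value up to some d > t, and by
  monotonicity was below k before, so the waiting time would be at least d.\<close>

lemma waiting_time_le_iff:
  assumes X: "\<And>t. 0 \<le> t \<Longrightarrow> continuous (at_right t) (\<lambda>t. X t \<omega>)"
    and mono: "mono_on {0..} (\<lambda>t. X t \<omega>)" and ne: "\<exists>s\<ge>0. k \<le> X s \<omega>" and t: "0 \<le> t"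
  shows "waiting_time X k \<omega> \<le> t \<longleftrightarrow> k \<le> X t \<omega>"
proof
  assume "k \<le> X t \<omega>"
  then show "waiting_time X k \<omega> \<le> t" unfolding waiting_time_def using t by (intro first_time_le) auto
next
  assume le: "waiting_time X k \<omega> \<le> t"
  obtain d where d: "t < d" "\<And>y. t < y \<Longrightarrow> y < d \<Longrightarrow> X y \<omega> = X t \<omega>"
    using eventually_eq_of_right_cont[OF X[OF t]] unfolding eventually_at_right_field by auto
  define y where "y = (t + d) / 2"
  have y: "t < y" "y < d" using d(1) by (auto simp: y_def)
  have "{t. 0 \<le> t \<and> k \<le> X t \<omega>} \<noteq> {}" using ne by auto
  then obtain s where "0 \<le> s" "k \<le> X s \<omega>" "s < y"
    using le y(1) first_time_less_iff[of "{t. 0 \<le> t \<and> k \<le> X t \<omega>}" y]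
    unfolding waiting_time_def by auto
  then have "k \<le> X y \<omega>" using monotone_onD[OF mono, of s y] by auto
  then show "k \<le> X t \<omega>" using d(2)[OF y] by simp
qed

text \<open>The explicit common value makes it possible to compare the waiting time on one
  probability space with the number of events on another.\<close>

lemma waiting_time_law:
  assumes N: "poisson_process M lam N" and lam: "0 < lam"
  shows "waiting_time N k \<in> borel_measurable M"
    and "0 \<le> t \<Longrightarrow> measure M {\<omega> \<in> space M. waiting_time N k \<omega> \<le> t} =
      1 - (\<Sum>j<k. exp (- (lam * t)) * (lam * t) ^ j / fact j)"
    and "0 \<le> t \<Longrightarrow> measure M {\<omega> \<in> space M. k \<le> N t \<omega>} =
      1 - (\<Sum>j<k. exp (- (lam * t)) * (lam * t) ^ j / fact j)"
proof -
  interpret prob_space M by (rule poisson_processD[OF N])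
  note right = poisson_processD(5)[OF N]
  let ?p = "1 - (\<Sum>j<k. exp (- (lam * t)) * (lam * t) ^ j / fact j)"
  show m [measurable]: "waiting_time N k \<in> borel_measurable M"
    by (rule measurable_waiting_time[OF poisson_processD(2)[OF N] right])
  assume t: "0 \<le> t"
  have [measurable]: "N t \<in> measurable M (count_space UNIV)" by (rule poisson_processD(2)[OF N t])
  have "{\<omega> \<in> space M. k \<le> N t \<omega>} = space M - (\<Union>j<k. {\<omega> \<in> space M. N t \<omega> = j})" by auto
  then have "prob {\<omega> \<in> space M. k \<le> N t \<omega>} = 1 - prob (\<Union>j<k. {\<omega> \<in> space M. N t \<omega> = j})"
    by (simp add: prob_compl)
  also have "prob (\<Union>j<k. {\<omega> \<in> space M. N t \<omega> = j}) = (\<Sum>j<k. prob {\<omega> \<in> space M. N t \<omega> = j})"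
    by (rule finite_measure_finite_Union) (auto simp: disjoint_family_on_def)
  finally show 1: "prob {\<omega> \<in> space M. k \<le> N t \<omega>} = ?p"
    by (simp add: poisson_process_prob[OF N lam t])
  have "prob {\<omega> \<in> space M. waiting_time N k \<omega> \<le> t} = prob {\<omega> \<in> space M. k \<le> N t \<omega>}"
  proof (rule finite_measure_eq_AE)
    show "AE \<omega> in M. \<omega> \<in> {\<omega> \<in> space M. waiting_time N k \<omega> \<le> t} \<longleftrightarrow> \<omega> \<in> {\<omega> \<in> space M. k \<le> N t \<omega>}"
      using poisson_process_unbounded[OF N lam] AE_space
    proof eventually_elim
      case (elim \<omega>)
      then have "waiting_time N k \<omega> \<le> t \<longleftrightarrow> k \<le> N t \<omega>"
        by (intro waiting_time_le_iff right poisson_processD(4)[OF N] t) auto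
      then show ?case by simp
    qed
  qed auto
  then show "prob {\<omega> \<in> space M. waiting_time N k \<omega> \<le> t} = ?p"
    using 1 by simp
qed

section \<open>The time-changed Poisson process\<close>

text \<open>Integrate over x first, at the argument
  \<open>\<xi> * (t / y) powr (\<beta> / \<alpha>)\<close>. Raising it to the power \<alpha> leaves
  \<open>y powr (- \<beta>)\<close>, the variable whose Laplace transform is the Mittag-Leffler
  function.\<close>

lemma laplace_time_change:
  assumes A: "stable_subordinator M \<alpha> A" and C: "stable_subordinator M \<beta> C"
    and \<alpha>: "0 < \<alpha>" and \<beta>: "0 < \<beta>"
    and J: "joint_indep M path_space (path_of A) path_space (path_of (inverse_process C))"
    and t: "0 \<le> t" and \<xi>: "0 \<le> \<xi>"
  shows "(\<integral>x. exp (- \<xi> * x) \<partial>distr M borel (time_change A (inverse_process C) t)) =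
    mittag_leffler \<beta> (- (t powr \<beta>) * \<xi> powr \<alpha>)"
proof -
  interpret prob_space M by (rule stable_subordinatorD[OF A])
  let ?a = "distr M borel (A 1)" and ?c = "distr M borel (C 1)"
  have la: "stable_law \<alpha> ?a" by (rule stable_subordinator_law[OF A \<alpha>])
  have lc: "stable_law \<beta> ?c" by (rule stable_subordinator_law[OF C \<beta>])
  interpret a: real_distribution ?a using la by (simp add: stable_law_def)
  interpret c: real_distribution ?c using lc by (simp add: stable_law_def)
  interpret ac: pair_prob_space ?a ?c ..
  have nn: "AE z in ?a \<Otimes>\<^sub>M ?c. 0 \<le> fst z"
  proof (rule ac.AE_pair_measure)
    show "{z \<in> space (?a \<Otimes>\<^sub>M ?c). 0 \<le> fst z} \<in> sets (?a \<Otimes>\<^sub>M ?c)" by measurable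
    show "AE x in ?a. AE y in ?c. 0 \<le> fst (x, y)"
      using la unfolding stable_law_def by auto
  qed
  have "(\<integral>x. exp (- \<xi> * x) \<partial>distr M borel (time_change A (inverse_process C) t)) =
     (\<integral>z. exp (- \<xi> * ((t / snd z) powr (\<beta> / \<alpha>) * fst z)) \<partial>(?a \<Otimes>\<^sub>M ?c))"
    unfolding distr_time_change(2)[OF A C \<alpha> \<beta> J t]
    by (subst integral_distr) (auto simp: case_prod_beta')
  also have "\<dots> = (\<integral>y. (\<integral>x. exp (- \<xi> * ((t / y) powr (\<beta> / \<alpha>) * x)) \<partial>?a) \<partial>?c)"
  proof -
    have "integrable (?a \<Otimes>\<^sub>M ?c) (\<lambda>(x, y). exp (- \<xi> * ((t / y) powr (\<beta> / \<alpha>) * x)))"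
      by (rule ac.P.integrable_const_bound[where B = 1])
         (use nn \<xi> in \<open>auto elim!: eventually_mono simp: case_prod_beta'\<close>)
    from ac.integral_snd[OF this] show ?thesis by (simp add: case_prod_beta')
  qed
  also have "\<dots> = (\<integral>y. exp (- (t powr \<beta> * \<xi> powr \<alpha>) * y powr (- \<beta>)) \<partial>?c)"
  proof (rule integral_cong_AE)
    show "AE y in ?c. (\<integral>x. exp (- \<xi> * ((t / y) powr (\<beta> / \<alpha>) * x)) \<partial>?a) = exp (- (t powr \<beta> * \<xi> powr \<alpha>) * y powr (- \<beta>))"
      using stable_law_pos[OF lc \<beta>]
    proof eventually_elim
      case (elim y)
      have "(\<integral>x. exp (- \<xi> * ((t / y) powr (\<beta> / \<alpha>) * x)) \<partial>?a) = (\<integral>x. exp (- (\<xi> * (t / y) powr (\<beta> / \<alpha>)) * x) \<partial>?a)"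
        by (simp add: mult_ac)
      also have "\<dots> = exp (- ((\<xi> * (t / y) powr (\<beta> / \<alpha>)) powr \<alpha>))"
        using la \<xi> unfolding stable_law_def by simp
      also have "(\<xi> * (t / y) powr (\<beta> / \<alpha>)) powr \<alpha> = t powr \<beta> * \<xi> powr \<alpha> * y powr (- \<beta>)"
        using \<xi> t elim \<alpha> by (simp add: powr_mult powr_powr powr_divide powr_minus_divide)
      finally show ?case by simp
    qed
  qed simp_all
  also have "\<dots> = mittag_leffler \<beta> (- (t powr \<beta> * \<xi> powr \<alpha>))"
    by (rule stable_law_inverse_laplace[OF lc \<beta>]) simp
  finally show ?thesis by simp
qed

lemma poisson_mixture_generating_function:
  assumes \<phi>: "real_distribution \<phi>" "AE x in \<phi>. 0 \<le> x" and lam: "0 < lam" and z: "\<bar>z\<bar> < 1"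
  shows "(\<lambda>k. (\<integral>x. exp (- (lam * x)) * (lam * x) ^ k / fact k \<partial>\<phi>) * z ^ k) sums
    (\<integral>x. exp (- (lam * (1 - z)) * x) \<partial>\<phi>)"
proof -
  interpret real_distribution \<phi> by fact
  define f where "f k x = exp (- (lam * x)) * (lam * x) ^ k / fact k * z ^ k" for k x
  \<comment> \<open>A Poisson probability is one term of an exponential series divided by its sum.
    The bound 1 leaves \<open>\<bar>z\<bar> ^ k\<close> as a majorant.\<close>
  have le1: "exp (- (lam * x)) * (lam * x) ^ k / fact k \<le> 1" if "0 \<le> x" for x k
  proof -
    have "(lam * x) ^ k / fact k \<le> exp (lam * x)"
    proof -
      have s: "(\<lambda>n. (lam * x) ^ n /\<^sub>R fact n) sums exp (lam * x)" by (rule exp_converges)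
      have "(\<Sum>n\<in>{k}. (lam * x) ^ n /\<^sub>R fact n) \<le> (\<Sum>n. (lam * x) ^ n /\<^sub>R fact n)"
        using s that lam by (intro sum_le_suminf) (auto simp: sums_iff)
      with s show ?thesis by (simp add: sums_iff divide_inverse mult.commute)
    qed
    then show ?thesis by (simp add: exp_minus field_simps)
  qed
  have bnd: "AE x in \<phi>. norm (f k x) \<le> \<bar>z\<bar> ^ k" for k
    using \<phi>(2)
  proof eventually_elim
    case (elim x)
    have "norm (f k x) = exp (- (lam * x)) * (lam * x) ^ k / fact k * \<bar>z\<bar> ^ k"
      using elim lam by (simp add: f_def abs_mult power_abs)
    also have "\<dots> \<le> 1 * \<bar>z\<bar> ^ k" by (intro mult_right_mono le1 elim) auto
    finally show ?case by simp
  qed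
  have [measurable]: "f k \<in> borel_measurable \<phi>" for k unfolding f_def by simp
  have i: "integrable \<phi> (f k)" for k by (rule integrable_const_bound[OF bnd]) simp
  have "(\<lambda>k. integral\<^sup>L \<phi> (f k)) sums (\<integral>x. (\<Sum>k. f k x) \<partial>\<phi>)"
  proof (rule sums_integral[OF i])
    have g: "summable (\<lambda>k. \<bar>z\<bar> ^ k)" using z by (intro summable_geometric) auto
    have "AE x in \<phi>. \<forall>k. norm (f k x) \<le> \<bar>z\<bar> ^ k" using bnd by (simp add: AE_all_countable)
    then show "AE x in \<phi>. summable (\<lambda>k. norm (f k x))"
      by eventually_elim (intro summable_comparison_test'[OF g], auto)
    have "(\<integral>x. norm (f k x) \<partial>\<phi>) \<le> (\<integral>x. \<bar>z\<bar> ^ k \<partial>\<phi>)" for k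
      using bnd[of k] i by (intro integral_mono_AE) auto
    then have "(\<integral>x. norm (f k x) \<partial>\<phi>) \<le> \<bar>z\<bar> ^ k" for k using prob_space by simp
    then show "summable (\<lambda>k. \<integral>x. norm (f k x) \<partial>\<phi>)"
      by (intro summable_comparison_test'[OF g]) auto
  qed
  moreover have "(\<Sum>k. f k x) = exp (- (lam * (1 - z)) * x)" for x
  proof -
    have "(\<lambda>k. exp (- (lam * x)) * ((lam * x * z) ^ k /\<^sub>R fact k)) sums (exp (- (lam * x)) * exp (lam * x * z))"
      by (intro sums_mult exp_converges)
    moreover have "exp (- (lam * x)) * ((lam * x * z) ^ k /\<^sub>R fact k) = f k x" for k
      by (simp add: f_def power_mult_distrib divide_inverse mult_ac)
    ultimately show ?thesis by (simp add: sums_iff algebra_simps flip: exp_add)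
  qed
  moreover have "integral\<^sup>L \<phi> (f k) = (\<integral>x. exp (- (lam * x)) * (lam * x) ^ k / fact k \<partial>\<phi>) * z ^ k" for k
    unfolding f_def[abs_def] by simp
  ultimately show ?thesis by simp
qed

text \<open>The counting process is read as a real-valued one so that it has a law on
  \<open>path_space\<close>; the event becomes membership in \<open>{real k}\<close>.\<close>

lemma poisson_random_time_prob:
  assumes N: "poisson_process M lam N" and lam: "0 < lam"
    and J: "joint_indep M path_space (path_of (\<lambda>t \<omega>. real (N t \<omega>))) borel R"
    and R: "\<And>\<omega>. \<omega> \<in> space M \<Longrightarrow> 0 \<le> R \<omega>"
  shows "measure M {\<omega> \<in> space M. N (R \<omega>) \<omega> = k} =
     (\<integral>x. exp (- (lam * x)) * (lam * x) ^ k / fact k \<partial>distr M borel R)"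
proof -
  interpret prob_space M by (rule poisson_processD[OF N])
  have [measurable]: "R \<in> borel_measurable M" using J by (simp add: joint_indep_def)
  have right: "continuous (at_right t) (\<lambda>t. real (N t \<omega>))" if "0 \<le> t" "\<omega> \<in> space M" for t \<omega>
    by (rule continuous_real_of_nat) (rule poisson_processD(5)[OF N that])
  have nn: "AE x in distr M borel R. 0 \<le> x" using R by (subst AE_distr_iff) auto
  have "emeasure M {\<omega> \<in> space M. N (R \<omega>) \<omega> = k} = emeasure M {\<omega> \<in> space M. real (N (R \<omega>) \<omega>) \<in> {real k}}"
    by simp
  also have "\<dots> = (\<integral>\<^sup>+r. emeasure M {\<omega> \<in> space M. real (N r \<omega>) \<in> {real k}} \<partial>distr M borel R)"
    by (rule random_time_emeasure[OF J R right]) auto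
  also have "\<dots> = (\<integral>\<^sup>+r. ennreal (exp (- (lam * r)) * (lam * r) ^ k / fact k) \<partial>distr M borel R)"
  proof (rule nn_integral_cong_AE)
    show "AE r in distr M borel R. emeasure M {\<omega> \<in> space M. real (N r \<omega>) \<in> {real k}} =
        ennreal (exp (- (lam * r)) * (lam * r) ^ k / fact k)"
      using nn by eventually_elim (simp add: emeasure_eq_measure poisson_process_prob[OF N lam])
  qed
  finally have "ennreal (prob {\<omega> \<in> space M. N (R \<omega>) \<omega> = k}) =
      (\<integral>\<^sup>+r. ennreal (exp (- (lam * r)) * (lam * r) ^ k / fact k) \<partial>distr M borel R)"
    by (simp add: emeasure_eq_measure)
  moreover have "AE r in distr M borel R. 0 \<le> exp (- (lam * r)) * (lam * r) ^ k / fact k"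
    using nn by eventually_elim (use lam in auto)
  ultimately have "has_bochner_integral (distr M borel R) (\<lambda>r. exp (- (lam * r)) * (lam * r) ^ k / fact k)
      (prob {\<omega> \<in> space M. N (R \<omega>) \<omega> = k})"
    by (intro has_bochner_integral_nn_integral) auto
  then show ?thesis by (simp only: has_bochner_integral_iff)
qed


section \<open>The time-changed process on a fixed probability space\<close>

locale fractional_poisson =
  fixes M :: "'a measure" and N :: "real \<Rightarrow> 'a \<Rightarrow> nat" and A C :: "real \<Rightarrow> 'a \<Rightarrow> real"
    and \<alpha> \<beta> lam :: real
  assumes \<alpha>: "0 < \<alpha>" "\<alpha> \<le> 1" and \<beta>: "0 < \<beta>" "\<beta> \<le> 1" and lam: "0 < lam"
    and N: "poisson_process M lam N"
    and A: "stable_subordinator M \<alpha> A" and C: "stable_subordinator M \<beta> C"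
    and indep: "prob_space.indep_vars M (\<lambda>_. path_space)
      (\<lambda>i. path_of ([A, inverse_process C, \<lambda>t \<omega>. real (N t \<omega>)] ! i)) {..<3::nat}"
begin

sublocale prob_space M by (rule poisson_processD[OF N])

abbreviation "F \<equiv> time_change A (inverse_process C)"
abbreviation "X \<equiv> time_change N F"

lemma joint_indep_A_L: "joint_indep M path_space (path_of A) path_space (path_of (inverse_process C))"
  using joint_indep_of_triple(1)[OF indep] by simp

lemmas F_nonneg = time_change_subordinator_nonneg[OF A]
lemmas F_measurable = distr_time_change(1)[OF A C \<alpha>(1) \<beta>(1) joint_indep_A_L]

text \<open>\<open>F t\<close> is the functional \<open>path_eval a (l t)\<close> of the paths of A
  and of the inverse process, and that pair is independent of N.\<close>

lemma joint_indep_N_F: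
  assumes t: "0 \<le> t"
  shows "joint_indep M path_space (path_of (\<lambda>t \<omega>. real (N t \<omega>))) borel (F t)"
proof -
  have "(\<lambda>a. a t) \<in> borel_measurable path_space"
    unfolding path_space_def by (rule measurable_component_singleton) (use t in simp)
  then have [measurable]: "(\<lambda>(a, l). path_eval a (l t)) \<in> borel_measurable (path_space \<Otimes>\<^sub>M path_space)"
    unfolding case_prod_beta'
    using measurable_compose[OF measurable_Pair measurable_path_eval, of fst "path_space \<Otimes>\<^sub>M path_space" "\<lambda>x. snd x t"]
    by (simp add: measurable_compose[OF measurable_snd])
  have "joint_indep M path_space (path_of (\<lambda>t \<omega>. real (N t \<omega>))) borel
      (\<lambda>\<omega>. path_eval (path_of A \<omega>) (path_of (inverse_process C) \<omega> t))"
    using joint_indep_of_triple(2)[OF indep, of "\<lambda>(a, l). path_eval a (l t)" borel] by simp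
  also have "?this \<longleftrightarrow> ?thesis"
  proof (rule joint_indep_cong)
    fix \<omega> assume \<omega>: "\<omega> \<in> space M"
    have "path_eval (path_of A \<omega>) (inverse_process C t \<omega>) = A (inverse_process C t \<omega>) \<omega>"
      by (rule path_eval_path_of[where X = A, OF inverse_process_nonneg
            stable_subordinatorD(5)[OF A inverse_process_nonneg \<omega>]])
    then show "path_eval (path_of A \<omega>) (path_of (inverse_process C) \<omega> t) = F t \<omega>"
      using t by (simp add: path_of_def time_change_def)
  qed
  finally show ?thesis .
qed

lemma X_prob_generating_function:
  assumes t: "0 \<le> t" and z: "\<bar>z\<bar> < 1 / 2"
  shows "(\<lambda>k. prob {\<omega> \<in> space M. X t \<omega> = k} * z ^ k) sums
    mittag_leffler \<beta> (- (t powr \<beta>) * (lam * (1 - z)) powr \<alpha>)"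
proof -
  have [measurable]: "F t \<in> borel_measurable M" by (rule F_measurable[OF t])
  have nn: "AE x in distr M borel (F t). 0 \<le> x"
    using F_nonneg by (subst AE_distr_iff) auto
  have "(\<lambda>k. (\<integral>x. exp (- (lam * x)) * (lam * x) ^ k / fact k \<partial>distr M borel (F t)) * z ^ k) sums
      (\<integral>x. exp (- (lam * (1 - z)) * x) \<partial>distr M borel (F t))"
    by (rule poisson_mixture_generating_function[OF _ nn lam]) (use z in auto)
  moreover have "prob {\<omega> \<in> space M. X t \<omega> = k} =
      (\<integral>x. exp (- (lam * x)) * (lam * x) ^ k / fact k \<partial>distr M borel (F t))" for k
    unfolding time_change_def[of N]
    by (rule poisson_random_time_prob[OF N lam joint_indep_N_F[OF t] F_nonneg])
  moreover have "(\<integral>x. exp (- (lam * (1 - z)) * x) \<partial>distr M borel (F t)) =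
      mittag_leffler \<beta> (- (t powr \<beta>) * (lam * (1 - z)) powr \<alpha>)"
    by (rule laplace_time_change[OF A C \<alpha>(1) \<beta>(1) joint_indep_A_L t]) (use lam z in auto)
  ultimately show ?thesis by simp
qed

text \<open>Both sequences have the same generating function near 0. The power of
  \<open>lam * (1 - z)\<close> splits into factors because \<open>1 - z\<close> is positive on the
  disc.\<close>

lemma X_prob: "0 \<le> t \<Longrightarrow> prob {\<omega> \<in> space M. X t \<omega> = k} = frac_pmf \<alpha> \<beta> (lam powr \<alpha>) k t"
proof (rule powser_coeff_unique[where r = "1 / 2"])
  fix z :: real assume t: "0 \<le> t" and z: "\<bar>z\<bar> < 1 / 2"
  show "(\<lambda>k. prob {\<omega> \<in> space M. X t \<omega> = k} * z ^ k) sums mittag_leffler \<beta> (- (t powr \<beta>) * (lam * (1 - z)) powr \<alpha>)"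
    by (rule X_prob_generating_function[OF t z])
  have "(\<lambda>k. frac_pmf \<alpha> \<beta> (lam powr \<alpha>) k t * z ^ k) sums
      mittag_leffler \<beta> (- (t powr \<beta>) * lam powr \<alpha> * (1 - z) powr \<alpha>)"
    by (rule frac_pmf_generating_function[OF \<alpha> \<beta>(1) _ z]) simp
  then show "(\<lambda>k. frac_pmf \<alpha> \<beta> (lam powr \<alpha>) k t * z ^ k) sums mittag_leffler \<beta> (- (t powr \<beta>) * (lam * (1 - z)) powr \<alpha>)"
    using lam z by (simp add: powr_mult mult.assoc)
qed simp

lemma X_prob_deriv:
  assumes "0 \<le> t"
  shows "(- lam) ^ k / fact k * (deriv ^^ k) (\<lambda>l. mittag_leffler \<beta> (- (t powr \<beta>) * l powr \<alpha>)) lam =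
    prob {\<omega> \<in> space M. X t \<omega> = k}"
  by (rule higher_deriv_of_generating_function[OF lam X_prob_generating_function[OF assms]])

lemma X_right_cont:
  assumes "0 \<le> t" "\<omega> \<in> space M"
  shows "continuous (at_right t) (\<lambda>t. X t \<omega>)"
  by (rule time_change_right_cont[where A = N and L = F, OF poisson_processD(5)[OF N _ assms(2)]
        F_nonneg[OF assms(2)] time_change_subordinator_right_cont[OF A assms(2)]])

lemma X_measurable:
  assumes t: "0 \<le> t"
  shows "X t \<in> measurable M (count_space UNIV)"
proof -
  have "(\<lambda>\<omega>. real (N (F t \<omega>) \<omega>)) \<in> borel_measurable M"
    by (rule random_time_measurable[OF joint_indep_N_F[OF t] F_nonneg continuous_real_of_nat])
       (auto intro: poisson_processD(5)[OF N])
  from measurable_compose[OF this, of "\<lambda>x. nat \<lfloor>x\<rfloor>" "count_space UNIV"] show ?thesis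
    by (simp add: time_change_def[abs_def])
qed

text \<open>Monotonicity holds where the inverse process avoids its default. To reach level k, take
  s with \<open>k \<le> N s\<close>, then r with \<open>s < A r\<close>: at time \<open>C r\<close>
  the inverse process is at least r, so F is at least s there.\<close>

lemma X_mono_unbounded:
  "AE \<omega> in M. mono_on {0..} (\<lambda>t. X t \<omega>) \<and> (\<forall>k. \<exists>t\<ge>0. k \<le> X t \<omega>)"
  using stable_subordinator_unbounded[OF A \<alpha>(1)] stable_subordinator_unbounded[OF C \<beta>(1)]
    poisson_process_unbounded[OF N lam] AE_space
proof eventually_elim
  case (elim \<omega>)
  note mA = monotone_onD[OF stable_subordinatorD(4)[OF A elim(4)]]
  note mN = monotone_onD[OF poisson_processD(4)[OF N elim(4)]]
  have L: "0 \<le> inverse_process C t \<omega>" for t by (rule inverse_process_nonneg)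
  have F: "0 \<le> F t \<omega>" for t by (rule F_nonneg[OF elim(4)])
  have "X t \<omega> \<le> X u \<omega>" if "t \<le> u" for t u
  proof -
    have "inverse_process C t \<omega> \<le> inverse_process C u \<omega>"
      using that elim(2) by (intro inverse_process_mono) auto
    then have "F t \<omega> \<le> F u \<omega>" using mA L by (simp add: time_change_def)
    then show ?thesis using mN F by (simp add: time_change_def[of N])
  qed
  then have "mono_on {0..} (\<lambda>t. X t \<omega>)" by (auto intro: monotone_onI)
  moreover have "\<exists>t\<ge>0. k \<le> X t \<omega>" for k
  proof -
    obtain s where s: "0 \<le> s" "k \<le> N s \<omega>" using elim(3) by blast
    obtain r where r: "0 \<le> r" "s < A r \<omega>" using elim(1) by blast
    have rL: "r \<le> inverse_process C (C r \<omega>) \<omega>"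
      using elim(2) r by (intro le_inverse_process stable_subordinatorD(4)[OF C elim(4)]) auto
    have "s \<le> F (C r \<omega>) \<omega>"
      using r mA[OF _ _ rL] L by (simp add: time_change_def)
    then have "k \<le> X (C r \<omega>) \<omega>"
      using s mN[of s "F (C r \<omega>) \<omega>"] F by (simp add: time_change_def[of N])
    moreover have "0 \<le> C r \<omega>" by (rule stable_subordinator_nonneg[OF C r(1) elim(4)])
    ultimately show ?thesis by blast
  qed
  ultimately show ?case by blast
qed

lemma waiting_time_measurable: "waiting_time X k \<in> borel_measurable M"
  by (rule measurable_waiting_time[OF X_measurable X_right_cont])

lemma waiting_time_prob:
  assumes t: "0 \<le> t"
  shows "emeasure M {\<omega> \<in> space M. waiting_time X k \<omega> \<le> t} = emeasure M {\<omega> \<in> space M. k \<le> X t \<omega>}"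
proof (rule emeasure_eq_AE)
  show "AE \<omega> in M. \<omega> \<in> {\<omega> \<in> space M. waiting_time X k \<omega> \<le> t} \<longleftrightarrow> \<omega> \<in> {\<omega> \<in> space M. k \<le> X t \<omega>}"
    using X_mono_unbounded AE_space
  proof eventually_elim
    case (elim \<omega>)
    then have "waiting_time X k \<omega> \<le> t \<longleftrightarrow> k \<le> X t \<omega>"
      using t by (intro waiting_time_le_iff X_right_cont) auto
    then show ?case by simp
  qed
  have [measurable]: "waiting_time X k \<in> borel_measurable M" by (rule waiting_time_measurable)
  show "{\<omega> \<in> space M. waiting_time X k \<omega> \<le> t} \<in> sets M" by measurable
  have [measurable]: "X t \<in> measurable M (count_space UNIV)" by (rule X_measurable[OF t])
  show "{\<omega> \<in> space M. k \<le> X t \<omega>} \<in> sets M" by measurable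
qed

lemma X_tail_prob:
  assumes t: "0 \<le> t"
  shows "emeasure M {\<omega> \<in> space M. k \<le> X t \<omega>} = ennreal (1 - (\<Sum>j<k. frac_pmf \<alpha> \<beta> (lam powr \<alpha>) j t))"
proof -
  have [measurable]: "X t \<in> measurable M (count_space UNIV)" by (rule X_measurable[OF t])
  have "{\<omega> \<in> space M. k \<le> X t \<omega>} = space M - (\<Union>j<k. {\<omega> \<in> space M. X t \<omega> = j})" by auto
  then have "prob {\<omega> \<in> space M. k \<le> X t \<omega>} = 1 - prob (\<Union>j<k. {\<omega> \<in> space M. X t \<omega> = j})"
    by (simp add: prob_compl)
  also have "prob (\<Union>j<k. {\<omega> \<in> space M. X t \<omega> = j}) = (\<Sum>j<k. prob {\<omega> \<in> space M. X t \<omega> = j})"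
    by (rule finite_measure_finite_Union) (auto simp: disjoint_family_on_def)
  finally show ?thesis by (simp add: emeasure_eq_measure X_prob[OF t])
qed

text \<open>The tail \<open>1 - (p_0 + ... + p_(k-1))\<close> is the distribution function on
  nonnegative times, and its derivative has already been put into the form of the density.\<close>

lemma waiting_time_distributed:
  assumes k: "1 \<le> k"
  shows "distributed M lborel (waiting_time X k)
    (\<lambda>t. ennreal (if 0 < t then \<beta> * real k / (\<alpha> * t) * frac_pmf \<alpha> \<beta> (lam powr \<alpha>) k t else 0))"
    (is "distributed M lborel _ (\<lambda>t. ennreal (?f t))")
proof (rule distributedI_borel_atMost[where g = "\<lambda>a. if 0 \<le> a then 1 - (\<Sum>j<k. frac_pmf \<alpha> \<beta> (lam powr \<alpha>) j a) else 0"])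
  let ?p = "frac_pmf \<alpha> \<beta> (lam powr \<alpha>)"
  let ?h = "\<lambda>a. 1 - (\<Sum>j<k. ?p j a)"
  show "waiting_time X k \<in> borel_measurable M" by (rule waiting_time_measurable)
  have [measurable]: "?p j \<in> borel_measurable borel" for j
    unfolding frac_pmf_def ml_series_def[abs_def] by (intro borel_measurable_suminf) simp
  show "?f \<in> borel_measurable borel" by measurable
  \<comment> \<open>The sign of the alternating series is obtained from its identification with a
    probability.\<close>
  have p0: "0 \<le> ?p j t" if "0 \<le> t" for j t using X_prob[OF that, of j] by (metis measure_nonneg)
  have f0: "0 \<le> ?f t" for t using p0[of t k] \<alpha> \<beta> by auto
  then show "AE t in lborel. 0 \<le> ?f t" by simp
  fix a :: real
  show "(\<integral>\<^sup>+t. ennreal (?f t * indicator {..a} t) \<partial>lborel) = ennreal (if 0 \<le> a then ?h a else 0)"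
  proof (cases "0 \<le> a")
    case True
    have "((\<lambda>t. ?f t) has_integral (?h a - ?h 0)) {0..a}"
    \<comment> \<open>The derivative formula is established for t > 0, where the density has no
      singularity; continuity of the tail at 0 allows the integral to start there.\<close>
    proof (rule fundamental_theorem_of_calculus_interior[OF True])
      show "continuous_on {0..a} ?h"
        using \<alpha> \<beta> by (intro continuous_intros continuous_on_subset[OF continuous_on_frac_pmf]) auto
      show "(?h has_vector_derivative ?f t) (at t)" if "t \<in> {0<..<a}" for t
        using has_real_derivative_frac_tail[OF \<alpha> \<beta>(1) _ k, of "lam powr \<alpha>" t] that
        by (simp add: has_real_derivative_iff_has_vector_derivative[symmetric])
    qed
    moreover have "?h 0 = 0"
    proof -
      have "(\<Sum>j<k. ?p j 0) = (\<Sum>j\<in>{0}. ?p j 0)"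
        using k \<beta> by (intro sum.mono_neutral_right) (auto simp: frac_pmf_0)
      then show ?thesis using \<beta> by (simp add: frac_pmf_0)
    qed
    ultimately have "(\<integral>\<^sup>+t. ennreal (?f t) * indicator {0..a} t \<partial>lborel) = ennreal (?h a)"
      using f0 by (intro nn_integral_has_integral_lebesgue') auto
    moreover have "(\<integral>\<^sup>+t. ennreal (?f t * indicator {..a} t) \<partial>lborel) = (\<integral>\<^sup>+t. ennreal (?f t) * indicator {0..a} t \<partial>lborel)"
      by (intro nn_integral_cong) (auto simp: indicator_def)
    ultimately show ?thesis using True by simp
  next
    case False
    then have "?f t * indicator {..a} t = 0" for t by (auto simp: indicator_def)
    then show ?thesis using False by (simp only: if_False) simp
  qed
  show "emeasure M {\<omega> \<in> space M. waiting_time X k \<omega> \<le> a} = ennreal (if 0 \<le> a then ?h a else 0)"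
  proof (cases "0 \<le> a")
    case True
    then show ?thesis using waiting_time_prob[OF True] X_tail_prob[OF True] by simp
  next
    case False
    then have "{\<omega> \<in> space M. waiting_time X k \<omega> \<le> a} = {}"
      using waiting_time_nonneg[of X k] by (auto simp: not_le intro: order_trans less_le_trans)
    then have "emeasure M {\<omega> \<in> space M. waiting_time X k \<omega> \<le> a} = 0" by (simp only: emeasure_empty)
    then show ?thesis using False by simp
  qed
qed

end

text \<open>With \<tau> the law of T_k and \<phi> that of F_t, the set of pairs (s, x) with s \<le>
  x is measured in both orders under the product. Sections at x give the probability of
  \<open>k \<le> N (F t)\<close>; sections at s give F_t \<ge> s, which duality turns into F'_s
  \<le> t, hence F' at the time T_k.\<close>

lemma (in fractional_poisson) waiting_time_distr_eq:
  fixes M' :: "'b measure"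
  assumes N': "poisson_process M' lam N'"
    and A': "stable_subordinator M' \<beta> A'" and C': "stable_subordinator M' \<alpha> C'"
    and J': "joint_indep M' path_space (path_of A') path_space (path_of (inverse_process C'))"
    and K': "joint_indep M' path_space (path_of (time_change A' (inverse_process C'))) borel (waiting_time N' k)"
  shows "distr M borel (waiting_time X k) =
    distr M' borel (\<lambda>\<omega>. time_change A' (inverse_process C') (waiting_time N' k \<omega>) \<omega>)"
proof -
  define F' where "F' = time_change A' (inverse_process C')"
  define T' where "T' = waiting_time N' k"
  interpret M': prob_space M' by (rule poisson_processD[OF N'])
  let ?R = "\<lambda>\<omega>. F' (T' \<omega>) \<omega>"
  have K: "joint_indep M' path_space (path_of F') borel T'" using K' by (simp add: F'_def T'_def)
  have T'm [measurable]: "T' \<in> borel_measurable M'" unfolding T'_def by (rule waiting_time_law[OF N' lam])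
  have T'0: "0 \<le> T' \<omega>" for \<omega> unfolding T'_def by (rule waiting_time_nonneg)
  have Tm [measurable]: "waiting_time X k \<in> borel_measurable M" by (rule waiting_time_measurable)
  have F'r: "continuous (at_right t) (\<lambda>t. F' t \<omega>)" if "\<omega> \<in> space M'" for t \<omega>
    unfolding F'_def by (rule time_change_subordinator_right_cont[OF A' that])
  have F'0: "0 \<le> F' t \<omega>" if "\<omega> \<in> space M'" for t \<omega>
    unfolding F'_def by (rule time_change_subordinator_nonneg[OF A' that])
  have F'm [measurable]: "F' s \<in> borel_measurable M'" if "0 \<le> s" for s
    unfolding F'_def by (rule distr_time_change(1)[OF A' C' \<beta>(1) \<alpha>(1) J' that])
  have Rm [measurable]: "?R \<in> borel_measurable M'"
    by (rule M'.random_time_measurable[OF K T'0 F'r])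
  let ?a = "distr M borel (A 1)" and ?c = "distr M borel (C 1)"
  have a: "stable_law \<alpha> ?a" by (rule stable_subordinator_law[OF A \<alpha>(1)])
  have c: "stable_law \<beta> ?c" by (rule stable_subordinator_law[OF C \<beta>(1)])
  \<comment> \<open>The roles are exchanged: A' has index \<beta> and shares its law with C, while
    C' shares its law with A. Uniqueness of stable laws carries this from one probability space to
    the other.\<close>
  have eqs: "distr M' borel (A' 1) = ?c" "distr M' borel (C' 1) = ?a"
    by (rule stable_law_unique[OF stable_subordinator_law c] stable_law_unique[OF stable_subordinator_law a], fact, fact \<alpha> \<beta>)+
  let ?\<tau> = "distr M' borel T'"
  interpret \<tau>: prob_space ?\<tau> by (rule M'.prob_space_distr) simp
  have \<tau>0: "AE s in ?\<tau>. 0 \<le> s" using T'0 by (subst AE_distr_iff) auto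
  have cdf_eq: "emeasure M {\<omega> \<in> space M. waiting_time X k \<omega> \<le> t} = emeasure M' {\<omega> \<in> space M'. F' (T' \<omega>) \<omega> \<le> t}"
    if t: "0 \<le> t" for t
  proof -
    have [measurable]: "F t \<in> borel_measurable M" by (rule F_measurable[OF t])
    let ?\<phi> = "distr M borel (F t)"
    interpret \<phi>: prob_space ?\<phi> by (rule prob_space_distr) simp
    interpret P: pair_sigma_finite ?\<tau> ?\<phi> ..
    have \<phi>0: "AE x in ?\<phi>. 0 \<le> x" using F_nonneg by (subst AE_distr_iff) auto
    have "emeasure M {\<omega> \<in> space M. waiting_time X k \<omega> \<le> t} = emeasure M {\<omega> \<in> space M. real (N (F t \<omega>) \<omega>) \<in> {real k..}}"
      using waiting_time_prob[OF t, of k] by (simp add: time_change_def[of N])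
    also have "\<dots> = (\<integral>\<^sup>+x. emeasure M {\<omega> \<in> space M. real (N x \<omega>) \<in> {real k..}} \<partial>?\<phi>)"
      by (rule random_time_emeasure[OF joint_indep_N_F[OF t] F_nonneg continuous_real_of_nat])
         (auto intro: poisson_processD(5)[OF N])
    also have "\<dots> = (\<integral>\<^sup>+x. emeasure ?\<tau> {..x} \<partial>?\<phi>)"
    proof (rule nn_integral_cong_AE)
      show "AE x in ?\<phi>. emeasure M {\<omega> \<in> space M. real (N x \<omega>) \<in> {real k..}} = emeasure ?\<tau> {..x}"
        using \<phi>0
      proof eventually_elim
        case (elim x)
        have "emeasure ?\<tau> {..x} = emeasure M' {\<omega> \<in> space M'. T' \<omega> \<le> x}"
          by (subst emeasure_distr) (auto intro!: arg_cong[where f = "emeasure M'"])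
        then show ?case
          using waiting_time_law(2)[OF N' lam elim, of k] waiting_time_law(3)[OF N lam elim, of k]
          by (simp add: emeasure_eq_measure M'.emeasure_eq_measure T'_def)
      qed
    qed
    also have "\<dots> = emeasure (?\<tau> \<Otimes>\<^sub>M ?\<phi>) {z. fst z \<le> snd z}"
    proof -
      have "{z \<in> space (?\<tau> \<Otimes>\<^sub>M ?\<phi>). fst z \<le> snd z} \<in> sets (?\<tau> \<Otimes>\<^sub>M ?\<phi>)" by measurable
      then have m: "{z :: real \<times> real. fst z \<le> snd z} \<in> sets (?\<tau> \<Otimes>\<^sub>M ?\<phi>)" by (simp add: space_pair_measure)
      have "(\<lambda>s. (s, x)) -` {z. fst z \<le> snd z} = {..x}" for x :: real by auto
      with P.emeasure_pair_measure_alt2[OF m] show ?thesis by simp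
    qed
    also have "\<dots> = (\<integral>\<^sup>+s. emeasure ?\<phi> {s..} \<partial>?\<tau>)"
    proof -
      have "{z \<in> space (?\<tau> \<Otimes>\<^sub>M ?\<phi>). fst z \<le> snd z} \<in> sets (?\<tau> \<Otimes>\<^sub>M ?\<phi>)" by measurable
      then have m: "{z :: real \<times> real. fst z \<le> snd z} \<in> sets (?\<tau> \<Otimes>\<^sub>M ?\<phi>)" by (simp add: space_pair_measure)
      have "Pair s -` {z. fst z \<le> snd z} = {s..}" for s :: real by auto
      with \<phi>.emeasure_pair_measure_alt[OF m] show ?thesis by simp
    qed
    also have "\<dots> = (\<integral>\<^sup>+s. emeasure M' {\<omega> \<in> space M'. F' s \<omega> \<in> {..t}} \<partial>?\<tau>)"
    proof (rule nn_integral_cong_AE)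
      show "AE s in ?\<tau>. emeasure ?\<phi> {s..} = emeasure M' {\<omega> \<in> space M'. F' s \<omega> \<in> {..t}}"
        using \<tau>0
      proof eventually_elim
        case (elim s)
        have "emeasure ?\<phi> {s..} = emeasure (distr (?a \<Otimes>\<^sub>M ?c) borel (\<lambda>(x, y). (t / y) powr (\<beta> / \<alpha>) * x)) {s..}"
          by (simp only: distr_time_change(2)[OF A C \<alpha>(1) \<beta>(1) joint_indep_A_L t])
        also have "\<dots> = emeasure (distr (?c \<Otimes>\<^sub>M ?a) borel (\<lambda>(y, x). (s / x) powr (\<alpha> / \<beta>) * y)) {..t}"
          by (rule stable_product_duality[OF a c \<alpha>(1) \<beta>(1) elim t])
        also have "\<dots> = emeasure (distr M' borel (F' s)) {..t}"
          unfolding F'_def distr_time_change(2)[OF A' C' \<beta>(1) \<alpha>(1) J' elim] eqs ..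
        also have "\<dots> = emeasure M' {\<omega> \<in> space M'. F' s \<omega> \<in> {..t}}"
          using elim by (subst emeasure_distr) (auto intro!: arg_cong[where f = "emeasure M'"])
        finally show ?case .
      qed
    qed
    also have "\<dots> = emeasure M' {\<omega> \<in> space M'. F' (T' \<omega>) \<omega> \<in> {..t}}"
      by (rule M'.random_time_emeasure[OF K T'0 F'r, symmetric]) auto
    finally show ?thesis by simp
  qed
  have "distr M borel (waiting_time X k) = distr M' borel ?R"
  proof (rule cdf_unique[OF _ _ ext])
    fix t :: real
    have l: "cdf (distr M borel (waiting_time X k)) t = prob {\<omega> \<in> space M. waiting_time X k \<omega> \<le> t}"
      unfolding cdf_def by (subst measure_distr) (auto intro!: arg_cong[where f = prob])
    have r: "cdf (distr M' borel ?R) t = M'.prob {\<omega> \<in> space M'. F' (T' \<omega>) \<omega> \<le> t}"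
      unfolding cdf_def by (subst measure_distr) (auto intro!: arg_cong[where f = "M'.prob"])
    show "cdf (distr M borel (waiting_time X k)) t = cdf (distr M' borel ?R) t"
    proof (cases "0 \<le> t")
      case True
      then show ?thesis unfolding l r using cdf_eq[OF True] by (simp add: measure_def)
    next
      case False
      then have "{\<omega> \<in> space M. waiting_time X k \<omega> \<le> t} = {}" "{\<omega> \<in> space M'. F' (T' \<omega>) \<omega> \<le> t} = {}"
        using waiting_time_nonneg[of X k] F'0 by (auto simp: not_le intro: less_le_trans)
      then show ?thesis unfolding l r by (simp only: measure_empty)
    qed
  qed (auto intro: prob_space.real_distribution_distr)
  then show ?thesis by (simp add: F'_def T'_def)
qed

text \<open>Being the solution is read as existence together with uniqueness among families
  continuous on \<open>[0, \<infinity>)\<close>. The identity in law ranges over all copies of the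
  processes on a second probability space, since it compares laws only.\<close>

theorem theorem2:
  fixes M :: "'a measure"
    and N :: "real \<Rightarrow> 'a \<Rightarrow> nat"
    and A C L F :: "real \<Rightarrow> 'a \<Rightarrow> real"
    and \<alpha> \<beta> lam :: real
    and p q :: "nat \<Rightarrow> real \<Rightarrow> real"
  assumes "0 < \<alpha>" "\<alpha> \<le> 1" "0 < \<beta>" "\<beta> \<le> 1" "0 < lam"
    and "poisson_process M lam N"
    and "stable_subordinator M \<alpha> A"
    and "stable_subordinator M \<beta> C"
    and "L = inverse_process C"
    and "prob_space.indep_vars M (\<lambda>_. path_space)
           (\<lambda>i. path_of ([A, L, \<lambda>t \<omega>. real (N t \<omega>)] ! i)) {..<3::nat}"
    and "F = time_change A L"
    and p: "\<And>k t. p k t = measure M {\<omega> \<in> space M. time_change N F t \<omega> = k}"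
    and q: "\<And>k t. q k t = (- lam) ^ k / fact k *
              (deriv ^^ k) (\<lambda>l. mittag_leffler \<beta> (- (t powr \<beta>) * l powr \<alpha>)) lam"
  shows "(\<forall>k. \<forall>t>0. p k t = q k t) \<and>
    solves_frac_cauchy \<alpha> \<beta> lam p \<and>
    (\<forall>u. solves_frac_cauchy \<alpha> \<beta> lam u \<longrightarrow> (\<forall>k. \<forall>t\<ge>0. u k t = p k t)) \<and>
    (\<forall>k\<ge>1.
       distributed M lborel (waiting_time (time_change N F) k)
         (\<lambda>t. if 0 < t then ennreal (\<beta> * real k / (\<alpha> * t) * q k t) else 0) \<and>
       (\<forall>t>0. \<beta> * real k / (\<alpha> * t) * q k t = \<beta> * real k / (\<alpha> * t) * p k t) \<and>
       (\<forall>(M' :: 'b measure) N' A' C' L' F'.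
          poisson_process M' lam N' \<and>
          stable_subordinator M' \<beta> A' \<and>
          stable_subordinator M' \<alpha> C' \<and>
          L' = inverse_process C' \<and>
          prob_space.indep_var M' path_space (path_of A') path_space (path_of L') \<and>
          F' = time_change A' L' \<and>
          indep_elements M' path_space (path_of F') borel (waiting_time N' k) \<longrightarrow>
          distr M borel (waiting_time (time_change N F) k) =
          distr M' borel (\<lambda>\<omega>. F' (waiting_time N' k \<omega>) \<omega>)))"
proof -
  let ?p = "frac_pmf \<alpha> \<beta> (lam powr \<alpha>)"
  interpret fractional_poisson M N A C \<alpha> \<beta> lam
    using assms by unfold_locales auto
  have F: "F = time_change A (inverse_process C)" and L: "L = inverse_process C"
    using assms by auto
  have pX: "p k t = ?p k t" if "0 \<le> t" for k t
    using X_prob[OF that, of k] by (simp add: p F L)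
  have qX: "q k t = ?p k t" if "0 \<le> t" for k t
    unfolding q X_prob_deriv[OF that] by (rule X_prob[OF that])
  have sol: "solves_frac_cauchy \<alpha> \<beta> lam ?p"
    using \<alpha> \<beta> by (intro frac_pmf_solves_frac_cauchy) auto
  have law: "distr M borel (waiting_time (time_change N F) k) = distr M' borel (\<lambda>\<omega>. F' (waiting_time N' k \<omega>) \<omega>)"
    if "poisson_process M' lam N' \<and> stable_subordinator M' \<beta> A' \<and> stable_subordinator M' \<alpha> C' \<and>
        L' = inverse_process C' \<and>
        prob_space.indep_var M' path_space (path_of A') path_space (path_of L') \<and>
        F' = time_change A' L' \<and>
        indep_elements M' path_space (path_of F') borel (waiting_time N' k)"
    for k and M' :: "'b measure" and N' A' C' L' F'
  proof -
    interpret M': prob_space M' using that by (auto simp: poisson_process_def)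
    show ?thesis
      using waiting_time_distr_eq[of M' N' A' C' k] that
        M'.joint_indep_of_indep_var[of path_space "path_of A'" path_space "path_of L'"]
        M'.joint_indep_of_indep_elements[of path_space "path_of F'" borel "waiting_time N' k"]
      by (auto simp: F)
  qed
  have dens: "distributed M lborel (waiting_time (time_change N F) k)
      (\<lambda>t. if 0 < t then ennreal (\<beta> * real k / (\<alpha> * t) * q k t) else 0)" if "1 \<le> k" for k
  proof -
    have "(\<lambda>t. if 0 < t then ennreal (\<beta> * real k / (\<alpha> * t) * q k t) else 0) =
        (\<lambda>t. ennreal (if 0 < t then \<beta> * real k / (\<alpha> * t) * ?p k t else 0))"
      by (auto simp: fun_eq_iff qX)
    then show ?thesis using waiting_time_distributed[OF that] by (simp only: F)
  qed
  have psol: "solves_frac_cauchy \<alpha> \<beta> lam p"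
    by (rule solves_frac_cauchy_cong[OF pX sol])
  have uniq: "u k t = p k t" if "solves_frac_cauchy \<alpha> \<beta> lam u" "0 \<le> t" for u k t
    by (rule frac_cauchy_unique[OF \<beta> that(1) psol that(2)])
  have pq: "q k t = p k t" if "0 < t" for k t using pX qX that by simp
  show ?thesis
  proof (intro conjI allI impI)
    show "solves_frac_cauchy \<alpha> \<beta> lam p" by (rule psol)
    show "p k t = q k t" if "0 < t" for k t using pq[OF that] by simp
    show "\<beta> * real k / (\<alpha> * t) * q k t = \<beta> * real k / (\<alpha> * t) * p k t" if "0 < t" for k t
      using pq[OF that] by simp
  qed (fact uniq dens | rule law, assumption)+
qed

end
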